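(* Consider the linear relaxation system $U_t+AU_x=\frac1\epsilon QU$ ($x>0$, $t>0$) with boundary condition $BU(0,t)=b(t)$, in the block form and under the standing assumptions given in the context, and the boundary AP scheme given in the context, in the stiff regime $\epsilon\le\tau$. Let the ratio $\lambda=\tau/h>0$ be fixed. (i) (Limiting scheme.) For fixed $\tau,h$, let $U_j^n=(u_j^n,v_j^n)$ (depending on $\epsilon$) solve the scheme for each small $\epsilon>0$, with initial data satisfying $v_j^0=0$ for $j\ge1$, and suppose that for every $j,n\ge0$ it converges as $\epsilon\to0$. Then the limit, again denoted $(u_j^n,v_j^n)$, satisfies for all $n\ge0$: $$u_1^{n+1}-u_1^n+\lambda A_{11}^+\big(u_1^n-u_0^n-A_{11}^{-1}A_{12}v_0^n\big)+\lambda A_{11}^-(u_2^n-u_1^n)=0,$$ $$u_j^{n+1}-u_j^n+\lambda A_{11}^+(u_j^n-u_{j-1}^n)+\lambda A_{11}^-(u_{j+1}^n-u_j^n)=0,\qquad j\ge2,$$ $$v_j^{n+1}=0,\qquad j\ge1,$$ $$L_+^Hv_0^{n+1}=0,$$ $$L_-^1(u_0^{n+1}-u_0^n)+\lambda L_-^1\big[A_{11}(u_1^n-u_0^n)+A_{12}(v_1^n-v_0^n)\big]=0,$$ $$B_uu_0^{n+1}+B_vv_0^{n+1}=b^{n+1}.$$ (ii) (Consistency with the asymptotic limit.) Let $(u_{lim},v_{lim})(x_j,t_n)$ be the grid values of the asymptotic limit described in the context. Inserted into this limiting scheme in place of $(u_j^n,v_j^n)$, they satisfy the first two equations ($j=1$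 and $j\ge2$) up to a residual $O(\tau^2)$, the fifth equation (the one involving $L_-^1$, at $j=0$) up to a residual $O(\tau)$, and the remaining equations ($v_j^{n+1}=0$ for $j\ge1$, $L_+^Hv_0^{n+1}=0$, and the boundary condition) exactly. That is, the limiting scheme is a first-order scheme for the asymptotic limit of the initial-boundary value problem.
   Context: **System.** $U=(u,v)^T\in\mathbb{R}^n$ with $u\in\mathbb{R}^{n-r}$, $v\in\mathbb{R}^r$; $$A=\begin{pmatrix} A_{11} & A_{12} \\ A_{21} & A_{22} \end{pmatrix},\qquad Q=\begin{pmatrix} 0 & 0 \\ 0 & S \end{pmatrix},\qquad B=(B_u,B_v),$$ constant real matrices in matching block form, $S$ an $r\times r$ negative-definite matrix, and $B$ of size $n_+\times n$ with $n_+$ the number of positive eigenvalues of $A$. Standing assumptions: the relaxation system and its equilibrium system $\bar u_t+A_{11}\bar u_x=0$ are hyperbolic ($A$ and $A_{11}$ are diagonalizable with real eigenvalues); the boundary is non-characteristic for both ($A$ and $A_{11}$ are invertible). Put $X=(A_{22}-A_{21}A_{11}^{-1}A_{12})^{-1}$ and $H=XS$; $H$ has no eigenvalue on the imaginary axis. **Stable/unstable matrices.** For a square matrix $N$ without purely imaginary eigenvalues, a right-unstable matrix $R_+^N$ (resp. right-stable matrix $R_-^N$) is a full-rank matrix whose columns span the invariant subspace of $N$ associated with the eigenvalues of positive (resp. negative) real part. Left-unstable/left-stable matrices $L_+^N,L_-^N$ are defined by $\begin{pmatrix} L_+^N \\ L_-^N \end{pmatrix}(R_+^N,R_-^N)=I$.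 The superscript $1$ denotes $N=A_{11}$ (with the columns of $R_\pm^1$ chosen to be eigenvectors), so that $A_{11}R_\pm^1=R_\pm^1\Lambda_\pm^1$ with $\Lambda_+^1$, $\Lambda_-^1$ the diagonal matrices of positive, negative eigenvalues of $A_{11}$; the superscript $H$ denotes $N=H$. Put $A_{11}^\pm=A_{11}R_\pm^1L_\pm^1=R_\pm^1\Lambda_\pm^1L_\pm^1$. **Scheme.** Grid $x_j=jh$, $t_n=n\tau$, $j,n\ge0$; $\lambda=\tau/h$; $b^n=b(t_n)$; $U_j^n=(u_j^n,v_j^n)^T$. Let $R_\pm=R_\pm^A$ if $\tau<\epsilon$, and $R_\pm=R_\pm^\infty$ if $\tau\ge\epsilon$, where $$R_\pm^\infty=\begin{pmatrix} I_{n-r} & -A_{11}^{-1}A_{12} \\ 0 & I_r \end{pmatrix}\begin{pmatrix} R_\pm^1 & 0 \\ 0 & R_\mp^H \end{pmatrix},$$ and define $L_\pm$ by $\begin{pmatrix} L_+ \\ L_- \end{pmatrix}(R_+,R_-)=I$. The scheme is, for $n\ge0$, $$U_j^{n+1}-U_j^n+\lambda AR_+L_+(U_j^n-U_{j-1}^n)+\lambda AR_-L_-(U_{j+1}^n-U_j^n)=\frac\tau\epsilon QU_j^{n+1},\quad j\ge1,$$ $$L_-A^{-1}(U_0^{n+1}-U_0^n)+\lambda L_-(U_1^n-U_0^n)=\frac\tau\epsilon L_-A^{-1}QU_0^{n+1},\qquad BU_0^{n+1}=b^{n+1}.$$ **Asymptotic limit.** $\bar u(x,t)$ (on $x\ge0,t\ge0$)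 and $\nu(0,t)$ are smooth functions satisfying $$\bar u_t+A_{11}\bar u_x=0,\qquad L_+^H\nu(0,t)=0,\qquad B_u\bar u(0,t)+(B_v-B_uA_{11}^{-1}A_{12})\nu(0,t)=b(t).$$ The grid values of the limit are $(u_{lim},v_{lim})(x_0,t_n)=(\bar u_0^n-A_{11}^{-1}A_{12}\nu_0^n,\ \nu_0^n)$ and $(u_{lim},v_{lim})(x_j,t_n)=(\bar u_j^n,\ 0)$ for $j\ge1$, where $\bar u_j^n=\bar u(x_j,t_n)$ and $\nu_0^n=\nu(0,t_n)$. The $O(\cdot)$ bounds are as $\tau\to0$ with $\lambda=\tau/h$ fixed, uniform for $(x_j,t_n)$ in compact subsets of $[0,\infty)\times[0,\infty)$. *)

theory Defs
  imports
    "HOL-Analysis.Euclidean_Space"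
    "Jordan_Normal_Form.Char_Poly"
    "Jordan_Normal_Form.Gauss_Jordan_Elimination"
    "Jordan_Normal_Form.DL_Rank"
    "Jordan_Normal_Form.Matrix_Kernel"
begin

text \<open>
  Matrices and vectors are those of Jordan_Normal_Form, whose dimensions are natural numbers.
  Unstable and stable subspaces may be trivial, so matrices with zero columns or rows are needed.
\<close>

text \<open>Only meaningful for invertible \<open>A\<close>.\<close>

definition minv :: "real mat \<Rightarrow> real mat" where
  "minv A = the (mat_inverse A)"

definition append_cols :: "real mat \<Rightarrow> real mat \<Rightarrow> real mat" where
  "append_cols A B = four_block_mat A B (0\<^sub>m 0 (dim_col A)) (0\<^sub>m 0 (dim_col B))"

definition real_diagonalizable :: "real mat \<Rightarrow> bool" where
  "real_diagonalizable A \<longleftrightarrow> (\<exists>D. similar_mat A D \<and> diagonal_mat D)"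

text \<open>Eigenvalues are counted with algebraic multiplicity.\<close>

definition num_pos_eigenvalues :: "real mat \<Rightarrow> nat" where
  "num_pos_eigenvalues A = size (filter_mset (\<lambda>x. 0 < x) (proots (char_poly A)))"

text \<open>Symmetry is not required.\<close>

definition negative_definite :: "nat \<Rightarrow> real mat \<Rightarrow> bool" where
  "negative_definite r S \<longleftrightarrow> S \<in> carrier_mat r r \<and>
     (\<forall>x\<in>carrier_vec r. x \<noteq> 0\<^sub>v r \<longrightarrow> x \<bullet> (S *\<^sub>v x) < 0)"

abbreviation cmat :: "real mat \<Rightarrow> complex mat" where
  "cmat N \<equiv> map_mat complex_of_real N"

text \<open>
  The real vectors lying in the sum of the complex generalized eigenspaces of \<open>N\<close> for the
  eigenvalues in \<open>Z\<close>; the exponent \<open>dim_row N\<close> exhausts each generalized eigenspace.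
\<close>

definition spectral_subspace :: "complex set \<Rightarrow> real mat \<Rightarrow> real vec set" where
  "spectral_subspace Z N =
     {x \<in> carrier_vec (dim_row N).
        map_vec complex_of_real x \<in> LinearCombinations.module.span class_ring
          (module_vec TYPE(complex) (dim_row N))
          (\<Union>e\<in>{e \<in> Z. eigenvalue (cmat N) e}. mat_kernel (char_matrix (cmat N) e ^\<^sub>m dim_row N))}"

definition right_basis_matrix :: "complex set \<Rightarrow> real mat \<Rightarrow> real mat \<Rightarrow> bool" where
  "right_basis_matrix Z N R \<longleftrightarrow> dim_row R = dim_row N \<and>
     vec_space.rank (dim_row N) R = dim_col R \<and>
     vec_space.col_space (dim_row N) R = spectral_subspace Z N"

definition right_unstable :: "real mat \<Rightarrow> real mat \<Rightarrow> bool" where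
  "right_unstable = right_basis_matrix {z. Re z > 0}"

definition right_stable :: "real mat \<Rightarrow> real mat \<Rightarrow> bool" where
  "right_stable = right_basis_matrix {z. Re z < 0}"

definition columns_are_eigenvectors :: "real mat \<Rightarrow> real mat \<Rightarrow> bool" where
  "columns_are_eigenvectors N R \<longleftrightarrow> (\<forall>j<dim_col R. \<exists>e. eigenvector N (col R j) e)"

definition left_matrices :: "real mat \<Rightarrow> real mat \<Rightarrow> real mat \<Rightarrow> real mat \<Rightarrow> bool" where
  "left_matrices Rp Rm Lp Lm \<longleftrightarrow>
     Lp \<in> carrier_mat (dim_col Rp) (dim_row Rp) \<and>
     Lm \<in> carrier_mat (dim_col Rm) (dim_row Rm) \<and>
     (Lp @\<^sub>r Lm) * append_cols Rp Rm = 1\<^sub>m (dim_col Rp + dim_col Rm)"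

text \<open>With \<open>(R1, RH) = (R\<^sub>+\<^sup>1, R\<^sub>-\<^sup>H)\<close> this is \<open>R\<^sub>+\<^sup>\<infinity>\<close>, with \<open>(R\<^sub>-\<^sup>1, R\<^sub>+\<^sup>H)\<close> it is \<open>R\<^sub>-\<^sup>\<infinity>\<close>.\<close>

definition R_infinity :: "real mat \<Rightarrow> real mat \<Rightarrow> real mat \<Rightarrow> real mat \<Rightarrow> real mat" where
  "R_infinity A11 A12 R1 RH =
     (let m = dim_row R1; r = dim_row RH in
      four_block_mat (1\<^sub>m m) (- (minv A11 * A12)) (0\<^sub>m r m) (1\<^sub>m r) *
      four_block_mat R1 (0\<^sub>m m (dim_col RH)) (0\<^sub>m r (dim_col R1)) RH)"

text \<open>
  A grid function has the arguments \<open>j\<close> (space), \<open>n\<close> (time). \<open>WA\<close> and \<open>Winf\<close> are the quadruples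
  \<open>(R\<^sub>+, R\<^sub>-, L\<^sub>+, L\<^sub>-)\<close> used for \<open>\<tau> < \<epsilon>\<close> and \<open>\<tau> \<ge> \<epsilon>\<close>.
\<close>

type_synonym frame = "real mat \<times> real mat \<times> real mat \<times> real mat"

definition ap_scheme ::
  "real mat \<Rightarrow> real mat \<Rightarrow> real mat \<Rightarrow> (real \<Rightarrow> real vec) \<Rightarrow> frame \<Rightarrow> frame \<Rightarrow>
   real \<Rightarrow> real \<Rightarrow> real \<Rightarrow> (nat \<Rightarrow> nat \<Rightarrow> real vec) \<Rightarrow> bool" where
  "ap_scheme A Q B b WA Winf \<tau> h \<epsilon> U \<longleftrightarrow>
     (let (Rp, Rm, Lp, Lm) = (if \<tau> < \<epsilon> then WA else Winf); lam = \<tau> / h in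
       (\<forall>n. \<forall>j\<ge>1.
          U j (n+1) - U j n
          + lam \<cdot>\<^sub>v ((A * Rp * Lp) *\<^sub>v (U j n - U (j-1) n))
          + lam \<cdot>\<^sub>v ((A * Rm * Lm) *\<^sub>v (U (j+1) n - U j n))
          = (\<tau> / \<epsilon>) \<cdot>\<^sub>v (Q *\<^sub>v U j (n+1))) \<and>
       (\<forall>n.
          (Lm * minv A) *\<^sub>v (U 0 (n+1) - U 0 n) + lam \<cdot>\<^sub>v (Lm *\<^sub>v (U 1 n - U 0 n))
          = (\<tau> / \<epsilon>) \<cdot>\<^sub>v ((Lm * minv A * Q) *\<^sub>v U 0 (n+1))) \<and>
       (\<forall>n. B *\<^sub>v U 0 (n+1) = b (real (n+1) * \<tau>)))"

text \<open>Left-hand sides of the limiting scheme at \<open>j = 1\<close>, at \<open>j \<ge> 2\<close>, and of its \<open>L\<^sub>-\<^sup>1\<close> equation.\<close>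

definition first_cell_residual ::
  "real mat \<Rightarrow> real mat \<Rightarrow> real mat \<Rightarrow> real mat \<Rightarrow> real \<Rightarrow>
   (nat \<Rightarrow> nat \<Rightarrow> real vec) \<Rightarrow> (nat \<Rightarrow> nat \<Rightarrow> real vec) \<Rightarrow> nat \<Rightarrow> real vec" where
  "first_cell_residual A11 A12 A11p A11m lam u v n =
     u 1 (n+1) - u 1 n
     + lam \<cdot>\<^sub>v (A11p *\<^sub>v (u 1 n - u 0 n - (minv A11 * A12) *\<^sub>v v 0 n))
     + lam \<cdot>\<^sub>v (A11m *\<^sub>v (u 2 n - u 1 n))"

definition interior_residual ::
  "real mat \<Rightarrow> real mat \<Rightarrow> real \<Rightarrow> (nat \<Rightarrow> nat \<Rightarrow> real vec) \<Rightarrow> nat \<Rightarrow> nat \<Rightarrow> real vec" where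
  "interior_residual A11p A11m lam u j n =
     u j (n+1) - u j n
     + lam \<cdot>\<^sub>v (A11p *\<^sub>v (u j n - u (j-1) n))
     + lam \<cdot>\<^sub>v (A11m *\<^sub>v (u (j+1) n - u j n))"

definition boundary_residual ::
  "real mat \<Rightarrow> real mat \<Rightarrow> real mat \<Rightarrow> real \<Rightarrow>
   (nat \<Rightarrow> nat \<Rightarrow> real vec) \<Rightarrow> (nat \<Rightarrow> nat \<Rightarrow> real vec) \<Rightarrow> nat \<Rightarrow> real vec" where
  "boundary_residual A11 A12 L1m lam u v n =
     L1m *\<^sub>v (u 0 (n+1) - u 0 n)
     + lam \<cdot>\<^sub>v (L1m *\<^sub>v (A11 *\<^sub>v (u 1 n - u 0 n) + A12 *\<^sub>v (v 1 n - v 0 n)))"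

text \<open>The type \<^typ>\<open>real vec\<close> carries no topology; limits, derivatives and bounds are componentwise.\<close>

definition vec_tendsto :: "(real \<Rightarrow> real vec) \<Rightarrow> real vec \<Rightarrow> real filter \<Rightarrow> bool" where
  "vec_tendsto f l F \<longleftrightarrow> (\<forall>i<dim_vec l. ((\<lambda>x. f x $ i) \<longlongrightarrow> l $ i) F)"

definition has_vec_derivative :: "(real \<Rightarrow> real vec) \<Rightarrow> real vec \<Rightarrow> real filter \<Rightarrow> bool" where
  "has_vec_derivative f f' F \<longleftrightarrow>
     (\<forall>i<dim_vec f'. ((\<lambda>x. f x $ i) has_real_derivative f' $ i) F)"

definition vec_bounded_by :: "real vec \<Rightarrow> real \<Rightarrow> bool" where
  "vec_bounded_by w c \<longleftrightarrow> (\<forall>i<dim_vec w. \<bar>w $ i\<bar> \<le> c)"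

text \<open>
  Smoothness up to the boundary, with one-sided derivatives there. It is used for
  \<open>{0..}\<close> and the closed quadrant, on which derivatives within the set are unique.
\<close>

primrec Ck_on :: "nat \<Rightarrow> 'a::euclidean_space set \<Rightarrow> ('a \<Rightarrow> real) \<Rightarrow> bool" where
  "Ck_on 0 S f \<longleftrightarrow> continuous_on S f"
| "Ck_on (Suc k) S f \<longleftrightarrow>
     (\<exists>f'. (\<forall>x\<in>S. (f has_derivative f' x) (at x within S)) \<and>
           (\<forall>e\<in>Basis. Ck_on k S (\<lambda>x. f' x e)))"

definition smooth_on :: "'a::euclidean_space set \<Rightarrow> ('a \<Rightarrow> real) \<Rightarrow> bool" where
  "smooth_on S f \<longleftrightarrow> (\<forall>k. Ck_on k S f)"

abbreviation quadrant :: "(real \<times> real) set" where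
  "quadrant \<equiv> {0..} \<times> {0..}"

text \<open>\<open>ubar x t\<close> is the limit solution and \<open>nu t\<close> stands for \<open>\<nu>(0,t)\<close>.\<close>

definition asymptotic_limit ::
  "nat \<Rightarrow> nat \<Rightarrow> real mat \<Rightarrow> real mat \<Rightarrow> real mat \<Rightarrow> real mat \<Rightarrow> real mat \<Rightarrow> (real \<Rightarrow> real vec) \<Rightarrow>
   (real \<Rightarrow> real \<Rightarrow> real vec) \<Rightarrow> (real \<Rightarrow> real vec) \<Rightarrow> bool" where
  "asymptotic_limit m r A11 A12 Bu Bv LHp b ubar nu \<longleftrightarrow>
     (\<forall>x\<ge>0. \<forall>t\<ge>0. ubar x t \<in> carrier_vec m) \<and>
     (\<forall>t\<ge>0. nu t \<in> carrier_vec r) \<and>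
     (\<forall>i<m. smooth_on quadrant (\<lambda>(x, t). ubar x t $ i)) \<and>
     (\<forall>i<r. smooth_on {0..} (\<lambda>t. nu t $ i)) \<and>
     (\<forall>x\<ge>0. \<forall>t\<ge>0. \<exists>ut\<in>carrier_vec m. \<exists>ux\<in>carrier_vec m.
        has_vec_derivative (\<lambda>s. ubar x s) ut (at t within {0..}) \<and>
        has_vec_derivative (\<lambda>y. ubar y t) ux (at x within {0..}) \<and>
        ut + A11 *\<^sub>v ux = 0\<^sub>v m) \<and>
     (\<forall>t\<ge>0. LHp *\<^sub>v nu t = 0\<^sub>v (dim_row LHp)) \<and>
     (\<forall>t\<ge>0. Bu *\<^sub>v ubar 0 t + (Bv - Bu * minv A11 * A12) *\<^sub>v nu t = b t)"

definition u_lim ::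
  "real mat \<Rightarrow> real mat \<Rightarrow> (real \<Rightarrow> real \<Rightarrow> real vec) \<Rightarrow> (real \<Rightarrow> real vec) \<Rightarrow>
   real \<Rightarrow> real \<Rightarrow> nat \<Rightarrow> nat \<Rightarrow> real vec" where
  "u_lim A11 A12 ubar nu \<tau> h j n =
     (if j = 0 then ubar 0 (real n * \<tau>) - (minv A11 * A12) *\<^sub>v nu (real n * \<tau>)
      else ubar (real j * h) (real n * \<tau>))"

definition v_lim :: "nat \<Rightarrow> (real \<Rightarrow> real vec) \<Rightarrow> real \<Rightarrow> nat \<Rightarrow> nat \<Rightarrow> real vec" where
  "v_lim r nu \<tau> j n = (if j = 0 then nu (real n * \<tau>) else 0\<^sub>v r)"

end

theory Submission
  imports
    Defs
    "HOL-Analysis.Elementary_Metric_Spaces"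
    "Jordan_Normal_Form.Jordan_Normal_Form_Existence"
    "Jordan_Normal_Form.Jordan_Normal_Form_Uniqueness"
begin

text \<open>
  The columns of \<open>R\<^sub>+\<^sup>\<infinity>\<close> and \<open>R\<^sub>-\<^sup>\<infinity>\<close> together span the whole space, because generalized eigenvectors do
  and neither \<open>A\<^sub>1\<^sub>1\<close> nor \<open>H\<close> has imaginary eigenvalues. The left matrices are therefore unique, with
  rows \<open>L\<^sup>1 (I, A\<^sub>1\<^sub>1\<^sup>-\<^sup>1 A\<^sub>1\<^sub>2)\<close> and \<open>(0, L\<^sup>H)\<close>. Hence the upper block of the interior scheme and the
  \<open>L\<^sup>1\<close> rows of the boundary scheme contain no stiff term, and pass to the limit unchanged. Multiplied by
  \<open>\<epsilon>\<close>, the remaining equations leave \<open>S v = 0\<close> in the interior and \<open>L\<^sub>+\<^sup>H H v = 0\<close> at the boundary, where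
  \<open>H\<close> may be dropped because \<open>L\<^sub>+\<^sup>H H = M L\<^sub>+\<^sup>H\<close> with \<open>M\<close> injective. Consistency is Taylor expansion,
  the first-order terms cancelling by \<open>A\<^sub>1\<^sub>1\<^sup>+ + A\<^sub>1\<^sub>1\<^sup>- = A\<^sub>1\<^sub>1\<close>.
\<close>

section \<open>Spectral subspaces\<close>

text \<open>\<open>left_matrices\<close> asserts only L R = I, and nothing in it makes the
  juxtaposed R square. The other half, \<open>Rp * Lp + Rm * Lm = 1\<^sub>m n\<close>, amounts to
  spanning, and the algebra rests on it: uniqueness of the left matrices, the relation L N = M L,
  and A_11^+ + A_11^- = A_11. The spectral theory serves to obtain this half; afterwards an
  \<open>invariant_splitting\<close> records it without mentioning eigenvalues. The extra term in
  the first cell has one source: the upper block of the flux sees (u, v) only through u + K v with K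
  = A_11^{-1} A_12. As v vanishes for j >= 1, differences of K v drop out except across the boundary
  cell, where - K v_0 survives. For the asymptotic limit, u_0 = ubar_0 - K nu_0 cancels it, and the
  first cell becomes the ordinary upwind step for ubar. At j = 0 the term K nu cancels in the
  spatial difference because A_11 K = A_12, but not in the time increment; this leaves a residual of
  order tau there.\<close>

lemma char_matrix_jordan_matrix:
  "char_matrix (jordan_matrix n_as) (b :: 'a :: field) = jordan_matrix (map (\<lambda>(n, a). (n, a - b)) n_as)"
proof (induct n_as)
  case Nil
  show ?case by (rule eq_matI) (auto simp: char_matrix_def)
next
  case (Cons na n_as)
  obtain n a where na: "na = (n, a)" by force
  have dims: "map fst (map (\<lambda>(n, a). (n, a - b)) n_as) = map fst n_as" by auto
  show ?case
    unfolding na list.map prod.case jordan_matrix_Cons Cons[symmetric] dims char_matrix_def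
    by (rule eq_matI) (auto simp: jordan_block_def)
qed

text \<open>Take \<open>a\<close> to be the eigenvalue of the block that contains index
  \<open>k\<close>: the shifted block is nilpotent and powers stay block diagonal, so column
  \<open>k\<close> of the power vanishes. Working with entries turns the induction over blocks into
  a shift of the index.\<close>

lemma jordan_matrix_generalized_eigenvector:
  assumes "k < sum_list (map fst n_as)" "p \<ge> sum_list (map fst n_as)"
  shows "\<exists>(n, a) \<in> set n_as. n > 0 \<and> (\<forall>i<sum_list (map fst n_as).
           (char_matrix (jordan_matrix n_as) (a :: 'a :: field) ^\<^sub>m p) $$ (i, k) = 0)"
  using assms
proof (induct n_as arbitrary: k)
  case Nil
  then show ?case by simp
next
  case (Cons na n_as)
  obtain n a where na: "na = (n, a)" by force
  let ?s = "sum_list (map fst n_as)"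
  have dims: "map fst (map (\<lambda>(n, a). (n, a - b)) n_as) = map fst n_as" for b :: 'a by auto
  have block: "char_matrix (jordan_matrix (na # n_as)) b ^\<^sub>m p =
      four_block_mat (jordan_block n (a - b) ^\<^sub>m p) (0\<^sub>m n ?s) (0\<^sub>m ?s n)
        (char_matrix (jordan_matrix n_as) b ^\<^sub>m p)" for b
  proof -
    let ?n_bs = "map (\<lambda>(n, a). (n, a - b)) n_as"
    have carr: "jordan_matrix ?n_bs \<in> carrier_mat ?s ?s"
      using jordan_matrix_carrier[of ?n_bs] unfolding dims .
    have "char_matrix (jordan_matrix (na # n_as)) b =
        four_block_mat (jordan_block n (a - b)) (0\<^sub>m n ?s) (0\<^sub>m ?s n) (jordan_matrix ?n_bs)"
      using jordan_matrix_Cons[of n "a - b" ?n_bs] unfolding dims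
      by (simp add: na char_matrix_jordan_matrix)
    then show ?thesis
      unfolding char_matrix_jordan_matrix[of n_as]
      by (simp only: pow_four_block_mat[OF jordan_block_carrier carr])
  qed
  have carr: "char_matrix (jordan_matrix n_as) b ^\<^sub>m p \<in> carrier_mat ?s ?s" for b
    by (intro pow_carrier_mat char_matrix_closed jordan_matrix_carrier)
  show ?case
  proof (cases "k < n")
    case True
    then have "\<forall>i<n + ?s. (char_matrix (jordan_matrix (na # n_as)) a ^\<^sub>m p) $$ (i, k) = 0"
      unfolding block using True Cons(3) na carrier_matD[OF carr[of a]] by (auto simp: jordan_block_zero_pow)
    then show ?thesis using True na by auto
  next
    case False
    then have k: "k - n < ?s" using Cons(2) na by auto
    have p: "p \<ge> ?s" using Cons(3) na by auto
    from Cons(1)[OF k p] obtain m b where mb: "(m, b) \<in> set n_as" "m > 0"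
      "\<forall>i<?s. (char_matrix (jordan_matrix n_as) b ^\<^sub>m p) $$ (i, k - n) = 0" by auto
    have "\<forall>i<n + ?s. (char_matrix (jordan_matrix (na # n_as)) b ^\<^sub>m p) $$ (i, k) = 0"
    proof (intro allI impI)
      define X where "X = char_matrix (jordan_matrix n_as) b ^\<^sub>m p"
      have X: "X \<in> carrier_mat ?s ?s" unfolding X_def by (rule carr)
      fix i assume i: "i < n + ?s"
      show "(char_matrix (jordan_matrix (na # n_as)) b ^\<^sub>m p) $$ (i, k) = 0"
        unfolding block X_def[symmetric]
        using Cons(2) na False i k carrier_matD[OF X] mb(3)[folded X_def] by (auto simp: not_less)
    qed
    then show ?thesis using mb na by (auto intro!: bexI[of _ "(m, b)"])
  qed
qed

text \<open>The generators inside \<open>spectral_subspace\<close>, taken before the span. Closure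
  under \<open>N\<close> and under conjugation is checked here, one kernel at a time, and then
  carried over to spans.\<close>

definition generalized_eigenvectors :: "complex set \<Rightarrow> complex mat \<Rightarrow> complex vec set" where
  "generalized_eigenvectors Z N =
     (\<Union>e\<in>{e \<in> Z. eigenvalue N e}. mat_kernel (char_matrix N e ^\<^sub>m dim_row N))"

lemma generalized_eigenvectors_carrier:
  assumes "N \<in> carrier_mat n n"
  shows "generalized_eigenvectors Z N \<subseteq> carrier_vec n"
proof -
  have "char_matrix N e ^\<^sub>m dim_row N \<in> carrier_mat n n" for e
    using assms by (intro pow_carrier_mat char_matrix_closed)
  then show ?thesis
    unfolding generalized_eigenvectors_def mat_kernel_def by fastforce
qed

text \<open>The columns of the transition matrix to Jordan form work: (N - e)^n P = P (J - e)^n, so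
  a zero column of (J - e)^n makes the corresponding column of P a kernel vector. The right inverse
  \<open>P'\<close> supplies the coordinates of a vector with respect to these columns.\<close>

lemma generalized_eigenvector_basis:
  fixes N :: "complex mat"
  assumes N: "N \<in> carrier_mat n n"
  shows "\<exists>P P'. P \<in> carrier_mat n n \<and> P' \<in> carrier_mat n n \<and> P * P' = 1\<^sub>m n \<and>
     (\<forall>k<n. \<exists>e. eigenvalue N e \<and> col P k \<in> mat_kernel (char_matrix N e ^\<^sub>m n))"
proof -
  from char_poly_factorized[OF N] obtain as where "char_poly N = (\<Prod>a\<leftarrow>as. [:- a, 1:])" by auto
  from jordan_nf_exists[OF N this] obtain n_as where nf: "jordan_nf N n_as" by auto
  let ?J = "jordan_matrix n_as"
  from nf obtain P P' where wit: "similar_mat_wit N ?J P P'"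
    unfolding jordan_nf_def similar_mat_def by auto
  note c = similar_mat_witD2[OF N wit]
  have s: "sum_list (map fst n_as) = n" using c(5) by auto
  show ?thesis
  proof (rule exI[of _ P], rule exI[of _ P'], intro conjI allI impI)
    fix k assume k: "k < n"
    have "\<exists>(m, a) \<in> set n_as. m > 0 \<and> (\<forall>i<n. (char_matrix ?J a ^\<^sub>m n) $$ (i, k) = 0)"
      using jordan_matrix_generalized_eigenvector[of k n_as n] k s by auto
    then obtain m a where ma: "(m, a) \<in> set n_as" "m > 0"
      and z: "\<And>i. i < n \<Longrightarrow> (char_matrix ?J a ^\<^sub>m n) $$ (i, k) = 0" by auto
    \<comment> \<open>A block of positive size contributes an actual factor to the characteristic
      polynomial, so \<open>a\<close> is an eigenvalue of \<open>N\<close>.\<close>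
    have "poly ([:- a, 1:] ^ m) a = 0" using ma(2) by simp
    then have "0 \<in> set (map (\<lambda>(n, b). poly ([:- b, 1:] ^ n) a) n_as)"
      using ma(1) by (force simp: image_iff)
    then have ev: "eigenvalue N a"
      unfolding eigenvalue_root_char_poly[OF N] jordan_nf_char_poly[OF nf] poly_prod_list
      by (simp add: prod_list_zero_iff o_def split_def)
    let ?C = "char_matrix N a ^\<^sub>m n"
    define D where "D = char_matrix ?J a ^\<^sub>m n"
    have D: "D \<in> carrier_mat n n" and C: "?C \<in> carrier_mat n n"
      unfolding D_def by (intro pow_carrier_mat char_matrix_closed c N)+
    have "?C * P = P * D * P' * P"
      unfolding D_def by (simp only: similar_mat_wit_pow_id[OF similar_mat_wit_char_matrix[OF wit]])
    also have "\<dots> = P * D * (P' * P)" by (rule assoc_mult_mat[OF mult_carrier_mat[OF c(6) D] c(7) c(6)])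
    also have "\<dots> = P * D" unfolding c(2) by (rule right_mult_one_mat[OF mult_carrier_mat[OF c(6) D]])
    finally have "col (?C * P) k = col (P * D) k" by simp
    moreover have "col D k = 0\<^sub>v n"
      using z D k unfolding D_def[symmetric] by (intro eq_vecI) auto
    moreover have "P *\<^sub>v 0\<^sub>v n = 0\<^sub>v n" using c(6) by auto
    ultimately have "?C *\<^sub>v col P k = 0\<^sub>v n"
      using c(6) C D k by (simp add: col_mult2[OF C c(6) k] col_mult2[OF c(6) D k])
    then show "\<exists>e. eigenvalue N e \<and> col P k \<in> mat_kernel (char_matrix N e ^\<^sub>m n)"
      using ev c(6) by (intro exI[of _ a]) (auto intro!: mat_kernelI[OF C])
  qed (use c in auto)
qed

section \<open>Invariance of spectral subspaces and complex conjugation\<close>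

abbreviation cspan :: "nat \<Rightarrow> complex vec set \<Rightarrow> complex vec set" where
  "cspan n W \<equiv> LinearCombinations.module.span class_ring (module_vec TYPE(complex) n) W"

lemma mult_vec_in_cspan:
  fixes M :: "complex mat"
  assumes M: "M \<in> carrier_mat n k" and W: "W \<subseteq> carrier_vec n"
    and cols: "\<And>i. i < k \<Longrightarrow> col M i \<in> cspan n W" and c: "c \<in> carrier_vec k"
  shows "M *\<^sub>v c \<in> cspan n W"
proof -
  interpret vec_space "TYPE(complex)" n .
  have "M *\<^sub>v c \<in> col_space M" unfolding col_space_eq[OF M] using M c by auto
  also have "\<dots> \<subseteq> span W" unfolding col_space_def
  proof (rule span_subsetI[OF W])
    show "set (cols M) \<subseteq> span W" using cols M by (auto simp: cols_def)
  qed
  finally show ?thesis .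
qed

text \<open>The vectors that \<open>N\<close> sends into the span form a submodule. It contains
  \<open>W\<close>, hence the whole span of \<open>W\<close>.\<close>

lemma cspan_closed_mult_vec:
  fixes N :: "complex mat"
  assumes N: "N \<in> carrier_mat n n" and W: "W \<subseteq> carrier_vec n"
    and inv: "\<And>w. w \<in> W \<Longrightarrow> N *\<^sub>v w \<in> W" and x: "x \<in> cspan n W"
  shows "N *\<^sub>v x \<in> cspan n W"
proof -
  interpret vec_space "TYPE(complex)" n .
  have c: "span W \<subseteq> carrier_vec n" using span_is_subset2 W by auto
  have "submodule class_ring {y \<in> carrier_vec n. N *\<^sub>v y \<in> span W} V"
  proof (unfold_locales, goal_cases)
    case 2
    then show ?case using N W
      by (auto simp: mult_add_distrib_mat_vec[OF N] intro!: span_add1)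
  next
    case 3
    have "N *\<^sub>v 0\<^sub>v n = 0\<^sub>v n" using N by auto
    then show ?case using submodule.zero_closed[OF span_is_submodule, of W] W by simp
  next
    case 4
    then show ?case using N W
      by (auto simp: mult_mat_vec[OF N] intro!: smult_in_span)
  qed auto
  moreover have "W \<subseteq> {y \<in> carrier_vec n. N *\<^sub>v y \<in> span W}"
    using W inv in_own_span[simplified, OF W] by auto
  ultimately have "span W \<subseteq> {y \<in> carrier_vec n. N *\<^sub>v y \<in> span W}"
    by (rule span_is_subset[rotated])
  then show ?thesis using x by auto
qed

lemma char_matrix_commute:
  fixes N :: "'a :: field mat"
  assumes N: "N \<in> carrier_mat n n"
  shows "char_matrix N e ^\<^sub>m k * N = N * char_matrix N e ^\<^sub>m k"
proof -
  have "char_matrix N e * N = N * char_matrix N e"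
    unfolding char_matrix_def using N
    by (simp add: add_mult_distrib_mat[of _ n n] mult_add_distrib_mat[of _ n n]
        mult_smult_distrib[OF N one_carrier_mat] mult_smult_assoc_mat[OF one_carrier_mat N])
  then show ?thesis
  proof (induct k)
    case (Suc k)
    have C: "char_matrix N e \<in> carrier_mat n n" using N by simp
    then have Ck: "char_matrix N e ^\<^sub>m k \<in> carrier_mat n n" by simp
    let ?C = "char_matrix N e"
    have "?C ^\<^sub>m Suc k * N = ?C ^\<^sub>m k * (?C * N)"
      unfolding pow_mat.simps by (rule assoc_mult_mat[OF Ck C N])
    also have "\<dots> = ?C ^\<^sub>m k * N * ?C"
      unfolding Suc(2) by (rule assoc_mult_mat[OF Ck N C, symmetric])
    also have "\<dots> = N * ?C ^\<^sub>m Suc k"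
      unfolding Suc(1)[OF Suc(2)] pow_mat.simps by (rule assoc_mult_mat[OF N Ck C])
    finally show ?case .
  qed (use N in \<open>auto simp: char_matrix_def\<close>)
qed

lemma generalized_eigenvectors_invariant:
  assumes N: "N \<in> carrier_mat n n" and x: "x \<in> generalized_eigenvectors Z N"
  shows "N *\<^sub>v x \<in> generalized_eigenvectors Z N"
proof -
  from x N obtain e where e: "e \<in> Z" "eigenvalue N e"
    and k: "x \<in> mat_kernel (char_matrix N e ^\<^sub>m n)" unfolding generalized_eigenvectors_def by auto
  let ?C = "char_matrix N e ^\<^sub>m n"
  have C: "?C \<in> carrier_mat n n" using N by simp
  from mat_kernelD[OF C k] have x: "x \<in> carrier_vec n" "?C *\<^sub>v x = 0\<^sub>v n" .
  have "?C *\<^sub>v (N *\<^sub>v x) = (?C * N) *\<^sub>v x"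
    by (rule assoc_mult_mat_vec[OF C N x(1), symmetric])
  also have "\<dots> = N *\<^sub>v (?C *\<^sub>v x)"
    unfolding char_matrix_commute[OF N] by (rule assoc_mult_mat_vec[OF N C x(1)])
  also have "\<dots> = 0\<^sub>v n" using x N by auto
  finally have "N *\<^sub>v x \<in> mat_kernel ?C" using N x by (intro mat_kernelI[OF C]) auto
  then show ?thesis unfolding generalized_eigenvectors_def using e N by auto
qed

text \<open>Provides the transport rules for entrywise conjugation of matrix products and
  powers.\<close>

interpretation cnj_hom: inj_semiring_hom cnj
  by unfold_locales auto

lemma char_matrix_cnj:
  assumes "N \<in> carrier_mat n n"
  shows "char_matrix (map_mat cnj N) (cnj e) = map_mat cnj (char_matrix N e)"
  using assms by (intro eq_matI) (auto simp: char_matrix_def)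

text \<open>Since \<open>N\<close> is real, conjugating (N - e)^n x = 0 yields the same equation for
  the conjugates of e and x. The set \<open>Z\<close> must be symmetric about the real axis, as both
  open half planes are.\<close>

lemma generalized_eigenvectors_cnj:
  assumes N: "N \<in> carrier_mat n n" and Z: "\<And>z. z \<in> Z \<Longrightarrow> cnj z \<in> Z"
    and x: "x \<in> generalized_eigenvectors Z (cmat N)"
  shows "map_vec cnj x \<in> generalized_eigenvectors Z (cmat N)"
proof -
  let ?N = "cmat N"
  have cN: "?N \<in> carrier_mat n n" using N by simp
  have real: "map_mat cnj ?N = ?N" by (intro eq_matI) auto
  from x N obtain e where e: "e \<in> Z" "eigenvalue ?N e"
    and k: "x \<in> mat_kernel (char_matrix ?N e ^\<^sub>m n)" unfolding generalized_eigenvectors_def by auto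
  let ?C = "char_matrix ?N e"
  have C: "?C \<in> carrier_mat n n" using N by simp
  have Cn: "?C ^\<^sub>m n \<in> carrier_mat n n" using C by simp
  note ch = char_matrix_cnj[OF cN, of e, unfolded real]
  from mat_kernelD[OF Cn k] have x: "x \<in> carrier_vec n" "?C ^\<^sub>m n *\<^sub>v x = 0\<^sub>v n" .
  have "char_matrix ?N (cnj e) ^\<^sub>m n *\<^sub>v map_vec cnj x = map_vec cnj (?C ^\<^sub>m n *\<^sub>v x)"
    unfolding ch cnj_hom.mult_mat_vec_hom[OF Cn x(1)] cnj_hom.mat_hom_pow[OF C] ..
  also have "\<dots> = 0\<^sub>v n" unfolding x by (rule cnj_hom.vec_hom_zero)
  finally have "map_vec cnj x \<in> mat_kernel (char_matrix ?N (cnj e) ^\<^sub>m n)"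
    using x cN by (intro mat_kernelI[of _ n n]) auto
  moreover have "eigenvalue ?N (cnj e)"
  proof -
    from e(2) obtain v where "eigenvector ?N v e" unfolding eigenvalue_def by auto
    then have "v \<in> carrier_vec n" "v \<noteq> 0\<^sub>v n" "?N *\<^sub>v v = e \<cdot>\<^sub>v v"
      unfolding eigenvector_def using N by auto
    moreover from this have "?N *\<^sub>v map_vec cnj v = cnj e \<cdot>\<^sub>v map_vec cnj v"
      using cnj_hom.mult_mat_vec_hom[OF cN, of v] by (simp add: real cnj_hom.vec_hom_smult)
    ultimately have "eigenvector ?N (map_vec cnj v) (cnj e)"
      unfolding eigenvector_def using N by auto
    then show ?thesis unfolding eigenvalue_def by auto
  qed
  ultimately show ?thesis unfolding generalized_eigenvectors_def using e Z N by auto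
qed

lemma spectral_subspace_alt:
  "spectral_subspace Z N = {x \<in> carrier_vec (dim_row N).
     map_vec complex_of_real x \<in> cspan (dim_row N) (generalized_eigenvectors Z (cmat N))}"
  unfolding spectral_subspace_def generalized_eigenvectors_def by simp

lemma spectral_subspace_invariant:
  assumes N: "N \<in> carrier_mat n n" and x: "x \<in> spectral_subspace Z N"
  shows "N *\<^sub>v x \<in> spectral_subspace Z N"
proof -
  have cN: "cmat N \<in> carrier_mat n n" using N by simp
  have d: "dim_row N = n" using N by auto
  from x have x: "x \<in> carrier_vec n"
    "map_vec complex_of_real x \<in> cspan n (generalized_eigenvectors Z (cmat N))"
    unfolding spectral_subspace_alt d by auto
  have "cmat N *\<^sub>v map_vec complex_of_real x \<in> cspan n (generalized_eigenvectors Z (cmat N))"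
    by (rule cspan_closed_mult_vec[OF cN generalized_eigenvectors_carrier[OF cN] _ x(2)])
      (rule generalized_eigenvectors_invariant[OF cN])
  then have "map_vec complex_of_real (N *\<^sub>v x) \<in> cspan n (generalized_eigenvectors Z (cmat N))"
    by (simp only: of_real_hom.mult_mat_vec_hom[OF N x(1)])
  then show ?thesis unfolding spectral_subspace_alt d using N x by auto
qed

text \<open>The complex decomposition is made real by averaging it with its conjugate.\<close>

lemma spectral_subspace_sum:
  assumes N: "N \<in> carrier_mat n n" and no_im: "\<forall>e. eigenvalue (cmat N) e \<longrightarrow> Re e \<noteq> 0"
    and x: "x \<in> carrier_vec n"
  shows "\<exists>y\<in>spectral_subspace {z. Re z > 0} N. \<exists>z\<in>spectral_subspace {z. Re z < 0} N. x = y + z"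
proof -
  let ?N = "cmat N"
  have cN: "?N \<in> carrier_mat n n" using N by simp
  have d: "dim_row N = n" using N by auto
  from generalized_eigenvector_basis[OF cN] obtain P P' where P: "P \<in> carrier_mat n n"
    and P': "P' \<in> carrier_mat n n" and PP': "P * P' = 1\<^sub>m n"
    and ge: "\<forall>k<n. \<exists>e. eigenvalue ?N e \<and> col P k \<in> mat_kernel (char_matrix ?N e ^\<^sub>m n)" by blast
  from ge obtain e where ev: "\<And>k. k < n \<Longrightarrow> eigenvalue ?N (e k)"
    and ker: "\<And>k. k < n \<Longrightarrow> col P k \<in> mat_kernel (char_matrix ?N (e k) ^\<^sub>m n)" by metis
  let ?x = "map_vec complex_of_real x"
  define c where "c = P' *\<^sub>v ?x"
  have cx: "?x \<in> carrier_vec n" using x by simp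
  have c: "c \<in> carrier_vec n" unfolding c_def by (rule mult_mat_vec_carrier[OF P' cx])
  have Pc: "P *\<^sub>v c = ?x"
    unfolding c_def assoc_mult_mat_vec[OF P P' cx, symmetric] PP' using cx by simp
  \<comment> \<open>The columns of \<open>P\<close> whose eigenvalue lies in \<open>Z\<close> are
    kept and the others replaced by zero, so that \<open>part Z *\<^sub>v c\<close> is the
    \<open>Z\<close> component of the complexified x.\<close>
  define part where "part Z = mat n n (\<lambda>(i, k). if e k \<in> Z then P $$ (i, k) else 0)" for Z
  have part: "part Z \<in> carrier_mat n n" for Z unfolding part_def by simp
  define w where "w Z = part Z *\<^sub>v c" for Z
  define y where "y Z = map_vec Re (w Z)" for Z
  have w: "w Z \<in> carrier_vec n" for Z using mult_mat_vec_carrier[OF part c] unfolding w_def .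
  have yspec: "y Z \<in> spectral_subspace Z N" if Z: "\<And>z. z \<in> Z \<Longrightarrow> cnj z \<in> Z" for Z
  proof -
    interpret vec_space "TYPE(complex)" n .
    let ?W = "generalized_eigenvectors Z ?N"
    have W: "?W \<subseteq> carrier_vec n" by (rule generalized_eigenvectors_carrier[OF cN])
    have col: "col (part Z) k = (if e k \<in> Z then col P k else 0\<^sub>v n)" if "k < n" for k
      using that P unfolding part_def by (intro eq_vecI) auto
    have colW: "col P k \<in> ?W" if "k < n" "e k \<in> Z" for k
      using that ev ker N unfolding generalized_eigenvectors_def by auto
    have W_span: "?W \<subseteq> span ?W" using in_own_span[simplified, OF W] .
    have zero: "0\<^sub>v n \<in> span ?W" using submodule.zero_closed[OF span_is_submodule, of ?W] W by simp
    have 1: "w Z \<in> span ?W" unfolding w_def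
      by (rule mult_vec_in_cspan[OF part W _ c]) (use col colW W_span zero in auto)
    have "map_vec cnj (w Z) = map_mat cnj (part Z) *\<^sub>v map_vec cnj c"
      unfolding w_def by (rule cnj_hom.mult_mat_vec_hom[OF part c])
    also have "\<dots> \<in> span ?W"
    proof (rule mult_vec_in_cspan[OF _ W])
      fix k assume k: "k < n"
      have "col (map_mat cnj (part Z)) k = map_vec cnj (col (part Z) k)"
        using k part[of Z] by (intro eq_vecI) auto
      then show "col (map_mat cnj (part Z)) k \<in> span ?W"
        using generalized_eigenvectors_cnj[OF N Z, of "col P k"] colW[of k] k W_span zero
        by (auto simp: col cnj_hom.vec_hom_zero)
    qed (use part c in auto)
    finally have "(1/2) \<cdot>\<^sub>v (w Z + map_vec cnj (w Z)) \<in> span ?W"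
      using 1 W by (intro smult_in_span span_add1) auto
    moreover have "(1/2) \<cdot>\<^sub>v (w Z + map_vec cnj (w Z)) = map_vec complex_of_real (y Z)"
      using w[of Z] unfolding y_def by (intro eq_vecI) (auto simp: complex_eq_iff)
    ultimately show ?thesis unfolding spectral_subspace_alt d using w by (auto simp: y_def)
  qed
  let ?p = "{z. Re z > 0}" let ?m = "{z. Re z < 0}"
  \<comment> \<open>No eigenvalue has real part zero, so each column of \<open>P\<close> is kept by
    exactly one of the two parts.\<close>
  have "part ?p + part ?m = P"
    using P ev no_im unfolding part_def by (intro eq_matI) (auto simp: not_less)
  then have "w ?p + w ?m = ?x"
    unfolding w_def Pc[symmetric] using add_mult_distrib_mat_vec[OF part part c] by metis
  then have "map_vec Re (w ?p + w ?m) = x" using x by auto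
  moreover have "map_vec Re (w ?p + w ?m) = y ?p + y ?m"
    using w[of ?p] w[of ?m] unfolding y_def by (intro eq_vecI) auto
  ultimately have "x = y ?p + y ?m" by simp
  then show ?thesis using yspec[of ?p] yspec[of ?m] by auto
qed

section \<open>Frames of complementary invariant subspaces\<close>

lemma mat_eq_if_mult_vec_eq:
  fixes M M' :: "'a :: semiring_1 mat"
  assumes M: "M \<in> carrier_mat k n" and M': "M' \<in> carrier_mat k n"
    and eq: "\<And>x. x \<in> carrier_vec n \<Longrightarrow> M *\<^sub>v x = M' *\<^sub>v x"
  shows "M = M'"
proof (rule eq_matI)
  fix i j assume ij: "i < dim_row M'" "j < dim_col M'"
  have "(M *\<^sub>v unit_vec n j) $ i = (M' *\<^sub>v unit_vec n j) $ i" by (simp add: eq)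
  then show "M $$ (i, j) = M' $$ (i, j)" using ij M M' by auto
qed (use M M' in auto)

lemma zero_mult_mat_vec: "v \<in> carrier_vec k \<Longrightarrow> 0\<^sub>m n k *\<^sub>v v = (0\<^sub>v n :: 'a :: semiring_1 vec)"
  by (intro eq_vecI) auto

lemma mult_zero_vec: "M \<in> carrier_mat n k \<Longrightarrow> M *\<^sub>v 0\<^sub>v k = (0\<^sub>v n :: 'a :: semiring_1 vec)"
  by (intro eq_vecI) auto

lemma mult_mat3_vec:
  fixes M1 :: "'a :: semiring_1 mat"
  assumes "M1 \<in> carrier_mat n1 n2" "M2 \<in> carrier_mat n2 n3" "M3 \<in> carrier_mat n3 n4"
    and "v \<in> carrier_vec n4"
  shows "(M1 * M2 * M3) *\<^sub>v v = M1 *\<^sub>v (M2 *\<^sub>v (M3 *\<^sub>v v))"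
  using assms assoc_mult_mat_vec[OF mult_carrier_mat[OF assms(1,2)] assms(3,4)]
    assoc_mult_mat_vec[OF assms(1,2) mult_mat_vec_carrier[OF assms(3,4)]] by argo

lemma four_block_mat_eqD:
  assumes "four_block_mat A B C D = four_block_mat A' B' C' D'"
    and "A \<in> carrier_mat a c" "B \<in> carrier_mat a d" "C \<in> carrier_mat b c" "D \<in> carrier_mat b d"
    and "A' \<in> carrier_mat a c" "B' \<in> carrier_mat a d" "C' \<in> carrier_mat b c" "D' \<in> carrier_mat b d"
  shows "A = A'" "B = B'" "C = C'" "D = D'"
proof -
  have e: "four_block_mat A B C D $$ (i, j) = four_block_mat A' B' C' D' $$ (i, j)" for i j
    using assms(1) by simp
  show "A = A'"
  proof (rule eq_matI)
    fix i j assume "i < dim_row A'" "j < dim_col A'"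
    then show "A $$ (i, j) = A' $$ (i, j)" using assms(2-) e[of i j] by auto
  qed (use assms(2-) in auto)
  show "B = B'"
  proof (rule eq_matI)
    fix i j assume "i < dim_row B'" "j < dim_col B'"
    then show "B $$ (i, j) = B' $$ (i, j)" using assms(2-) e[of i "j + c"] by auto
  qed (use assms(2-) in auto)
  show "C = C'"
  proof (rule eq_matI)
    fix i j assume "i < dim_row C'" "j < dim_col C'"
    then show "C $$ (i, j) = C' $$ (i, j)" using assms(2-) e[of "i + a" j] by auto
  qed (use assms(2-) in auto)
  show "D = D'"
  proof (rule eq_matI)
    fix i j assume "i < dim_row D'" "j < dim_col D'"
    then show "D $$ (i, j) = D' $$ (i, j)" using assms(2-) e[of "i + a" "j + c"] by auto
  qed (use assms(2-) in auto)
qed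

lemma left_matrices_blocks:
  assumes L: "left_matrices Rp Rm Lp Lm"
    and Rp: "Rp \<in> carrier_mat n a" and Rm: "Rm \<in> carrier_mat n b"
  shows "Lp \<in> carrier_mat a n" "Lm \<in> carrier_mat b n"
    "Lp * Rp = 1\<^sub>m a" "Lp * Rm = 0\<^sub>m a b" "Lm * Rp = 0\<^sub>m b a" "Lm * Rm = 1\<^sub>m b"
proof -
  show Lp: "Lp \<in> carrier_mat a n" and Lm: "Lm \<in> carrier_mat b n"
    using L Rp Rm unfolding left_matrices_def by auto
  \<comment> \<open>Stacking and juxtaposing are four-block matrices with blocks of zero width or
    height, so the block product rule applies to both.\<close>
  have z: "0\<^sub>m a 0 \<in> carrier_mat a 0" "0\<^sub>m b 0 \<in> carrier_mat b 0"
    "0\<^sub>m 0 a \<in> carrier_mat 0 a" "0\<^sub>m 0 b \<in> carrier_mat 0 b" by auto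
  have p: "Lp * Rp \<in> carrier_mat a a" "Lp * Rm \<in> carrier_mat a b"
    "Lm * Rp \<in> carrier_mat b a" "Lm * Rm \<in> carrier_mat b b" using Rp Rm Lp Lm by auto
  have "(Lp @\<^sub>r Lm) * append_cols Rp Rm =
      four_block_mat (Lp * Rp) (Lp * Rm) (Lm * Rp) (Lm * Rm)"
    unfolding append_rows_def append_cols_def
    using mult_four_block_mat[OF Lp z(1) Lm z(2) Rp Rm z(3) z(4)] p Rp Rm Lp Lm by simp
  moreover have "(Lp @\<^sub>r Lm) * append_cols Rp Rm = 1\<^sub>m (a + b)"
    using L Rp Rm unfolding left_matrices_def by auto
  ultimately have "four_block_mat (Lp * Rp) (Lp * Rm) (Lm * Rp) (Lm * Rm) =
      four_block_mat (1\<^sub>m a) (0\<^sub>m a b) (0\<^sub>m b a) (1\<^sub>m b)" by simp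
  from four_block_mat_eqD[OF this p]
  show "Lp * Rp = 1\<^sub>m a" "Lp * Rm = 0\<^sub>m a b" "Lm * Rp = 0\<^sub>m b a" "Lm * Rm = 1\<^sub>m b" by auto
qed

text \<open>Both halves of the inverse relation are recorded, since the column counts
  \<open>a\<close> and \<open>b\<close> are not tied to \<open>n\<close> beforehand. Eigenvalues and
  their signs are absent, so A_11 and H share the locale and \<open>swap\<close> exchanges the two
  sides.\<close>

locale invariant_splitting =
  fixes n a b :: nat and N Rp Rm Lp Lm :: "real mat"
  assumes N: "N \<in> carrier_mat n n" and Rp: "Rp \<in> carrier_mat n a" and Rm: "Rm \<in> carrier_mat n b"
    and Lp: "Lp \<in> carrier_mat a n" and Lm: "Lm \<in> carrier_mat b n"
    and Lp_Rp: "Lp * Rp = 1\<^sub>m a" and Lp_Rm: "Lp * Rm = 0\<^sub>m a b"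
    and Lm_Rp: "Lm * Rp = 0\<^sub>m b a" and Lm_Rm: "Lm * Rm = 1\<^sub>m b"
    and resolution: "Rp * Lp + Rm * Lm = 1\<^sub>m n"
    and Rp_invariant: "y \<in> carrier_vec a \<Longrightarrow> \<exists>y'\<in>carrier_vec a. N *\<^sub>v (Rp *\<^sub>v y) = Rp *\<^sub>v y'"
    and Rm_invariant: "z \<in> carrier_vec b \<Longrightarrow> \<exists>z'\<in>carrier_vec b. N *\<^sub>v (Rm *\<^sub>v z) = Rm *\<^sub>v z'"
begin

lemma swap: "invariant_splitting n b a N Rm Rp Lm Lp"
proof
  show "Rm * Lm + Rp * Lp = 1\<^sub>m n"
    using resolution comm_add_mat[OF mult_carrier_mat[OF Rp Lp] mult_carrier_mat[OF Rm Lm]] by metis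
qed (fact N Rp Rm Lp Lm Lp_Rp Lp_Rm Lm_Rp Lm_Rm | erule Rp_invariant | erule Rm_invariant)+

text \<open>\<open>Lp\<close> annihilates the range of \<open>Rm\<close>, which \<open>N\<close>
  preserves. Hence \<open>Lp * N\<close> sees only the component
  \<open>Rp *\<^sub>v (Lp *\<^sub>v x)\<close> of x. The matrix \<open>Lp * N * Rp\<close> is
  \<open>N\<close> restricted to the range of \<open>Rp\<close>, in coordinates.\<close>

lemma Lp_commute: "Lp * N = (Lp * N * Rp) * Lp"
proof (rule mat_eq_if_mult_vec_eq)
  fix x :: "real vec" assume x: "x \<in> carrier_vec n"
  let ?y = "Lp *\<^sub>v x" and ?z = "Lm *\<^sub>v x"
  have y: "?y \<in> carrier_vec a" and z: "?z \<in> carrier_vec b" using Lp Lm x by auto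
  have Ry: "Rp *\<^sub>v ?y \<in> carrier_vec n" and Rz: "Rm *\<^sub>v ?z \<in> carrier_vec n"
    using Rp Rm y z by auto
  have "x = (Rp * Lp + Rm * Lm) *\<^sub>v x" using resolution x by simp
  also have "\<dots> = Rp *\<^sub>v ?y + Rm *\<^sub>v ?z"
    using Rp Rm Lp Lm x by (simp add: add_mult_distrib_mat_vec[of _ n n])
  finally have "N *\<^sub>v x = N *\<^sub>v (Rp *\<^sub>v ?y + Rm *\<^sub>v ?z)" by (rule arg_cong)
  also have "\<dots> = N *\<^sub>v (Rp *\<^sub>v ?y) + N *\<^sub>v (Rm *\<^sub>v ?z)"
    by (rule mult_add_distrib_mat_vec[OF N Ry Rz])
  finally have "N *\<^sub>v x = N *\<^sub>v (Rp *\<^sub>v ?y) + N *\<^sub>v (Rm *\<^sub>v ?z)" .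
  moreover obtain z' where z': "z' \<in> carrier_vec b" "N *\<^sub>v (Rm *\<^sub>v ?z) = Rm *\<^sub>v z'"
    using Rm_invariant[OF z] by auto
  ultimately have Nx: "N *\<^sub>v x = N *\<^sub>v (Rp *\<^sub>v ?y) + Rm *\<^sub>v z'" by argo
  have "Lp *\<^sub>v (Rm *\<^sub>v z') = 0\<^sub>v a"
    using assoc_mult_mat_vec[OF Lp Rm z'(1)] zero_mult_mat_vec[OF z'(1)] unfolding Lp_Rm by metis
  moreover have NRy: "N *\<^sub>v (Rp *\<^sub>v ?y) \<in> carrier_vec n" by (rule mult_mat_vec_carrier[OF N Ry])
  moreover have "Rm *\<^sub>v z' \<in> carrier_vec n" by (rule mult_mat_vec_carrier[OF Rm z'(1)])
  ultimately have "Lp *\<^sub>v (N *\<^sub>v x) = Lp *\<^sub>v (N *\<^sub>v (Rp *\<^sub>v ?y))"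
    unfolding Nx using mult_add_distrib_mat_vec[OF Lp NRy] right_zero_vec[OF mult_mat_vec_carrier[OF Lp NRy]]
    by metis
  then show "(Lp * N) *\<^sub>v x = (Lp * N * Rp * Lp) *\<^sub>v x"
    unfolding assoc_mult_mat_vec[OF mult_carrier_mat[OF mult_carrier_mat[OF Lp N] Rp] Lp x]
      assoc_mult_mat_vec[OF Lp N x] mult_mat3_vec[OF Lp N Rp y] .
qed (use Lp N Rp in auto)

text \<open>By invariance \<open>N *\<^sub>v (Rp *\<^sub>v y)\<close> has coordinates in the columns
  of \<open>Rp\<close>, and these are exactly the value of the compressed matrix at
  \<open>y\<close>. If they vanish, injectivity of \<open>N\<close> and then of \<open>Rp\<close>
  gives y = 0.\<close>

lemma Lp_N_Rp_injective:
  assumes inj: "\<And>x. x \<in> carrier_vec n \<Longrightarrow> N *\<^sub>v x = 0\<^sub>v n \<Longrightarrow> x = 0\<^sub>v n"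
    and y: "y \<in> carrier_vec a" and My: "(Lp * N * Rp) *\<^sub>v y = 0\<^sub>v a"
  shows "y = 0\<^sub>v a"
proof -
  obtain y' where y': "y' \<in> carrier_vec a" "N *\<^sub>v (Rp *\<^sub>v y) = Rp *\<^sub>v y'"
    using Rp_invariant[OF y] by auto
  have id: "Lp *\<^sub>v (Rp *\<^sub>v w) = w" if "w \<in> carrier_vec a" for w
    using assoc_mult_mat_vec[OF Lp Rp that] one_mult_mat_vec[OF that] unfolding Lp_Rp by argo
  have "y' = 0\<^sub>v a"
    using My unfolding mult_mat3_vec[OF Lp N Rp y] y'(2) id[OF y'(1)] .
  then have "N *\<^sub>v (Rp *\<^sub>v y) = 0\<^sub>v n" using y'(2) mult_zero_vec[OF Rp] by argo
  then have "Rp *\<^sub>v y = 0\<^sub>v n" by (rule inj[OF mult_mat_vec_carrier[OF Rp y]])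
  then show ?thesis using id[OF y] mult_zero_vec[OF Lp] by argo
qed

end

section \<open>From spectral subspaces to splittings\<close>

lemma right_basis_matrix_spectral:
  assumes N: "N \<in> carrier_mat n n" and R: "right_basis_matrix Z N R"
  shows "R \<in> carrier_mat n (dim_col R)"
    "spectral_subspace Z N = {R *\<^sub>v y |y. y \<in> carrier_vec (dim_col R)}"
proof -
  show Rc: "R \<in> carrier_mat n (dim_col R)" using assms unfolding right_basis_matrix_def by auto
  interpret vec_space "TYPE(real)" n .
  have n: "dim_row N = n" "dim_row R = n" using N Rc by auto
  have "spectral_subspace Z N = col_space R"
    using R unfolding right_basis_matrix_def n by metis
  also have "\<dots> = {R *\<^sub>v y |y. y \<in> carrier_vec (dim_col R)}"
    unfolding col_space_eq[OF Rc] n using mult_mat_vec_carrier[OF Rc] by blast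
  finally show "spectral_subspace Z N = {R *\<^sub>v y |y. y \<in> carrier_vec (dim_col R)}" .
qed

text \<open>The missing half of the inverse relation comes from spanning: write x as
  \<open>Rp *\<^sub>v y + Rm *\<^sub>v z\<close>; the given half reads off y and z as
  \<open>Lp *\<^sub>v x\<close> and \<open>Lm *\<^sub>v x\<close>, so the two projections add up to
  x.\<close>

lemma spectral_splitting:
  assumes N: "N \<in> carrier_mat n n" and no_im: "\<forall>e. eigenvalue (cmat N) e \<longrightarrow> Re e \<noteq> 0"
    and Rp: "right_unstable N Rp" and Rm: "right_stable N Rm" and L: "left_matrices Rp Rm Lp Lm"
  shows "invariant_splitting n (dim_col Rp) (dim_col Rm) N Rp Rm Lp Lm"
proof -
  note p = right_basis_matrix_spectral[OF N Rp[unfolded right_unstable_def]]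
  note m = right_basis_matrix_spectral[OF N Rm[unfolded right_stable_def]]
  note L = left_matrices_blocks[OF L p(1) m(1)]
  have res: "Rp * Lp + Rm * Lm = 1\<^sub>m n"
  proof (rule mat_eq_if_mult_vec_eq)
    fix x :: "real vec" assume x: "x \<in> carrier_vec n"
    obtain y z where y: "y \<in> carrier_vec (dim_col Rp)" and z: "z \<in> carrier_vec (dim_col Rm)"
      and xyz: "x = Rp *\<^sub>v y + Rm *\<^sub>v z"
      using spectral_subspace_sum[OF N no_im x] unfolding p(2) m(2) by blast
    have Ry: "Rp *\<^sub>v y \<in> carrier_vec n" and Rz: "Rm *\<^sub>v z \<in> carrier_vec n"
      using mult_mat_vec_carrier[OF p(1) y] mult_mat_vec_carrier[OF m(1) z] by auto
    have "Lp *\<^sub>v x = (Lp * Rp) *\<^sub>v y + (Lp * Rm) *\<^sub>v z"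
      unfolding xyz mult_add_distrib_mat_vec[OF L(1) Ry Rz]
        assoc_mult_mat_vec[OF L(1) p(1) y] assoc_mult_mat_vec[OF L(1) m(1) z] ..
    then have Lpx: "Lp *\<^sub>v x = y"
      unfolding L zero_mult_mat_vec[OF z] one_mult_mat_vec[OF y] right_zero_vec[OF y] .
    have "Lm *\<^sub>v x = (Lm * Rp) *\<^sub>v y + (Lm * Rm) *\<^sub>v z"
      unfolding xyz mult_add_distrib_mat_vec[OF L(2) Ry Rz]
        assoc_mult_mat_vec[OF L(2) p(1) y] assoc_mult_mat_vec[OF L(2) m(1) z] ..
    then have Lmx: "Lm *\<^sub>v x = z"
      unfolding L zero_mult_mat_vec[OF y] one_mult_mat_vec[OF z] left_zero_vec[OF z] .
    show "(Rp * Lp + Rm * Lm) *\<^sub>v x = 1\<^sub>m n *\<^sub>v x"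
      unfolding add_mult_distrib_mat_vec[OF mult_carrier_mat[OF p(1) L(1)] mult_carrier_mat[OF m(1) L(2)] x]
        assoc_mult_mat_vec[OF p(1) L(1) x] assoc_mult_mat_vec[OF m(1) L(2) x] Lpx Lmx
        one_mult_mat_vec[OF x] xyz[symmetric] ..
  qed (rule add_carrier_mat[OF mult_carrier_mat[OF m(1) L(2)]], rule one_carrier_mat)
  have inv: "\<exists>y'\<in>carrier_vec (dim_col R). N *\<^sub>v (R *\<^sub>v y) = R *\<^sub>v y'"
    if spec: "spectral_subspace Z N = {R *\<^sub>v y |y. y \<in> carrier_vec (dim_col R)}"
      and y: "y \<in> carrier_vec (dim_col R)" for R Z y
  proof -
    have "R *\<^sub>v y \<in> spectral_subspace Z N" unfolding spec using y by blast
    then have "N *\<^sub>v (R *\<^sub>v y) \<in> spectral_subspace Z N"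
      by (rule spectral_subspace_invariant[OF N])
    then show ?thesis unfolding spec by blast
  qed
  show ?thesis
    by (rule invariant_splitting.intro[OF N p(1) m(1) L res inv[OF p(2)] inv[OF m(2)]])
qed

section \<open>Inverses, and eigenvalues of hyperbolic matrices\<close>

lemma mult_mat_vec_uminus:
  fixes M :: "real mat"
  assumes M: "M \<in> carrier_mat n k" and v: "v \<in> carrier_vec k"
  shows "M *\<^sub>v (- v) = - (M *\<^sub>v v)"
  using M v by (intro eq_vecI) auto

lemma invertible_mat_imp_injective:
  fixes A :: "real mat"
  assumes A: "A \<in> carrier_mat n n" and inv: "invertible_mat A"
    and v: "v \<in> carrier_vec n" and Av: "A *\<^sub>v v = 0\<^sub>v n"
  shows "v = 0\<^sub>v n"
proof -
  obtain B where AB: "A * B = 1\<^sub>m n" and BA: "B * A = 1\<^sub>m (dim_row B)"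
    using inv A unfolding invertible_mat_def inverts_mat_def by auto
  have "dim_col B = n" using arg_cong[OF AB, of dim_col] by simp
  \<comment> \<open>The size of the inverse is read off from the two identity matrices, because
    \<open>invertible_mat\<close> does not prescribe it.\<close>
  moreover have rB: "dim_row B = n" using arg_cong[OF BA, of dim_col] A by simp
  ultimately have B: "B \<in> carrier_mat n n" by auto
  have "v = (B * A) *\<^sub>v v" unfolding BA rB using v by simp
  also have "\<dots> = 0\<^sub>v n" unfolding assoc_mult_mat_vec[OF B A v] Av by (rule mult_zero_vec[OF B])
  finally show ?thesis .
qed

text \<open>Injectivity is the hypothesis because this is what block elimination yields for the
  Schur complement. A nonzero determinant guarantees that \<open>mat_inverse\<close> returns a
  value, so \<open>the\<close> in \<open>minv\<close> is meaningful.\<close>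

lemma minv_injective:
  assumes A: "A \<in> carrier_mat n n"
    and inj: "\<And>v. v \<in> carrier_vec n \<Longrightarrow> A *\<^sub>v v = 0\<^sub>v n \<Longrightarrow> v = 0\<^sub>v n"
  shows "minv A \<in> carrier_mat n n" "A * minv A = 1\<^sub>m n" "minv A * A = 1\<^sub>m n"
proof -
  have "det A \<noteq> 0" unfolding det_0_iff_vec_prod_zero[OF A] using inj by blast
  then have "A \<in> Units (ring_mat TYPE(real) n ())" by (rule det_non_zero_imp_unit[OF A])
  then obtain B where "mat_inverse A = Some B"
    using mat_inverse(1)[OF A, where b = "()"] by (metis option.exhaust)
  then show "minv A \<in> carrier_mat n n" "A * minv A = 1\<^sub>m n" "minv A * A = 1\<^sub>m n"
    using mat_inverse(2)[OF A] unfolding minv_def by auto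
qed

lemma minv_invertible:
  assumes "A \<in> carrier_mat n n" "invertible_mat A"
  shows "minv A \<in> carrier_mat n n" "A * minv A = 1\<^sub>m n" "minv A * A = 1\<^sub>m n"
  using minv_injective[OF assms(1)] invertible_mat_imp_injective[OF assms] by blast+

text \<open>After complexification the eigenvalues are still the real diagonal entries of
  \<open>D\<close>. One with vanishing real part would be 0, and a kernel vector of \<open>A\<close>
  would contradict invertibility.\<close>

lemma real_diagonalizable_no_imaginary_eigenvalue:
  assumes A: "A \<in> carrier_mat n n" and diag: "real_diagonalizable A"
    and inv: "invertible_mat A" and e: "eigenvalue (cmat A) e"
  shows "Re e \<noteq> 0"
proof
  assume re: "Re e = 0"
  obtain D P P' where wit: "similar_mat_wit A D P P'" and D: "diagonal_mat D"
    using diag unfolding real_diagonalizable_def similar_mat_def by auto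
  note c = similar_mat_witD2[OF A wit]
  have ut: "upper_triangular D" using D c(5) unfolding diagonal_mat_def upper_triangular_def by auto
  then have utc: "upper_triangular (cmat D)" using c(5) unfolding upper_triangular_def by auto
  have "similar_mat (cmat A) (cmat D)"
  proof (rule similar_matI)
    show "cmat P * cmat P' = 1\<^sub>m n" "cmat P' * cmat P = 1\<^sub>m n"
      using of_real_hom.mat_hom_mult[OF c(6,7), symmetric] of_real_hom.mat_hom_mult[OF c(7,6), symmetric]
      unfolding c(1,2) by (simp_all add: of_real_hom.mat_hom_one)
    show "cmat A = cmat P * cmat D * cmat P'"
      using of_real_hom.mat_hom_mult[OF c(6,5)] of_real_hom.mat_hom_mult[OF mult_carrier_mat[OF c(6,5)] c(7)]
        c(3) by metis
  qed (use c in auto)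
  note cp = char_poly_similar[OF this, unfolded char_poly_upper_triangular[OF map_carrier_mat[THEN iffD2, OF c(5)] utc]]
  have "poly (char_poly (cmat A)) e = 0"
    using e eigenvalue_root_char_poly[OF map_carrier_mat[THEN iffD2, OF A]] by blast
  then have "e \<in> set (diag_mat (cmat D))"
    unfolding cp poly_prod_list by (auto simp: prod_list_zero_iff)
  then obtain i where i: "i < n" "e = of_real (D $$ (i, i))" using c(5) unfolding diag_mat_def by auto
  then have "D $$ (i, i) = 0" using re by simp
  then have "0 \<in> set (diag_mat D)" using i c(5) unfolding diag_mat_def by force
  then have "poly (char_poly A) 0 = 0"
    unfolding char_poly_similar[of A D, unfolded similar_mat_def, OF exI, OF exI, OF wit]
      char_poly_upper_triangular[OF c(5) ut] poly_prod_list
    by (auto simp: prod_list_zero_iff)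
  then obtain v where "eigenvector A v 0"
    unfolding eigenvalue_root_char_poly[OF A, symmetric] eigenvalue_def by auto
  then have v: "v \<in> carrier_vec n" "v \<noteq> 0\<^sub>v n" "A *\<^sub>v v = 0\<^sub>v n"
    unfolding eigenvector_def using A by auto
  then show False using invertible_mat_imp_injective[OF A inv] by blast
qed

text \<open>A left inverse and a right inverse of the juxtaposed matrix coincide. An explicit
  candidate for the left matrices therefore needs to be tested only as a right inverse.\<close>

lemma left_inverse_unique:
  fixes Rp :: "real mat"
  assumes Rp: "Rp \<in> carrier_mat n a" and Rm: "Rm \<in> carrier_mat n b" and Lp: "Lp \<in> carrier_mat a n"
    and Ep: "Ep \<in> carrier_mat a n" and Em: "Em \<in> carrier_mat b n"
    and Lp_Rp: "Lp * Rp = 1\<^sub>m a" and Lp_Rm: "Lp * Rm = 0\<^sub>m a b"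
    and resolution: "Rp * Ep + Rm * Em = 1\<^sub>m n"
  shows "Lp = Ep"
proof -
  have "Lp = Lp * (Rp * Ep + Rm * Em)" unfolding resolution using right_mult_one_mat[OF Lp] by simp
  also have "\<dots> = Lp * (Rp * Ep) + Lp * (Rm * Em)"
    by (rule mult_add_distrib_mat[OF Lp mult_carrier_mat[OF Rp Ep] mult_carrier_mat[OF Rm Em]])
  also have "\<dots> = (Lp * Rp) * Ep + (Lp * Rm) * Em"
    unfolding assoc_mult_mat[OF Lp Rp Ep] assoc_mult_mat[OF Lp Rm Em] ..
  also have "\<dots> = Ep"
    unfolding Lp_Rp Lp_Rm left_mult_one_mat[OF Ep] left_mult_zero_mat[OF Em] right_add_zero_mat[OF Ep] ..
  finally show ?thesis .
qed

section \<open>Block forms of the limiting frame, its left matrices and the flux\<close>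

lemma R_infinity_eq:
  assumes K: "minv A11 * A12 \<in> carrier_mat m r" and R1: "R1 \<in> carrier_mat m a" and RH: "RH \<in> carrier_mat r d"
  shows "R_infinity A11 A12 R1 RH =
    four_block_mat R1 (- (minv A11 * A12 * RH)) (0\<^sub>m r a) RH"
proof -
  let ?K = "minv A11 * A12"
  have K': "- ?K \<in> carrier_mat m r" using K by simp
  have dims: "dim_row R1 = m" "dim_col R1 = a" "dim_row RH = r" "dim_col RH = d" using R1 RH by auto
  have "R_infinity A11 A12 R1 RH =
      four_block_mat (1\<^sub>m m * R1 + (- ?K) * 0\<^sub>m r a) (1\<^sub>m m * 0\<^sub>m m d + (- ?K) * RH)
        (0\<^sub>m r m * R1 + 1\<^sub>m r * 0\<^sub>m r a) (0\<^sub>m r m * 0\<^sub>m m d + 1\<^sub>m r * RH)"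
    unfolding R_infinity_def dims Let_def
    by (rule mult_four_block_mat[OF one_carrier_mat K' zero_carrier_mat one_carrier_mat R1
          zero_carrier_mat zero_carrier_mat RH])
  moreover have "(- ?K) * RH = - (?K * RH)" by (rule uminus_mult_left_mat) (use carrier_matD[OF K] RH in simp)
  ultimately show ?thesis
    using R1 RH K' mult_carrier_mat[OF K RH] left_mult_one_mat[OF R1] left_mult_one_mat[OF RH]
    by (simp add: right_mult_zero_mat[OF K'] left_mult_zero_mat[OF R1])
qed

text \<open>Block elimination: if the Schur complement kills v, then \<open>A\<close> kills the
  vector with upper part - A_11^{-1} A_12 v and lower part v.\<close>

lemma schur_complement_injective:
  assumes c: "A11 \<in> carrier_mat m m" "A12 \<in> carrier_mat m r" "A21 \<in> carrier_mat r m" "A22 \<in> carrier_mat r r"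
    and inv: "invertible_mat A11" "invertible_mat (four_block_mat A11 A12 A21 A22)"
    and v: "v \<in> carrier_vec r" and z: "(A22 - A21 * minv A11 * A12) *\<^sub>v v = 0\<^sub>v r"
  shows "v = 0\<^sub>v r"
proof -
  note i = minv_invertible[OF c(1) inv(1)]
  let ?K = "minv A11 * A12"
  have K: "?K \<in> carrier_mat m r" using i c by simp
  have A11K: "A11 * ?K = A12"
    unfolding assoc_mult_mat[OF c(1) i(1) c(2), symmetric] i(2) by (rule left_mult_one_mat[OF c(2)])
  define w where "w = ?K *\<^sub>v v"
  have w: "w \<in> carrier_vec m" unfolding w_def by (rule mult_mat_vec_carrier[OF K v])
  have A11w: "A11 *\<^sub>v w = A12 *\<^sub>v v"
    unfolding w_def assoc_mult_mat_vec[OF c(1) K v, symmetric] A11K ..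
  have "(A22 - A21 * minv A11 * A12) *\<^sub>v v = A22 *\<^sub>v v - A21 *\<^sub>v w"
    unfolding w_def assoc_mult_mat[OF c(3) i(1) c(2)]
      minus_mult_distrib_mat_vec[OF c(4) mult_carrier_mat[OF c(3) K] v] assoc_mult_mat_vec[OF c(3) K v] ..
  then have e: "A22 *\<^sub>v v - A21 *\<^sub>v w = 0\<^sub>v r" using z by simp
  have mw: "- w \<in> carrier_vec m" using w by simp
  have "four_block_mat A11 A12 A21 A22 *\<^sub>v (- w @\<^sub>v v) =
      (A11 *\<^sub>v (- w) + A12 *\<^sub>v v) @\<^sub>v (A21 *\<^sub>v (- w) + A22 *\<^sub>v v)"
    by (rule four_block_mat_mult_vec[OF c mw v])
  also have "A11 *\<^sub>v (- w) + A12 *\<^sub>v v = 0\<^sub>v m"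
    using A11w c v unfolding mult_mat_vec_uminus[OF c(1) w] by (auto intro!: eq_vecI)
  also have "A21 *\<^sub>v (- w) + A22 *\<^sub>v v = 0\<^sub>v r"
    using e c v unfolding mult_mat_vec_uminus[OF c(3) w] by (auto simp: vec_eq_iff)
  finally have "four_block_mat A11 A12 A21 A22 *\<^sub>v (- w @\<^sub>v v) = 0\<^sub>v (m + r)" by auto
  moreover have "- w @\<^sub>v v \<in> carrier_vec (m + r)" using mw v by auto
  ultimately have "- w @\<^sub>v v = 0\<^sub>v (m + r)"
    using invertible_mat_imp_injective[OF four_block_carrier_mat[OF c(1,4)] inv(2)] by blast
  then have "- w @\<^sub>v v = 0\<^sub>v m @\<^sub>v 0\<^sub>v r" by auto
  then show ?thesis using append_vec_eq[OF mw zero_carrier_vec] by blast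
qed

text \<open>The frame is the product of the unipotent matrix with corner -K and the block diagonal
  matrix of R^1 and R^H. Inverting the factors in reverse order suggests diag(L^1, L^H) times the
  unipotent matrix with corner K, whose blocks are those claimed. The candidate is confirmed as a
  right inverse and identified by \<open>left_inverse_unique\<close>.\<close>

lemma L_infinity_eq:
  assumes s1: "invariant_splitting m a b A11 R1p R1m L1p L1m"
    and sH: "invariant_splitting r d c H RHm RHp LHm LHp"
    and K: "K \<in> carrier_mat m r"
    and Lp: "Lp \<in> carrier_mat (a + d) (m + r)"
    and Lp_Rp: "Lp * four_block_mat R1p (- (K * RHm)) (0\<^sub>m r a) RHm = 1\<^sub>m (a + d)"
    and Lp_Rm: "Lp * four_block_mat R1m (- (K * RHp)) (0\<^sub>m r b) RHp = 0\<^sub>m (a + d) (b + c)"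
  shows "Lp = four_block_mat L1p (L1p * K) (0\<^sub>m d m) LHm"
proof -
  interpret s1: invariant_splitting m a b A11 R1p R1m L1p L1m by fact
  interpret sH: invariant_splitting r d c H RHm RHp LHm LHp by fact
  define Pp Pm Vm Vp where "Pp = R1p * L1p" and "Pm = R1m * L1m" and "Vm = RHm * LHm" and "Vp = RHp * LHp"
  note PV = Pp_def Pm_def Vm_def Vp_def
  have P: "Pp \<in> carrier_mat m m" "Pm \<in> carrier_mat m m" "Vm \<in> carrier_mat r r" "Vp \<in> carrier_mat r r"
    unfolding PV using s1.Rp s1.Lp s1.Rm s1.Lm sH.Rp sH.Lp sH.Rm sH.Lm by auto
  have block: "four_block_mat R1 (- (K * RH)) (0\<^sub>m r k) RH * four_block_mat L1 (L1 * K) (0\<^sub>m l m) LH =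
      four_block_mat (R1 * L1) (R1 * L1 * K - K * (RH * LH)) (0\<^sub>m r m) (RH * LH)"
    if R1: "R1 \<in> carrier_mat m k" and RH: "RH \<in> carrier_mat r l"
      and L1: "L1 \<in> carrier_mat k m" and LH: "LH \<in> carrier_mat l r" for R1 RH L1 LH :: "real mat" and k l
  proof -
    have KRH: "K * RH \<in> carrier_mat m l" and L1K: "L1 * K \<in> carrier_mat k r" using K RH L1 by auto
    have c: "- (K * RH) \<in> carrier_mat m l" using KRH by simp
    have "R1 * (L1 * K) + - (K * RH) * LH = R1 * L1 * K - K * (RH * LH)"
      using carrier_matD[OF RH] carrier_matD[OF LH] KRH LH assoc_mult_mat[OF R1 L1 K] assoc_mult_mat[OF K RH LH]
        add_uminus_minus_mat[OF mult_carrier_mat[OF R1 L1K] mult_carrier_mat[OF KRH LH]] by simp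
    moreover have "R1 * L1 + - (K * RH) * 0\<^sub>m l m = R1 * L1"
      using right_add_zero_mat[OF mult_carrier_mat[OF R1 L1]] right_mult_zero_mat[OF c] by simp
    moreover have "0\<^sub>m r k * L1 + RH * 0\<^sub>m l m = 0\<^sub>m r m"
      using left_mult_zero_mat[OF L1] right_mult_zero_mat[OF RH] by simp
    moreover have "0\<^sub>m r k * (L1 * K) + RH * LH = RH * LH"
      using left_mult_zero_mat[OF L1K] left_add_zero_mat[OF mult_carrier_mat[OF RH LH]] by simp
    ultimately show ?thesis
      using mult_four_block_mat[OF R1 c zero_carrier_mat RH L1 L1K zero_carrier_mat LH] by metis
  qed
  \<comment> \<open>The corner blocks add up to K - K: both the projections of A_11, applied from
    the left, and those of H, applied from the right, sum to the identity.\<close>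
  have mid: "(Pp * K - K * Vm) + (Pm * K - K * Vp) = 0\<^sub>m m r"
  proof -
    have 1: "Pp * K + Pm * K = K"
      using add_mult_distrib_mat[OF P(1,2) K] s1.resolution left_mult_one_mat[OF K] unfolding PV by metis
    have 2: "K * Vm + K * Vp = K"
      using mult_add_distrib_mat[OF K P(3,4)] sH.resolution right_mult_one_mat[OF K] unfolding PV by metis
    have c: "Pp * K \<in> carrier_mat m r" "Pm * K \<in> carrier_mat m r" "K * Vm \<in> carrier_mat m r" "K * Vp \<in> carrier_mat m r"
      using P K by auto
    show ?thesis
    proof (rule eq_matI)
      fix i j assume "i < dim_row (0\<^sub>m m r :: real mat)" "j < dim_col (0\<^sub>m m r :: real mat)"
      then have ij: "i < m" "j < r" by auto
      define x1 x2 x3 x4 where "x1 = Pp * K" and "x2 = Pm * K" and "x3 = K * Vm" and "x4 = K * Vp"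
      note x = x1_def x2_def x3_def x4_def
      have "x1 $$ (i, j) + x2 $$ (i, j) = K $$ (i, j)" "x3 $$ (i, j) + x4 $$ (i, j) = K $$ (i, j)"
        using arg_cong[OF 1, of "\<lambda>M. M $$ (i, j)"] arg_cong[OF 2, of "\<lambda>M. M $$ (i, j)"] ij c
        unfolding x[symmetric] by auto
      then show "(Pp * K - K * Vm + (Pm * K - K * Vp)) $$ (i, j) = 0\<^sub>m m r $$ (i, j)"
        using ij c unfolding x[symmetric] by auto
    qed (use c in auto)
  qed
  have c: "Pp * K - K * Vm \<in> carrier_mat m r" "Pm * K - K * Vp \<in> carrier_mat m r"
    using P K by auto
  have "four_block_mat R1p (- (K * RHm)) (0\<^sub>m r a) RHm * four_block_mat L1p (L1p * K) (0\<^sub>m d m) LHm +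
      four_block_mat R1m (- (K * RHp)) (0\<^sub>m r b) RHp * four_block_mat L1m (L1m * K) (0\<^sub>m c m) LHp =
      four_block_mat (Pp + Pm) ((Pp * K - K * Vm) + (Pm * K - K * Vp)) (0\<^sub>m r m + 0\<^sub>m r m) (Vm + Vp)"
    unfolding block[OF s1.Rp sH.Rp s1.Lp sH.Lp] block[OF s1.Rm sH.Rm s1.Lm sH.Lm] PV[symmetric]
    by (rule add_four_block_mat[OF P(1) c(1) zero_carrier_mat P(3) P(2) c(2) zero_carrier_mat P(4)])
  also have "\<dots> = 1\<^sub>m (m + r)"
    unfolding mid using s1.resolution sH.resolution unfolding PV by simp
  finally have resolution: "four_block_mat R1p (- (K * RHm)) (0\<^sub>m r a) RHm * four_block_mat L1p (L1p * K) (0\<^sub>m d m) LHm +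
      four_block_mat R1m (- (K * RHp)) (0\<^sub>m r b) RHp * four_block_mat L1m (L1m * K) (0\<^sub>m c m) LHp = 1\<^sub>m (m + r)" .
  show ?thesis
    by (rule left_inverse_unique[OF four_block_carrier_mat[OF s1.Rp sH.Rp] four_block_carrier_mat[OF s1.Rm sH.Rm]
          Lp four_block_carrier_mat[OF s1.Lp sH.Lp] four_block_carrier_mat[OF s1.Lm sH.Lm] Lp_Rp Lp_Rm resolution])
qed

text \<open>\<open>L1\<close> sees (u, v) only through u + K v, and the columns of R^infinity
  carrying \<open>RH\<close> contribute nothing to the upper flux because A_12 - A_11 K = 0. The
  lower half is left as an unspecified \<open>w\<close>, since it is discarded when the blocks are
  separated.\<close>

lemma upwind_flux:
  fixes A11 A12 A21 A22 K R1 RH L1 LH :: "real mat"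
  assumes c: "A11 \<in> carrier_mat m m" "A12 \<in> carrier_mat m r" "A21 \<in> carrier_mat r m" "A22 \<in> carrier_mat r r"
    and K: "K \<in> carrier_mat m r" and A11K: "A11 * K = A12"
    and R1: "R1 \<in> carrier_mat m a" and RH: "RH \<in> carrier_mat r d"
    and L1: "L1 \<in> carrier_mat a m" and LH: "LH \<in> carrier_mat d r"
    and u: "u \<in> carrier_vec m" and v: "v \<in> carrier_vec r"
  shows "\<exists>w\<in>carrier_vec r.
     (four_block_mat A11 A12 A21 A22 * four_block_mat R1 (- (K * RH)) (0\<^sub>m r a) RH
       * four_block_mat L1 (L1 * K) (0\<^sub>m d m) LH) *\<^sub>v (u @\<^sub>v v)
     = (A11 * R1 * L1) *\<^sub>v (u + K *\<^sub>v v) @\<^sub>v w"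
proof -
  have Kv: "K *\<^sub>v v \<in> carrier_vec m" using K v by simp
  define x y where "x = L1 *\<^sub>v (u + K *\<^sub>v v)" and "y = LH *\<^sub>v v"
  have x: "x \<in> carrier_vec a" and y: "y \<in> carrier_vec d" unfolding x_def y_def using L1 LH u v Kv by auto
  have xx: "L1 *\<^sub>v u + (L1 * K) *\<^sub>v v = x"
    unfolding x_def assoc_mult_mat_vec[OF L1 K v] by (rule mult_add_distrib_mat_vec[OF L1 u Kv, symmetric])
  have yy: "0\<^sub>m d m *\<^sub>v u + LH *\<^sub>v v = y"
    unfolding y_def zero_mult_mat_vec[OF u] by (rule left_zero_vec[OF mult_mat_vec_carrier[OF LH v]])
  have KRH: "K * RH \<in> carrier_mat m d" using K RH by simp
  then have mKRH: "- (K * RH) \<in> carrier_mat m d" by simp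
  define p q where "p = R1 *\<^sub>v x" and "q = RH *\<^sub>v y"
  have p: "p \<in> carrier_vec m" and q: "q \<in> carrier_vec r" unfolding p_def q_def using R1 RH x y by auto
  have Kq: "K *\<^sub>v q \<in> carrier_vec m" using K q by simp
  have pp: "R1 *\<^sub>v x + - (K * RH) *\<^sub>v y = p - K *\<^sub>v q"
  proof -
    have "- (K * RH) *\<^sub>v y = - (K *\<^sub>v q)"
      unfolding q_def assoc_mult_mat_vec[OF K RH y, symmetric]
      by (rule uminus_mult_mat_vec) (use carrier_matD[OF RH] y in simp)
    then show ?thesis unfolding p_def[symmetric] using p Kq by (auto intro!: eq_vecI)
  qed
  have qq: "0\<^sub>m r a *\<^sub>v x + RH *\<^sub>v y = q"
    unfolding zero_mult_mat_vec[OF x] q_def[symmetric] by (rule left_zero_vec[OF q])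
  have pKq: "p - K *\<^sub>v q \<in> carrier_vec m" using p Kq by simp
  let ?w = "A21 *\<^sub>v (p - K *\<^sub>v q) + A22 *\<^sub>v q"
  \<comment> \<open>The H component q cancels here: A_11 K = A_12.\<close>
  have "A11 *\<^sub>v (p - K *\<^sub>v q) + A12 *\<^sub>v q = A11 *\<^sub>v p"
  proof -
    have "A11 *\<^sub>v (p - K *\<^sub>v q) = A11 *\<^sub>v p - A12 *\<^sub>v q"
      using mult_minus_distrib_mat_vec[OF c(1) p Kq] assoc_mult_mat_vec[OF c(1) K q] unfolding A11K by argo
    then show ?thesis using c p q by (auto intro!: eq_vecI)
  qed
  moreover have "A11 *\<^sub>v p = (A11 * R1 * L1) *\<^sub>v (u + K *\<^sub>v v)"
    unfolding p_def x_def by (rule mult_mat3_vec[OF c(1) R1 L1, symmetric]) (use u Kv in simp)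
  moreover have "(four_block_mat A11 A12 A21 A22 * four_block_mat R1 (- (K * RH)) (0\<^sub>m r a) RH
       * four_block_mat L1 (L1 * K) (0\<^sub>m d m) LH) *\<^sub>v (u @\<^sub>v v) =
      four_block_mat A11 A12 A21 A22 *\<^sub>v (four_block_mat R1 (- (K * RH)) (0\<^sub>m r a) RH
       *\<^sub>v (four_block_mat L1 (L1 * K) (0\<^sub>m d m) LH *\<^sub>v (u @\<^sub>v v)))"
    by (rule mult_mat3_vec[OF four_block_carrier_mat[OF c(1,4)] four_block_carrier_mat[OF R1 RH]
          four_block_carrier_mat[OF L1 LH]]) (use u v in simp)
  ultimately have "(four_block_mat A11 A12 A21 A22 * four_block_mat R1 (- (K * RH)) (0\<^sub>m r a) RH
       * four_block_mat L1 (L1 * K) (0\<^sub>m d m) LH) *\<^sub>v (u @\<^sub>v v) = (A11 * R1 * L1) *\<^sub>v (u + K *\<^sub>v v) @\<^sub>v ?w"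
    unfolding four_block_mat_mult_vec[OF L1 mult_carrier_mat[OF L1 K] zero_carrier_mat LH u v] xx yy
      four_block_mat_mult_vec[OF R1 mKRH zero_carrier_mat RH x y] pp qq
      four_block_mat_mult_vec[OF c pKq q] by argo
  moreover have "?w \<in> carrier_vec r" using c pKq q by auto
  ultimately show ?thesis by blast
qed

lemma negative_definite_injective:
  assumes S: "negative_definite r S" and v: "v \<in> carrier_vec r" and Sv: "S *\<^sub>v v = 0\<^sub>v r"
  shows "v = 0\<^sub>v r"
proof (rule ccontr)
  assume "v \<noteq> 0\<^sub>v r"
  then have "v \<bullet> (S *\<^sub>v v) < 0" using S v unfolding negative_definite_def by blast
  then show False unfolding Sv using v by simp
qed

section \<open>The stiff limit\<close>

text \<open>\<open>vec_tendsto\<close> compares only the components below the dimension of the limit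
  and does not fix the dimension of the approximating vectors. Adding both dimensions makes
  convergence compatible with matrix and vector operations.\<close>

definition vtends :: "nat \<Rightarrow> (real \<Rightarrow> real vec) \<Rightarrow> real vec \<Rightarrow> real filter \<Rightarrow> bool" where
  "vtends n f l F \<longleftrightarrow> l \<in> carrier_vec n \<and> (\<forall>\<^sub>F x in F. f x \<in> carrier_vec n) \<and> vec_tendsto f l F"

text \<open>The function \<open>g\<close> stands for the component formula, which is valid only once
  the vectors have the right dimension; an eventual equality is therefore all that is asked.\<close>

lemma vtendsI:
  assumes "l \<in> carrier_vec n" "\<forall>\<^sub>F x in F. f x \<in> carrier_vec n"
    and "\<And>i. i < n \<Longrightarrow> \<exists>g. ((\<lambda>x. g x) \<longlongrightarrow> l $ i) F \<and> (\<forall>\<^sub>F x in F. f x $ i = g x)"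
  shows "vtends n f l F"
proof -
  have "((\<lambda>x. f x $ i) \<longlongrightarrow> l $ i) F" if "i < n" for i
    using assms(3)[OF that] tendsto_cong by force
  then show ?thesis unfolding vtends_def vec_tendsto_def using assms(1,2) by auto
qed

lemma vtends_index: "vtends n f l F \<Longrightarrow> i < n \<Longrightarrow> ((\<lambda>x. f x $ i) \<longlongrightarrow> l $ i) F"
  unfolding vtends_def vec_tendsto_def by auto

lemma vtends_carrier:
  "vtends n f l F \<Longrightarrow> l \<in> carrier_vec n" "vtends n f l F \<Longrightarrow> \<forall>\<^sub>F x in F. f x \<in> carrier_vec n"
  unfolding vtends_def by auto

lemma vtends_mult:
  assumes M: "M \<in> carrier_mat n k" and f: "vtends k f l F"
  shows "vtends n (\<lambda>x. M *\<^sub>v f x) (M *\<^sub>v l) F"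
proof (rule vtendsI)
  have idx: "(M *\<^sub>v y) $ i = (\<Sum>j<k. M $$ (i, j) * y $ j)" if "i < n" "y \<in> carrier_vec k" for i y
    using that M by (auto simp: scalar_prod_def atLeast0LessThan intro!: sum.cong)
  fix i assume i: "i < n"
  have "((\<lambda>x. \<Sum>j<k. M $$ (i, j) * f x $ j) \<longlongrightarrow> (\<Sum>j<k. M $$ (i, j) * l $ j)) F"
    by (intro tendsto_intros) (use f in \<open>auto intro: vtends_index\<close>)
  moreover have "\<forall>\<^sub>F x in F. (M *\<^sub>v f x) $ i = (\<Sum>j<k. M $$ (i, j) * f x $ j)"
    using vtends_carrier(2)[OF f] by eventually_elim (rule idx[OF i])
  ultimately show "\<exists>g. (g \<longlongrightarrow> (M *\<^sub>v l) $ i) F \<and> (\<forall>\<^sub>F x in F. (M *\<^sub>v f x) $ i = g x)"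
    using idx[OF i vtends_carrier(1)[OF f]] by auto
next
  show "\<forall>\<^sub>F x in F. M *\<^sub>v f x \<in> carrier_vec n"
    using vtends_carrier(2)[OF f] by eventually_elim (rule mult_mat_vec_carrier[OF M])
qed (rule mult_mat_vec_carrier[OF M vtends_carrier(1)[OF f]])

lemma vtends_add:
  assumes f: "vtends n f l F" and g: "vtends n g k F"
  shows "vtends n (\<lambda>x. f x + g x) (l + k) F"
proof (rule vtendsI)
  fix i assume i: "i < n"
  have "((\<lambda>x. f x $ i + g x $ i) \<longlongrightarrow> (l + k) $ i) F"
    using tendsto_add[OF vtends_index[OF f i] vtends_index[OF g i]] vtends_carrier(1)[OF g] i by auto
  moreover have "\<forall>\<^sub>F x in F. (f x + g x) $ i = f x $ i + g x $ i"
    using vtends_carrier(2)[OF g] by eventually_elim (use i in auto)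
  ultimately show "\<exists>h. (h \<longlongrightarrow> (l + k) $ i) F \<and> (\<forall>\<^sub>F x in F. (f x + g x) $ i = h x)" by auto
next
  show "\<forall>\<^sub>F x in F. f x + g x \<in> carrier_vec n"
    using vtends_carrier(2)[OF f] vtends_carrier(2)[OF g] by eventually_elim auto
qed (use vtends_carrier(1)[OF f] vtends_carrier(1)[OF g] in auto)

text \<open>The scalar may vary because the stiff equation is scaled by epsilon/tau, which tends to
  0.\<close>

lemma vtends_smult:
  assumes f: "vtends n f l F" and c: "(c \<longlongrightarrow> c0) F"
  shows "vtends n (\<lambda>x. c x \<cdot>\<^sub>v f x) (c0 \<cdot>\<^sub>v l) F"
proof (rule vtendsI)
  fix i assume i: "i < n"
  have "((\<lambda>x. c x * f x $ i) \<longlongrightarrow> (c0 \<cdot>\<^sub>v l) $ i) F"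
    using tendsto_mult[OF c vtends_index[OF f i]] vtends_carrier(1)[OF f] i by auto
  moreover have "\<forall>\<^sub>F x in F. (c x \<cdot>\<^sub>v f x) $ i = c x * f x $ i"
    using vtends_carrier(2)[OF f] by eventually_elim (use i in auto)
  ultimately show "\<exists>h. (h \<longlongrightarrow> (c0 \<cdot>\<^sub>v l) $ i) F \<and> (\<forall>\<^sub>F x in F. (c x \<cdot>\<^sub>v f x) $ i = h x)" by auto
next
  show "\<forall>\<^sub>F x in F. c x \<cdot>\<^sub>v f x \<in> carrier_vec n"
    using vtends_carrier(2)[OF f] by eventually_elim auto
qed (use vtends_carrier(1)[OF f] in auto)

lemma vtends_minus:
  assumes f: "vtends n f l F" and g: "vtends n g k F"
  shows "vtends n (\<lambda>x. f x - g x) (l - k) F"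
proof (rule vtendsI)
  fix i assume i: "i < n"
  have "((\<lambda>x. f x $ i - g x $ i) \<longlongrightarrow> (l - k) $ i) F"
    using tendsto_diff[OF vtends_index[OF f i] vtends_index[OF g i]] vtends_carrier(1)[OF g] i by auto
  moreover have "\<forall>\<^sub>F x in F. (f x - g x) $ i = f x $ i - g x $ i"
    using vtends_carrier(2)[OF g] by eventually_elim (use i in auto)
  ultimately show "\<exists>h. (h \<longlongrightarrow> (l - k) $ i) F \<and> (\<forall>\<^sub>F x in F. (f x - g x) $ i = h x)" by auto
next
  show "\<forall>\<^sub>F x in F. f x - g x \<in> carrier_vec n"
    using vtends_carrier(2)[OF f] vtends_carrier(2)[OF g] by eventually_elim auto
qed (use vtends_carrier(1)[OF f] vtends_carrier(1)[OF g] in auto)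

lemma vtends_append:
  assumes f: "vtends n f l F" and g: "vtends k g l' F"
  shows "vtends (n + k) (\<lambda>x. f x @\<^sub>v g x) (l @\<^sub>v l') F"
proof (rule vtendsI)
  note c = vtends_carrier(1)[OF f] vtends_carrier(1)[OF g]
  have e: "\<forall>\<^sub>F x in F. f x \<in> carrier_vec n \<and> g x \<in> carrier_vec k"
    using vtends_carrier(2)[OF f] vtends_carrier(2)[OF g] by eventually_elim auto
  fix i assume i: "i < n + k"
  have "((\<lambda>x. if i < n then f x $ i else g x $ (i - n)) \<longlongrightarrow> (l @\<^sub>v l') $ i) F"
    using vtends_index[OF f, of i] vtends_index[OF g, of "i - n"] c i by (cases "i < n") auto
  moreover have "\<forall>\<^sub>F x in F. (f x @\<^sub>v g x) $ i = (if i < n then f x $ i else g x $ (i - n))"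
    using e by eventually_elim (use i in auto)
  ultimately show "\<exists>h. (h \<longlongrightarrow> (l @\<^sub>v l') $ i) F \<and> (\<forall>\<^sub>F x in F. (f x @\<^sub>v g x) $ i = h x)" by blast
next
  show "\<forall>\<^sub>F x in F. f x @\<^sub>v g x \<in> carrier_vec (n + k)"
    using vtends_carrier(2)[OF f] vtends_carrier(2)[OF g] by eventually_elim auto
qed (use vtends_carrier(1)[OF f] vtends_carrier(1)[OF g] in auto)

lemma vtends_unique:
  assumes f: "vtends n f l F" and e: "\<forall>\<^sub>F x in F. f x = k" and k: "k \<in> carrier_vec n" and F: "F \<noteq> bot"
  shows "l = k"
proof (rule eq_vecI)
  fix i assume "i < dim_vec k"
  then have i: "i < n" using k by auto
  have "((\<lambda>x. k $ i) \<longlongrightarrow> l $ i) F"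
    by (rule Lim_transform_eventually[OF vtends_index[OF f i]]) (use e in eventually_elim, auto)
  then show "l $ i = k $ i" using tendsto_unique[OF F _ tendsto_const] by blast
qed (use vtends_carrier(1)[OF f] k in auto)

section \<open>Block calculations for the boundary scheme\<close>

lemma append_vec_minus:
  fixes u :: "real vec"
  assumes "u \<in> carrier_vec n" "u' \<in> carrier_vec n" "v \<in> carrier_vec k" "v' \<in> carrier_vec k"
  shows "(u @\<^sub>v v) - (u' @\<^sub>v v') = (u - u') @\<^sub>v (v - v')"
  using assms by (intro eq_vecI) auto

lemma smult_append_vec: "c \<cdot>\<^sub>v (u @\<^sub>v v) = (c \<cdot>\<^sub>v u) @\<^sub>v (c \<cdot>\<^sub>v v)"
  by (intro eq_vecI) auto

text \<open>The numbers \<open>a\<close>, \<open>b\<close>, \<open>c\<close>, \<open>d\<close> count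
  the columns of \<open>R1p\<close>, \<open>R1m\<close>, \<open>RHp\<close>, \<open>RHm\<close>.
  Spectral assumptions on A_11 and H enter only through the two splittings. The signs are crossed in
  R^infinity, so \<open>Rip\<close> has \<open>a + d\<close> columns and \<open>Rim\<close> has
  \<open>b + c\<close>.\<close>

locale boundary_scheme =
  fixes m r a b c d :: nat
    and A11 A12 A21 A22 S A Q R1p R1m L1p L1m RHp RHm LHp LHm Rip Rim Lip Lim :: "real mat"
  assumes A11: "A11 \<in> carrier_mat m m" and A12: "A12 \<in> carrier_mat m r"
    and A21: "A21 \<in> carrier_mat r m" and A22: "A22 \<in> carrier_mat r r"
    and A_def: "A = four_block_mat A11 A12 A21 A22"
    and S: "negative_definite r S"
    and Q_def: "Q = four_block_mat (0\<^sub>m m m) (0\<^sub>m m r) (0\<^sub>m r m) S"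
    and inv_A: "invertible_mat A" and inv_A11: "invertible_mat A11"
    and splitting_A11: "invariant_splitting m a b A11 R1p R1m L1p L1m"
    and splitting_H: "invariant_splitting r c d (minv (A22 - A21 * minv A11 * A12) * S) RHp RHm LHp LHm"
    and Rip: "Rip = R_infinity A11 A12 R1p RHm" and Rim: "Rim = R_infinity A11 A12 R1m RHp"
    and left_infinity: "left_matrices Rip Rim Lip Lim"
begin

abbreviation "K \<equiv> minv A11 * A12"
abbreviation "X \<equiv> minv (A22 - A21 * minv A11 * A12)"

sublocale s1: invariant_splitting m a b A11 R1p R1m L1p L1m
  by (rule splitting_A11)

sublocale sH: invariant_splitting r c d "X * S" RHp RHm LHp LHm
  by (rule splitting_H)

lemma S_carrier: "S \<in> carrier_mat r r"
  using S unfolding negative_definite_def by blast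

lemmas minv_A11 = minv_invertible[OF A11 inv_A11]

lemma A_carrier: "A \<in> carrier_mat (m + r) (m + r)"
  unfolding A_def by (rule four_block_carrier_mat[OF A11 A22])

lemmas minv_A = minv_invertible[OF A_carrier inv_A]

lemma Q_carrier: "Q \<in> carrier_mat (m + r) (m + r)"
  unfolding Q_def by (rule four_block_carrier_mat[OF zero_carrier_mat S_carrier])

lemma K_carrier: "K \<in> carrier_mat m r"
  by (rule mult_carrier_mat[OF minv_A11(1) A12])

lemma A11_K: "A11 * K = A12"
  unfolding assoc_mult_mat[OF A11 minv_A11(1) A12, symmetric] minv_A11(2)
  by (rule left_mult_one_mat[OF A12])

lemma schur_carrier: "A22 - A21 * minv A11 * A12 \<in> carrier_mat r r"
  by (rule minus_carrier_mat[OF mult_carrier_mat[OF mult_carrier_mat[OF A21 minv_A11(1)] A12]])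

lemma X_inverse: "X \<in> carrier_mat r r" "(A22 - A21 * minv A11 * A12) * X = 1\<^sub>m r"
    "X * (A22 - A21 * minv A11 * A12) = 1\<^sub>m r"
  using minv_injective[OF schur_carrier]
    schur_complement_injective[OF A11 A12 A21 A22 inv_A11 inv_A[unfolded A_def]] by blast+

text \<open>Applying the Schur complement to H v = X S v returns S v, and S is injective. This makes
  the compressed matrix of H injective in \<open>H_kernel_left\<close>.\<close>

lemma H_injective:
  assumes v: "v \<in> carrier_vec r" and z: "(X * S) *\<^sub>v v = 0\<^sub>v r"
  shows "v = 0\<^sub>v r"
proof -
  have Sv: "S *\<^sub>v v \<in> carrier_vec r" by (rule mult_mat_vec_carrier[OF S_carrier v])
  have "S *\<^sub>v v = ((A22 - A21 * minv A11 * A12) * X) *\<^sub>v (S *\<^sub>v v)"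
    unfolding X_inverse(2) by (rule one_mult_mat_vec[OF Sv, symmetric])
  also have "\<dots> = (A22 - A21 * minv A11 * A12) *\<^sub>v ((X * S) *\<^sub>v v)"
    unfolding assoc_mult_mat_vec[OF schur_carrier X_inverse(1) Sv]
      assoc_mult_mat_vec[OF X_inverse(1) S_carrier v] ..
  also have "\<dots> = 0\<^sub>v r" unfolding z by (rule mult_zero_vec[OF schur_carrier])
  finally show ?thesis by (rule negative_definite_injective[OF S v])
qed

lemma Rip_eq: "Rip = four_block_mat R1p (- (K * RHm)) (0\<^sub>m r a) RHm"
  unfolding Rip by (rule R_infinity_eq[OF K_carrier s1.Rp sH.Rm])

lemma Rim_eq: "Rim = four_block_mat R1m (- (K * RHp)) (0\<^sub>m r b) RHp"
  unfolding Rim by (rule R_infinity_eq[OF K_carrier s1.Rm sH.Rp])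

lemma Rip_carrier: "Rip \<in> carrier_mat (m + r) (a + d)"
  unfolding Rip_eq by (rule four_block_carrier_mat[OF s1.Rp sH.Rm])

lemma Rim_carrier: "Rim \<in> carrier_mat (m + r) (b + c)"
  unfolding Rim_eq by (rule four_block_carrier_mat[OF s1.Rm sH.Rp])

lemmas L_blocks = left_matrices_blocks[OF left_infinity Rip_carrier Rim_carrier]

text \<open>Because \<open>Rip\<close> pairs \<open>R1p\<close> with \<open>RHm\<close>, the
  splitting of H is used with its two sides exchanged.\<close>

lemma Lip_eq: "Lip = four_block_mat L1p (L1p * K) (0\<^sub>m d m) LHm"
  using L_infinity_eq[OF splitting_A11 sH.swap K_carrier L_blocks(1)] L_blocks(3,4)
  unfolding Rip_eq Rim_eq by blast

lemma Lim_eq: "Lim = four_block_mat L1m (L1m * K) (0\<^sub>m c m) LHp"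
  using L_infinity_eq[OF s1.swap splitting_H K_carrier L_blocks(2)] L_blocks(5,6)
  unfolding Rip_eq Rim_eq by blast

lemma Q_append:
  assumes "u \<in> carrier_vec m" "v \<in> carrier_vec r"
  shows "Q *\<^sub>v (u @\<^sub>v v) = 0\<^sub>v m @\<^sub>v (S *\<^sub>v v)"
  unfolding Q_def four_block_mat_mult_vec[OF zero_carrier_mat zero_carrier_mat zero_carrier_mat S_carrier assms]
    zero_mult_mat_vec[OF assms(1)] zero_mult_mat_vec[OF assms(2)]
    left_zero_vec[OF zero_carrier_vec] left_zero_vec[OF mult_mat_vec_carrier[OF S_carrier assms(2)]] ..

lemma Lim_append:
  assumes u: "u \<in> carrier_vec m" and v: "v \<in> carrier_vec r"
  shows "Lim *\<^sub>v (u @\<^sub>v v) = L1m *\<^sub>v (u + K *\<^sub>v v) @\<^sub>v LHp *\<^sub>v v"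
  unfolding Lim_eq
    four_block_mat_mult_vec[OF s1.Lm mult_carrier_mat[OF s1.Lm K_carrier] zero_carrier_mat sH.Lp u v]
    zero_mult_mat_vec[OF u] left_zero_vec[OF mult_mat_vec_carrier[OF sH.Lp v]]
    assoc_mult_mat_vec[OF s1.Lm K_carrier v]
    mult_add_distrib_mat_vec[OF s1.Lm u mult_mat_vec_carrier[OF K_carrier v]] ..

text \<open>Elimination in A (p, q) = (u, v). The upper row, multiplied by A_11^{-1}, gives p + K q,
  the only combination seen by the L^1 rows of \<open>Lim\<close>. The lower part is identified only
  for u = 0, the case of vectors in the range of \<open>Q\<close>: then p = - K q, and the Schur
  complement maps q to v.\<close>

lemma minv_A_append:
  assumes u: "u \<in> carrier_vec m" and v: "v \<in> carrier_vec r"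
  obtains p q where "p \<in> carrier_vec m" "q \<in> carrier_vec r" "minv A *\<^sub>v (u @\<^sub>v v) = p @\<^sub>v q"
    "p + K *\<^sub>v q = minv A11 *\<^sub>v u" "u = 0\<^sub>v m \<Longrightarrow> q = X *\<^sub>v v"
proof -
  have uv: "u @\<^sub>v v \<in> carrier_vec (m + r)" using u v by simp
  let ?w = "minv A *\<^sub>v (u @\<^sub>v v)"
  have w: "?w \<in> carrier_vec (m + r)" by (rule mult_mat_vec_carrier[OF minv_A(1) uv])
  define p q where "p = vec_first ?w m" and "q = vec_last ?w r"
  have p: "p \<in> carrier_vec m" and q: "q \<in> carrier_vec r" unfolding p_def q_def by auto
  have pq: "?w = p @\<^sub>v q" unfolding p_def q_def using vec_first_last_append[OF w] by simp
  have Kq: "K *\<^sub>v q \<in> carrier_vec m" by (rule mult_mat_vec_carrier[OF K_carrier q])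
  have "A *\<^sub>v (p @\<^sub>v q) = u @\<^sub>v v"
    unfolding pq[symmetric] assoc_mult_mat_vec[OF A_carrier minv_A(1) uv, symmetric] minv_A(2)
    by (rule one_mult_mat_vec[OF uv])
  then have "(A11 *\<^sub>v p + A12 *\<^sub>v q) @\<^sub>v (A21 *\<^sub>v p + A22 *\<^sub>v q) = u @\<^sub>v v"
    unfolding A_def four_block_mat_mult_vec[OF A11 A12 A21 A22 p q] .
  moreover have "A11 *\<^sub>v p + A12 *\<^sub>v q \<in> carrier_vec m" using A11 A12 p q by simp
  ultimately have up: "A11 *\<^sub>v p + A12 *\<^sub>v q = u" and lo: "A21 *\<^sub>v p + A22 *\<^sub>v q = v"
    using append_vec_eq[OF _ u] by blast+
  have pKq: "p + K *\<^sub>v q \<in> carrier_vec m" using p Kq by simp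
  have "A11 *\<^sub>v (p + K *\<^sub>v q) = u"
    unfolding mult_add_distrib_mat_vec[OF A11 p Kq] assoc_mult_mat_vec[OF A11 K_carrier q, symmetric]
      A11_K up ..
  then have "minv A11 *\<^sub>v u = (minv A11 * A11) *\<^sub>v (p + K *\<^sub>v q)"
    using assoc_mult_mat_vec[OF minv_A11(1) A11 pKq] by argo
  then have 1: "p + K *\<^sub>v q = minv A11 *\<^sub>v u"
    unfolding minv_A11(3) one_mult_mat_vec[OF pKq] by (rule sym)
  have 2: "q = X *\<^sub>v v" if "u = 0\<^sub>v m"
  proof -
    have "p + K *\<^sub>v q = 0\<^sub>v m" unfolding 1 that by (rule mult_zero_vec[OF minv_A11(1)])
    then have "A21 *\<^sub>v (p + K *\<^sub>v q) = 0\<^sub>v r" using mult_zero_vec[OF A21] by argo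
    then have z: "A21 *\<^sub>v p + (A21 * K) *\<^sub>v q = 0\<^sub>v r"
      unfolding mult_add_distrib_mat_vec[OF A21 p Kq] assoc_mult_mat_vec[OF A21 K_carrier q] .
    have A21K: "A21 * K \<in> carrier_mat r r" by (rule mult_carrier_mat[OF A21 K_carrier])
    have "(A22 - A21 * minv A11 * A12) *\<^sub>v q = A22 *\<^sub>v q - (A21 * K) *\<^sub>v q"
      unfolding assoc_mult_mat[OF A21 minv_A11(1) A12] by (rule minus_mult_distrib_mat_vec[OF A22 A21K q])
    also have "\<dots> = v"
    proof (rule eq_vecI)
      fix i assume "i < dim_vec v"
      then have i: "i < r" using v by simp
      define x y z where "x = A21 *\<^sub>v p" and "y = A22 *\<^sub>v q" and "z = (A21 * K) *\<^sub>v q"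
      have c: "x \<in> carrier_vec r" "y \<in> carrier_vec r" "z \<in> carrier_vec r"
        unfolding x_def y_def z_def using A21 A22 A21K p q by auto
      show "(A22 *\<^sub>v q - (A21 * K) *\<^sub>v q) $ i = v $ i"
        using arg_cong[OF z, of "\<lambda>v. v $ i"] arg_cong[OF lo, of "\<lambda>v. v $ i"] i c
        unfolding x_def[symmetric] y_def[symmetric] z_def[symmetric] by auto
    qed (use A21K v q in auto)
    finally have "X *\<^sub>v v = (X * (A22 - A21 * minv A11 * A12)) *\<^sub>v q"
      using assoc_mult_mat_vec[OF X_inverse(1) schur_carrier q] by argo
    then show ?thesis unfolding X_inverse(3) one_mult_mat_vec[OF q] by (rule sym)
  qed
  show ?thesis by (rule that[OF p q pq 1 2])
qed

text \<open>The piece \<open>w\<close> belongs to the \<open>LHp\<close> rows. Its value matters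
  only for u = 0, where it becomes the stiff part of the boundary equation.\<close>

lemma Lim_minv_A_append:
  assumes u: "u \<in> carrier_vec m" and v: "v \<in> carrier_vec r"
  obtains w where "w \<in> carrier_vec c"
    "(Lim * minv A) *\<^sub>v (u @\<^sub>v v) = L1m *\<^sub>v (minv A11 *\<^sub>v u) @\<^sub>v w"
    "u = 0\<^sub>v m \<Longrightarrow> w = LHp *\<^sub>v (X *\<^sub>v v)"
proof -
  obtain p q where p: "p \<in> carrier_vec m" and q: "q \<in> carrier_vec r" and pq: "minv A *\<^sub>v (u @\<^sub>v v) = p @\<^sub>v q"
    and 1: "p + K *\<^sub>v q = minv A11 *\<^sub>v u" and 2: "u = 0\<^sub>v m \<Longrightarrow> q = X *\<^sub>v v"
    by (rule minv_A_append[OF u v]) blast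
  have uv: "u @\<^sub>v v \<in> carrier_vec (m + r)" using u v by simp
  have "(Lim * minv A) *\<^sub>v (u @\<^sub>v v) = L1m *\<^sub>v (minv A11 *\<^sub>v u) @\<^sub>v LHp *\<^sub>v q"
    unfolding assoc_mult_mat_vec[OF L_blocks(2) minv_A(1) uv] pq Lim_append[OF p q] 1 ..
  then show ?thesis using that[OF mult_mat_vec_carrier[OF sH.Lp q]] 2 by blast
qed

text \<open>\<open>Q\<close> produces (0, S v), so the preceding lemma applies with u = 0 and X S =
  H appears.\<close>

lemma Lim_minv_A_Q_append:
  assumes u: "u \<in> carrier_vec m" and v: "v \<in> carrier_vec r"
  shows "(Lim * minv A * Q) *\<^sub>v (u @\<^sub>v v) = 0\<^sub>v b @\<^sub>v (LHp * (X * S)) *\<^sub>v v"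
proof -
  have uv: "u @\<^sub>v v \<in> carrier_vec (m + r)" using u v by simp
  have Sv: "S *\<^sub>v v \<in> carrier_vec r" by (rule mult_mat_vec_carrier[OF S_carrier v])
  obtain w where w: "(Lim * minv A) *\<^sub>v (0\<^sub>v m @\<^sub>v S *\<^sub>v v) = L1m *\<^sub>v (minv A11 *\<^sub>v 0\<^sub>v m) @\<^sub>v w"
    "w = LHp *\<^sub>v (X *\<^sub>v (S *\<^sub>v v))"
    by (rule Lim_minv_A_append[OF zero_carrier_vec Sv]) blast
  show ?thesis
    unfolding assoc_mult_mat_vec[OF mult_carrier_mat[OF L_blocks(2) minv_A(1)] Q_carrier uv]
      Q_append[OF u v] w mult_zero_vec[OF minv_A11(1)] mult_zero_vec[OF s1.Lm]
      assoc_mult_mat_vec[OF sH.Lp sH.N v] assoc_mult_mat_vec[OF X_inverse(1) S_carrier v] ..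
qed

end

lemma append_cols_mult_vec:
  assumes Bu: "Bu \<in> carrier_mat p m" and Bv: "Bv \<in> carrier_mat p r"
    and u: "u \<in> carrier_vec m" and v: "v \<in> carrier_vec r"
  shows "append_cols Bu Bv *\<^sub>v (u @\<^sub>v v) = Bu *\<^sub>v u + Bv *\<^sub>v v"
proof -
  have "append_cols Bu Bv *\<^sub>v (u @\<^sub>v v) =
      (Bu *\<^sub>v u + Bv *\<^sub>v v) @\<^sub>v (0\<^sub>m 0 m *\<^sub>v u + 0\<^sub>m 0 r *\<^sub>v v)"
    using four_block_mat_mult_vec[OF Bu Bv zero_carrier_mat zero_carrier_mat u v]
      carrier_matD[OF Bu] carrier_matD[OF Bv] unfolding append_cols_def by metis
  \<comment> \<open>The lower blocks of \<open>append_cols\<close> have no rows, so the appended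
    vector is empty.\<close>
  also have "\<dots> = Bu *\<^sub>v u + Bv *\<^sub>v v" by (intro eq_vecI) auto
  finally show ?thesis .
qed

lemma zero_append_vec: "0\<^sub>v n @\<^sub>v 0\<^sub>v k = (0\<^sub>v (n + k) :: 'a :: zero vec)"
  by (intro eq_vecI) auto

section \<open>Equations free of the stiff term, and kernels of the stiff terms\<close>

context boundary_scheme
begin

abbreviation "A11p \<equiv> A11 * R1p * L1p"
abbreviation "A11m \<equiv> A11 * R1m * L1m"

lemma A11p_carrier: "A11p \<in> carrier_mat m m"
  by (rule mult_carrier_mat[OF mult_carrier_mat[OF A11 s1.Rp] s1.Lp])

lemma A11m_carrier: "A11m \<in> carrier_mat m m"
  by (rule mult_carrier_mat[OF mult_carrier_mat[OF A11 s1.Rm] s1.Lm])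

text \<open>The upper block of the right-hand side is zero for every factor \<open>s\<close>. The
  equation therefore holds at each fixed epsilon, before any limit, with the differences of v still
  present.\<close>

lemma cell_equation:
  assumes carr: "u' \<in> carrier_vec m" "u \<in> carrier_vec m" "ul \<in> carrier_vec m" "ur \<in> carrier_vec m"
    "v' \<in> carrier_vec r" "v \<in> carrier_vec r" "vl \<in> carrier_vec r" "vr \<in> carrier_vec r"
    and eq: "(u' @\<^sub>v v') - (u @\<^sub>v v) + lam \<cdot>\<^sub>v ((A * Rip * Lip) *\<^sub>v ((u @\<^sub>v v) - (ul @\<^sub>v vl)))
      + lam \<cdot>\<^sub>v ((A * Rim * Lim) *\<^sub>v ((ur @\<^sub>v vr) - (u @\<^sub>v v))) = s \<cdot>\<^sub>v (Q *\<^sub>v (u' @\<^sub>v v'))"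
  shows "u' - u + lam \<cdot>\<^sub>v (A11p *\<^sub>v (u - ul + K *\<^sub>v (v - vl)))
      + lam \<cdot>\<^sub>v (A11m *\<^sub>v (ur - u + K *\<^sub>v (vr - v))) = 0\<^sub>v m"
proof -
  have d: "u - ul \<in> carrier_vec m" "v - vl \<in> carrier_vec r" "ur - u \<in> carrier_vec m" "vr - v \<in> carrier_vec r"
    "u' - u \<in> carrier_vec m" "v' - v \<in> carrier_vec r" using carr by auto
  obtain w1 where w1: "w1 \<in> carrier_vec r" and
    e1: "(A * Rip * Lip) *\<^sub>v ((u - ul) @\<^sub>v (v - vl)) = A11p *\<^sub>v (u - ul + K *\<^sub>v (v - vl)) @\<^sub>v w1"
    using upwind_flux[OF A11 A12 A21 A22 K_carrier A11_K s1.Rp sH.Rm s1.Lp sH.Lm d(1,2)]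
    unfolding A_def[symmetric] Rip_eq[symmetric] Lip_eq[symmetric] by blast
  obtain w2 where w2: "w2 \<in> carrier_vec r" and
    e2: "(A * Rim * Lim) *\<^sub>v ((ur - u) @\<^sub>v (vr - v)) = A11m *\<^sub>v (ur - u + K *\<^sub>v (vr - v)) @\<^sub>v w2"
    using upwind_flux[OF A11 A12 A21 A22 K_carrier A11_K s1.Rm sH.Rp s1.Lm sH.Lp d(3,4)]
    unfolding A_def[symmetric] Rim_eq[symmetric] Lim_eq[symmetric] by blast
  define x1 x2 where "x1 = A11p *\<^sub>v (u - ul + K *\<^sub>v (v - vl))" and "x2 = A11m *\<^sub>v (ur - u + K *\<^sub>v (vr - v))"
  have x: "x1 \<in> carrier_vec m" "x2 \<in> carrier_vec m"
    unfolding x1_def x2_def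
    by (intro mult_mat_vec_carrier[OF A11p_carrier] mult_mat_vec_carrier[OF A11m_carrier] add_carrier_vec
        mult_mat_vec_carrier[OF K_carrier] d)+
  have l: "lam \<cdot>\<^sub>v x1 \<in> carrier_vec m" "lam \<cdot>\<^sub>v w1 \<in> carrier_vec r" "lam \<cdot>\<^sub>v x2 \<in> carrier_vec m" "lam \<cdot>\<^sub>v w2 \<in> carrier_vec r"
    using x w1 w2 by auto
  have 1: "u' - u + lam \<cdot>\<^sub>v x1 \<in> carrier_vec m" "v' - v + lam \<cdot>\<^sub>v w1 \<in> carrier_vec r" using d l by auto
  have "(u' - u + lam \<cdot>\<^sub>v x1 + lam \<cdot>\<^sub>v x2) @\<^sub>v (v' - v + lam \<cdot>\<^sub>v w1 + lam \<cdot>\<^sub>v w2) =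
      (s \<cdot>\<^sub>v 0\<^sub>v m) @\<^sub>v (s \<cdot>\<^sub>v (S *\<^sub>v v'))"
    using eq unfolding append_vec_minus[OF carr(1,2,5,6)] append_vec_minus[OF carr(2,3,6,7)]
      append_vec_minus[OF carr(4,2,8,6)] e1 e2 Q_append[OF carr(1,5)] smult_append_vec
      x1_def[symmetric] x2_def[symmetric]
      append_vec_add[OF d(5) l(1) d(6) l(2)] append_vec_add[OF 1(1) l(3) 1(2) l(4)] .
  moreover have "u' - u + lam \<cdot>\<^sub>v x1 + lam \<cdot>\<^sub>v x2 \<in> carrier_vec m" using 1 l by auto
  moreover have "s \<cdot>\<^sub>v 0\<^sub>v m = (0\<^sub>v m :: real vec)" by (intro eq_vecI) auto
  ultimately show ?thesis
    using append_vec_eq[of _ m "s \<cdot>\<^sub>v 0\<^sub>v m"] unfolding x1_def x2_def by auto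
qed

text \<open>The L^1 rows give \<open>L1m\<close> applied to A_11^{-1} times the time increment plus
  lam times (u_1 - u_0) + K (v_1 - v_0). Multiplying by M = \<open>L1m * A11 * R1m\<close> moves
  A_11 inside, since M \<open>L1m\<close> = \<open>L1m\<close> A_11; this removes the inverse and
  turns K into A_12.\<close>

lemma boundary_equation:
  assumes carr: "u0' \<in> carrier_vec m" "u0 \<in> carrier_vec m" "u1 \<in> carrier_vec m"
    "v0' \<in> carrier_vec r" "v0 \<in> carrier_vec r" "v1 \<in> carrier_vec r"
    and eq: "(Lim * minv A) *\<^sub>v ((u0' @\<^sub>v v0') - (u0 @\<^sub>v v0)) + lam \<cdot>\<^sub>v (Lim *\<^sub>v ((u1 @\<^sub>v v1) - (u0 @\<^sub>v v0)))
      = s \<cdot>\<^sub>v ((Lim * minv A * Q) *\<^sub>v (u0' @\<^sub>v v0'))"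
  shows "L1m *\<^sub>v (u0' - u0) + lam \<cdot>\<^sub>v (L1m *\<^sub>v (A11 *\<^sub>v (u1 - u0) + A12 *\<^sub>v (v1 - v0))) = 0\<^sub>v b"
proof -
  have d: "u0' - u0 \<in> carrier_vec m" "v0' - v0 \<in> carrier_vec r" "u1 - u0 \<in> carrier_vec m" "v1 - v0 \<in> carrier_vec r"
    using carr by auto
  obtain w where w: "w \<in> carrier_vec c" and
    e: "(Lim * minv A) *\<^sub>v ((u0' - u0) @\<^sub>v (v0' - v0)) = L1m *\<^sub>v (minv A11 *\<^sub>v (u0' - u0)) @\<^sub>v w"
    by (rule Lim_minv_A_append[OF d(1,2)]) blast
  define y z where "y = minv A11 *\<^sub>v (u0' - u0)" and "z = u1 - u0 + K *\<^sub>v (v1 - v0)"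
  have y: "y \<in> carrier_vec m" unfolding y_def by (rule mult_mat_vec_carrier[OF minv_A11(1) d(1)])
  have Kv: "K *\<^sub>v (v1 - v0) \<in> carrier_vec m" by (rule mult_mat_vec_carrier[OF K_carrier d(4)])
  have z: "z \<in> carrier_vec m" unfolding z_def using d Kv by simp
  have Lc: "L1m *\<^sub>v y \<in> carrier_vec b" "lam \<cdot>\<^sub>v (L1m *\<^sub>v z) \<in> carrier_vec b" "lam \<cdot>\<^sub>v (LHp *\<^sub>v (v1 - v0)) \<in> carrier_vec c"
    using s1.Lm sH.Lp y z d by auto
  have "(L1m *\<^sub>v y + lam \<cdot>\<^sub>v (L1m *\<^sub>v z)) @\<^sub>v (w + lam \<cdot>\<^sub>v (LHp *\<^sub>v (v1 - v0))) =
      (s \<cdot>\<^sub>v 0\<^sub>v b) @\<^sub>v (s \<cdot>\<^sub>v ((LHp * (X * S)) *\<^sub>v v0'))"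
    using eq unfolding append_vec_minus[OF carr(1,2,4,5)] append_vec_minus[OF carr(3,2,6,5)]
      e Lim_append[OF d(3,4)] Lim_minv_A_Q_append[OF carr(1,4)] smult_append_vec
      y_def[symmetric] z_def[symmetric] append_vec_add[OF Lc(1,2) w Lc(3)] .
  moreover have "L1m *\<^sub>v y + lam \<cdot>\<^sub>v (L1m *\<^sub>v z) \<in> carrier_vec b" using Lc by simp
  moreover have "s \<cdot>\<^sub>v 0\<^sub>v b = (0\<^sub>v b :: real vec)" by (intro eq_vecI) auto
  ultimately have top: "L1m *\<^sub>v y + lam \<cdot>\<^sub>v (L1m *\<^sub>v z) = 0\<^sub>v b"
    using append_vec_eq[of _ b "s \<cdot>\<^sub>v 0\<^sub>v b"] by auto
  \<comment> \<open>The commutation rule concerns the first side of a splitting, whereas here it is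
    needed for the stable side.\<close>
  interpret s1': invariant_splitting m b a A11 R1m R1p L1m L1p by (rule s1.swap)
  define M where "M = L1m * A11 * R1m"
  have M: "M \<in> carrier_mat b b" unfolding M_def using A11 s1.Lm s1.Rm by auto
  have M_L1m: "M *\<^sub>v (L1m *\<^sub>v x) = L1m *\<^sub>v (A11 *\<^sub>v x)" if x: "x \<in> carrier_vec m" for x
    using assoc_mult_mat_vec[OF M s1.Lm x] assoc_mult_mat_vec[OF s1.Lm A11 x] s1'.Lp_commute
    unfolding M_def by argo
  have "A11 *\<^sub>v y = (A11 * minv A11) *\<^sub>v (u0' - u0)"
    unfolding y_def by (rule assoc_mult_mat_vec[OF A11 minv_A11(1) d(1), symmetric])
  then have A11y: "A11 *\<^sub>v y = u0' - u0" unfolding minv_A11(2) one_mult_mat_vec[OF d(1)] .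
  have A11z: "A11 *\<^sub>v z = A11 *\<^sub>v (u1 - u0) + A12 *\<^sub>v (v1 - v0)"
    unfolding z_def mult_add_distrib_mat_vec[OF A11 d(3) Kv] assoc_mult_mat_vec[OF A11 K_carrier d(4), symmetric] A11_K ..
  have Lz: "L1m *\<^sub>v z \<in> carrier_vec b" by (rule mult_mat_vec_carrier[OF s1.Lm z])
  have "M *\<^sub>v (L1m *\<^sub>v y + lam \<cdot>\<^sub>v (L1m *\<^sub>v z)) = M *\<^sub>v 0\<^sub>v b" unfolding top ..
  then show ?thesis
    unfolding mult_add_distrib_mat_vec[OF M Lc(1,2)] mult_mat_vec[OF M Lz] M_L1m[OF y] M_L1m[OF z] A11y A11z
      mult_zero_vec[OF M] .
qed

lemma H_kernel_left:
  assumes v: "v \<in> carrier_vec r" and z: "(LHp * (X * S)) *\<^sub>v v = 0\<^sub>v c"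
  shows "LHp *\<^sub>v v = 0\<^sub>v c"
proof (rule sH.Lp_N_Rp_injective)
  have M: "LHp * (X * S) * RHp \<in> carrier_mat c c" using sH.Lp sH.N sH.Rp by auto
  show "(LHp * (X * S) * RHp) *\<^sub>v (LHp *\<^sub>v v) = 0\<^sub>v c"
    unfolding assoc_mult_mat_vec[OF M sH.Lp v, symmetric] sH.Lp_commute[symmetric] by (rule z)
qed (use H_injective sH.Lp v in auto)

lemma left_stable_infinity_kernel:
  assumes u: "u \<in> carrier_vec m" and v: "v \<in> carrier_vec r"
    and z: "(Lim * minv A * Q) *\<^sub>v (u @\<^sub>v v) = 0\<^sub>v (b + c)"
  shows "LHp *\<^sub>v v = 0\<^sub>v c"
proof -
  have "0\<^sub>v b @\<^sub>v (LHp * (X * S)) *\<^sub>v v = 0\<^sub>v b @\<^sub>v 0\<^sub>v c"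
    using z unfolding Lim_minv_A_Q_append[OF u v] zero_append_vec .
  then show ?thesis using append_vec_eq[OF zero_carrier_vec zero_carrier_vec] H_kernel_left[OF v] by blast
qed

lemma Q_kernel:
  assumes u: "u \<in> carrier_vec m" and v: "v \<in> carrier_vec r" and z: "Q *\<^sub>v (u @\<^sub>v v) = 0\<^sub>v (m + r)"
  shows "v = 0\<^sub>v r"
proof -
  have "0\<^sub>v m @\<^sub>v (S *\<^sub>v v) = 0\<^sub>v m @\<^sub>v 0\<^sub>v r"
    using z unfolding Q_append[OF u v] zero_append_vec .
  then show ?thesis
    using append_vec_eq[OF zero_carrier_vec zero_carrier_vec] negative_definite_injective[OF S v] by blast
qed

end

text \<open>After multiplication by \<open>\<epsilon>\<close> the stiff equation \<open>f \<epsilon> = (\<tau>/\<epsilon>) g \<epsilon>\<close> leaves only its right-hand side.\<close>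

lemma stiff_limit:
  assumes f: "vtends n f l (at_right 0)" and g: "vtends n g k (at_right 0)" and t: "\<tau> > 0"
    and eq: "\<forall>\<^sub>F \<epsilon> in at_right 0. f \<epsilon> = (\<tau> / \<epsilon>) \<cdot>\<^sub>v g \<epsilon>"
  shows "k = 0\<^sub>v n"
proof -
  have id: "((\<lambda>\<epsilon>. \<epsilon> / \<tau>) \<longlongrightarrow> 0) (at_right (0::real))" using t by (auto intro!: tendsto_eq_intros)
  \<comment> \<open>This combination is zero for small positive epsilon, while its limit is
    \<open>k\<close>.\<close>
  have "vtends n (\<lambda>\<epsilon>. g \<epsilon> - (\<epsilon> / \<tau>) \<cdot>\<^sub>v f \<epsilon>) (k - 0 \<cdot>\<^sub>v l) (at_right 0)"
    by (rule vtends_minus[OF g vtends_smult[OF f id]])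
  moreover have "\<forall>\<^sub>F \<epsilon> in at_right 0. g \<epsilon> - (\<epsilon> / \<tau>) \<cdot>\<^sub>v f \<epsilon> = 0\<^sub>v n"
    using eq vtends_carrier(2)[OF g] eventually_at_right_less[of "0::real"]
  proof eventually_elim
    case (elim \<epsilon>)
    then have "(\<epsilon> / \<tau>) \<cdot>\<^sub>v f \<epsilon> = g \<epsilon>" using t by (simp add: smult_smult_assoc)
    then show ?case using elim by simp
  qed
  ultimately have "k - 0 \<cdot>\<^sub>v l = 0\<^sub>v n" by (rule vtends_unique) (auto simp: trivial_limit_at_right_real)
  moreover have "k - 0 \<cdot>\<^sub>v l = k" using vtends_carrier(1)[OF f] vtends_carrier(1)[OF g] by (intro eq_vecI) auto
  ultimately show ?thesis by simp
qed

section \<open>Passage to the limit in the scheme\<close>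

context boundary_scheme
begin

lemma limiting_scheme:
  fixes u v :: "real \<Rightarrow> nat \<Rightarrow> nat \<Rightarrow> real vec"
  assumes Bu: "Bu \<in> carrier_mat p m" and Bv: "Bv \<in> carrier_mat p r" and B: "B = append_cols Bu Bv"
    and bd: "\<And>n. bd (real (n + 1) * \<tau>) \<in> carrier_vec p"
    and t: "0 < \<tau>" and lam: "\<tau> / h = lam"
    and ev: "\<forall>\<^sub>F \<epsilon> in at_right 0.
        (\<forall>j n. u \<epsilon> j n \<in> carrier_vec m \<and> v \<epsilon> j n \<in> carrier_vec r) \<and>
        ap_scheme A Q B bd WA (Rip, Rim, Lip, Lim) \<tau> h \<epsilon> (\<lambda>j n. u \<epsilon> j n @\<^sub>v v \<epsilon> j n) \<and>
        (\<forall>j\<ge>1. v \<epsilon> j 0 = 0\<^sub>v r)"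
    and lim: "\<forall>j n. u0 j n \<in> carrier_vec m \<and> v0 j n \<in> carrier_vec r \<and>
        vec_tendsto (\<lambda>\<epsilon>. u \<epsilon> j n) (u0 j n) (at_right 0) \<and>
        vec_tendsto (\<lambda>\<epsilon>. v \<epsilon> j n) (v0 j n) (at_right 0)"
  shows "first_cell_residual A11 A12 A11p A11m lam u0 v0 n = 0\<^sub>v m"
    and "j \<ge> 2 \<Longrightarrow> interior_residual A11p A11m lam u0 j n = 0\<^sub>v m"
    and "j \<ge> 1 \<Longrightarrow> v0 j (n + 1) = 0\<^sub>v r"
    and "LHp *\<^sub>v v0 0 (n + 1) = 0\<^sub>v c"
    and "boundary_residual A11 A12 L1m lam u0 v0 n = 0\<^sub>v b"
    and "Bu *\<^sub>v u0 0 (n + 1) + Bv *\<^sub>v v0 0 (n + 1) = bd (real (n + 1) * \<tau>)"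
proof -
  let ?F = "at_right (0 :: real)"
  have F: "?F \<noteq> bot" by (rule trivial_limit_at_right_real)
  let ?U = "\<lambda>\<epsilon> j n. u \<epsilon> j n @\<^sub>v v \<epsilon> j n"
  \<comment> \<open>Once epsilon is below tau, the conditional in \<open>ap_scheme\<close> selects
    the frame R^infinity.\<close>
  have lt: "\<forall>\<^sub>F \<epsilon> in ?F. \<epsilon> < \<tau>" using t by (auto simp: eventually_at_right_field)
  have ev_all: "\<forall>\<^sub>F \<epsilon> in ?F. (\<forall>j n. u \<epsilon> j n \<in> carrier_vec m \<and> v \<epsilon> j n \<in> carrier_vec r) \<and>
      (\<forall>j\<ge>1. v \<epsilon> j 0 = 0\<^sub>v r) \<and>
      (\<forall>n. \<forall>j\<ge>1. ?U \<epsilon> j (n+1) - ?U \<epsilon> j n + lam \<cdot>\<^sub>v ((A * Rip * Lip) *\<^sub>v (?U \<epsilon> j n - ?U \<epsilon> (j-1) n))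
          + lam \<cdot>\<^sub>v ((A * Rim * Lim) *\<^sub>v (?U \<epsilon> (j+1) n - ?U \<epsilon> j n)) = (\<tau> / \<epsilon>) \<cdot>\<^sub>v (Q *\<^sub>v ?U \<epsilon> j (n+1))) \<and>
      (\<forall>n. (Lim * minv A) *\<^sub>v (?U \<epsilon> 0 (n+1) - ?U \<epsilon> 0 n) + lam \<cdot>\<^sub>v (Lim *\<^sub>v (?U \<epsilon> 1 n - ?U \<epsilon> 0 n))
          = (\<tau> / \<epsilon>) \<cdot>\<^sub>v ((Lim * minv A * Q) *\<^sub>v ?U \<epsilon> 0 (n+1))) \<and>
      (\<forall>n. B *\<^sub>v ?U \<epsilon> 0 (n+1) = bd (real (n+1) * \<tau>))"
    using ev lt
  proof eventually_elim
    case (elim \<epsilon>)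
    then have "\<not> \<tau> < \<epsilon>" by simp
    with elim show ?case unfolding ap_scheme_def lam by (simp only: if_False Let_def prod.case) blast
  qed
  have ev_carr: "\<forall>\<^sub>F \<epsilon> in ?F. u \<epsilon> j n \<in> carrier_vec m" "\<forall>\<^sub>F \<epsilon> in ?F. v \<epsilon> j n \<in> carrier_vec r" for j n
    using ev_all by (eventually_elim, blast)+
  have u: "vtends m (\<lambda>\<epsilon>. u \<epsilon> j n) (u0 j n) ?F" and v: "vtends r (\<lambda>\<epsilon>. v \<epsilon> j n) (v0 j n) ?F" for j n
    using lim ev_carr unfolding vtends_def by blast+
  have U: "vtends (m + r) (\<lambda>\<epsilon>. ?U \<epsilon> j n) (u0 j n @\<^sub>v v0 j n) ?F" for j n
    by (rule vtends_append[OF u v])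
  have u0: "u0 j n \<in> carrier_vec m" and v0: "v0 j n \<in> carrier_vec r" for j n using lim by auto
  have const: "((\<lambda>\<epsilon>. x) \<longlongrightarrow> x) ?F" for x :: real by simp
  have ARL: "A * Rip * Lip \<in> carrier_mat (m + r) (m + r)" "A * Rim * Lim \<in> carrier_mat (m + r) (m + r)"
    using mult_carrier_mat[OF mult_carrier_mat[OF A_carrier Rip_carrier] L_blocks(1)]
      mult_carrier_mat[OF mult_carrier_mat[OF A_carrier Rim_carrier] L_blocks(2)] by auto
  have LA: "Lim * minv A \<in> carrier_mat (b + c) (m + r)" by (rule mult_carrier_mat[OF L_blocks(2) minv_A(1)])
  \<comment> \<open>Only convergence of the left-hand side matters here, not its value. Its limit is
    assembled by the rules for \<open>vtends\<close>, and \<open>stiff_limit\<close> then puts the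
    limiting vector in the kernel of \<open>Q\<close>.\<close>
  have v_later: "v0 j (n + 1) = 0\<^sub>v r" if j: "j \<ge> 1" for j n
  proof -
    have "Q *\<^sub>v (u0 j (n+1) @\<^sub>v v0 j (n+1)) = 0\<^sub>v (m + r)"
    proof (rule stiff_limit[OF vtends_add[OF vtends_add[OF vtends_minus[OF U U]
              vtends_smult[OF vtends_mult[OF ARL(1) vtends_minus[OF U U]] const]]
              vtends_smult[OF vtends_mult[OF ARL(2) vtends_minus[OF U U]] const]]
              vtends_mult[OF Q_carrier U] t])
      show "\<forall>\<^sub>F \<epsilon> in ?F. ?U \<epsilon> j (n+1) - ?U \<epsilon> j n + lam \<cdot>\<^sub>v ((A * Rip * Lip) *\<^sub>v (?U \<epsilon> j n - ?U \<epsilon> (j-1) n))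
          + lam \<cdot>\<^sub>v ((A * Rim * Lim) *\<^sub>v (?U \<epsilon> (j+1) n - ?U \<epsilon> j n)) = (\<tau> / \<epsilon>) \<cdot>\<^sub>v (Q *\<^sub>v ?U \<epsilon> j (n+1))"
        using ev_all by eventually_elim (use j in blast)
    qed
    then show ?thesis by (rule Q_kernel[OF u0 v0])
  qed
  then show "j \<ge> 1 \<Longrightarrow> v0 j (n + 1) = 0\<^sub>v r" .
  \<comment> \<open>The cell equations contain v at the old time level, so level 0 is needed as
    well. It comes from the initial data, whereas later levels come from the stiff equation.\<close>
  have v_zero: "v0 j n = 0\<^sub>v r" if j: "j \<ge> 1" for j n
  proof (cases n)
    case 0
    have "\<forall>\<^sub>F \<epsilon> in ?F. v \<epsilon> j 0 = 0\<^sub>v r" using ev_all by eventually_elim (use j in blast)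
    then show ?thesis unfolding 0 by (rule vtends_unique[OF v _ zero_carrier_vec F])
  next
    case (Suc k)
    then show ?thesis using v_later[OF j, of k] by simp
  qed
  have "(Lim * minv A * Q) *\<^sub>v (u0 0 (n+1) @\<^sub>v v0 0 (n+1)) = 0\<^sub>v (b + c)"
  proof (rule stiff_limit[OF vtends_add[OF vtends_mult[OF LA vtends_minus[OF U U]]
            vtends_smult[OF vtends_mult[OF L_blocks(2) vtends_minus[OF U U]] const]]
            vtends_mult[OF mult_carrier_mat[OF LA Q_carrier] U] t])
    show "\<forall>\<^sub>F \<epsilon> in ?F. (Lim * minv A) *\<^sub>v (?U \<epsilon> 0 (n+1) - ?U \<epsilon> 0 n) + lam \<cdot>\<^sub>v (Lim *\<^sub>v (?U \<epsilon> 1 n - ?U \<epsilon> 0 n))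
          = (\<tau> / \<epsilon>) \<cdot>\<^sub>v ((Lim * minv A * Q) *\<^sub>v ?U \<epsilon> 0 (n+1))"
      using ev_all by eventually_elim blast
  qed
  then show "LHp *\<^sub>v v0 0 (n + 1) = 0\<^sub>v c" by (rule left_stable_infinity_kernel[OF u0 v0])
  have "L1m *\<^sub>v (u0 0 (n+1) - u0 0 n) + lam \<cdot>\<^sub>v (L1m *\<^sub>v (A11 *\<^sub>v (u0 1 n - u0 0 n) + A12 *\<^sub>v (v0 1 n - v0 0 n))) = 0\<^sub>v b"
  proof (rule vtends_unique[OF _ _ zero_carrier_vec F])
    show "vtends b (\<lambda>\<epsilon>. L1m *\<^sub>v (u \<epsilon> 0 (n+1) - u \<epsilon> 0 n) + lam \<cdot>\<^sub>v (L1m *\<^sub>v (A11 *\<^sub>v (u \<epsilon> 1 n - u \<epsilon> 0 n) + A12 *\<^sub>v (v \<epsilon> 1 n - v \<epsilon> 0 n))))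
        (L1m *\<^sub>v (u0 0 (n+1) - u0 0 n) + lam \<cdot>\<^sub>v (L1m *\<^sub>v (A11 *\<^sub>v (u0 1 n - u0 0 n) + A12 *\<^sub>v (v0 1 n - v0 0 n)))) ?F"
      by (intro vtends_add vtends_smult[OF _ const] vtends_mult[OF s1.Lm] vtends_mult[OF A11] vtends_mult[OF A12]
          vtends_minus u v)
    show "\<forall>\<^sub>F \<epsilon> in ?F. L1m *\<^sub>v (u \<epsilon> 0 (n+1) - u \<epsilon> 0 n) + lam \<cdot>\<^sub>v (L1m *\<^sub>v (A11 *\<^sub>v (u \<epsilon> 1 n - u \<epsilon> 0 n) + A12 *\<^sub>v (v \<epsilon> 1 n - v \<epsilon> 0 n))) = 0\<^sub>v b"
      using ev_all by eventually_elim (rule boundary_equation, blast+)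
  qed
  then show "boundary_residual A11 A12 L1m lam u0 v0 n = 0\<^sub>v b" unfolding boundary_residual_def .
  \<comment> \<open>A single limit covers all cells j >= 1. With \<open>v_zero\<close> the terms in
    K vanish for j >= 2; for j = 1 the neighbor at the boundary leaves - K v_0.\<close>
  have cell: "u0 j (n+1) - u0 j n + lam \<cdot>\<^sub>v (A11p *\<^sub>v (u0 j n - u0 (j-1) n + K *\<^sub>v (v0 j n - v0 (j-1) n)))
      + lam \<cdot>\<^sub>v (A11m *\<^sub>v (u0 (j+1) n - u0 j n + K *\<^sub>v (v0 (j+1) n - v0 j n))) = 0\<^sub>v m" if j: "j \<ge> 1" for j
  proof (rule vtends_unique[OF _ _ zero_carrier_vec F])
    show "vtends m (\<lambda>\<epsilon>. u \<epsilon> j (n+1) - u \<epsilon> j n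
        + lam \<cdot>\<^sub>v (A11p *\<^sub>v (u \<epsilon> j n - u \<epsilon> (j-1) n + K *\<^sub>v (v \<epsilon> j n - v \<epsilon> (j-1) n)))
        + lam \<cdot>\<^sub>v (A11m *\<^sub>v (u \<epsilon> (j+1) n - u \<epsilon> j n + K *\<^sub>v (v \<epsilon> (j+1) n - v \<epsilon> j n))))
        (u0 j (n+1) - u0 j n + lam \<cdot>\<^sub>v (A11p *\<^sub>v (u0 j n - u0 (j-1) n + K *\<^sub>v (v0 j n - v0 (j-1) n)))
      + lam \<cdot>\<^sub>v (A11m *\<^sub>v (u0 (j+1) n - u0 j n + K *\<^sub>v (v0 (j+1) n - v0 j n)))) ?F"
      by (intro vtends_add vtends_smult[OF _ const] vtends_mult[OF A11p_carrier] vtends_mult[OF A11m_carrier]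
          vtends_mult[OF K_carrier] vtends_minus u v)
    show "\<forall>\<^sub>F \<epsilon> in ?F. u \<epsilon> j (n+1) - u \<epsilon> j n
        + lam \<cdot>\<^sub>v (A11p *\<^sub>v (u \<epsilon> j n - u \<epsilon> (j-1) n + K *\<^sub>v (v \<epsilon> j n - v \<epsilon> (j-1) n)))
        + lam \<cdot>\<^sub>v (A11m *\<^sub>v (u \<epsilon> (j+1) n - u \<epsilon> j n + K *\<^sub>v (v \<epsilon> (j+1) n - v \<epsilon> j n))) = 0\<^sub>v m"
      using ev_all
    proof eventually_elim
      case (elim \<epsilon>)
      show ?case
        by (rule cell_equation[where v' = "v \<epsilon> j (n+1)" and s = "\<tau> / \<epsilon>"]) (use elim j in blast)+
    qed
  qed
  have Kz: "K *\<^sub>v (0\<^sub>v r - 0\<^sub>v r) = 0\<^sub>v m" using mult_zero_vec[OF K_carrier] by simp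
  have K0: "K *\<^sub>v (0\<^sub>v r - v0 0 n) = - (K *\<^sub>v v0 0 n)"
    using mult_mat_vec_uminus[OF K_carrier v0] by (simp add: zero_minus_vec[OF v0])
  have diff: "u0 i n - u0 j n \<in> carrier_vec m" for i j using u0 by simp
  have "u0 1 n - u0 0 n + - (K *\<^sub>v v0 0 n) = u0 1 n - u0 0 n - K *\<^sub>v v0 0 n"
    by (rule minus_add_uminus_vec[OF diff mult_mat_vec_carrier[OF K_carrier v0], symmetric])
  then show "first_cell_residual A11 A12 A11p A11m lam u0 v0 n = 0\<^sub>v m"
    using cell[of 1] K0 Kz right_zero_vec[OF diff[of 2 1]]
    unfolding first_cell_residual_def by (simp add: v_zero numeral_2_eq_2)
  show "interior_residual A11p A11m lam u0 j n = 0\<^sub>v m" if "j \<ge> 2"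
    using that cell[of j] Kz right_zero_vec[OF diff]
    unfolding interior_residual_def by (simp add: v_zero)
  have "Bu *\<^sub>v u0 0 (n+1) + Bv *\<^sub>v v0 0 (n+1) = bd (real (n+1) * \<tau>)"
  proof (rule vtends_unique[OF _ _ bd F])
    show "vtends p (\<lambda>\<epsilon>. Bu *\<^sub>v u \<epsilon> 0 (n+1) + Bv *\<^sub>v v \<epsilon> 0 (n+1)) (Bu *\<^sub>v u0 0 (n+1) + Bv *\<^sub>v v0 0 (n+1)) ?F"
      by (intro vtends_add vtends_mult[OF Bu] vtends_mult[OF Bv] u v)
    show "\<forall>\<^sub>F \<epsilon> in ?F. Bu *\<^sub>v u \<epsilon> 0 (n+1) + Bv *\<^sub>v v \<epsilon> 0 (n+1) = bd (real (n+1) * \<tau>)"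
      using ev_all by eventually_elim (use append_cols_mult_vec[OF Bu Bv] B in metis)
  qed
  then show "Bu *\<^sub>v u0 0 (n + 1) + Bv *\<^sub>v v0 0 (n + 1) = bd (real (n + 1) * \<tau>)" .
qed

end

section \<open>Consistency\<close>

lemma Ck_on_imp_continuous_on: "Ck_on k S f \<Longrightarrow> continuous_on S f"
proof (cases k)
  case (Suc n)
  assume "Ck_on k S f"
  then obtain f' where "\<forall>x\<in>S. (f has_derivative f' x) (at x within S)" unfolding Suc by auto
  then show ?thesis by (auto simp: continuous_on_eq_continuous_within intro: has_derivative_continuous)
qed simp

text \<open>Restriction to a line parallel to the axis is the chain rule within the quadrant, so at
  x = 0 the derivative is one-sided. The partial derivative is the value of the total derivative at
  a basis vector and thus inherits \<open>Ck_on\<close>.\<close>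

lemma Ck_on_partial_fst:
  assumes "Ck_on (Suc k) quadrant f"
  obtains g where "Ck_on k quadrant g"
    "\<And>x t. x \<ge> 0 \<Longrightarrow> t \<ge> 0 \<Longrightarrow> ((\<lambda>y. f (y, t)) has_real_derivative g (x, t)) (at x within {0..})"
proof -
  obtain f' where f': "\<And>p. p \<in> quadrant \<Longrightarrow> (f has_derivative f' p) (at p within quadrant)"
    and Ck: "\<forall>e\<in>Basis. Ck_on k quadrant (\<lambda>p. f' p e)" using assms by auto
  have "((\<lambda>y. f (y, t)) has_real_derivative f' (x, t) (1, 0)) (at x within {0..})"
    if x: "x \<ge> 0" and t: "t \<ge> 0" for x t
  proof -
    have d: "(f has_derivative f' (x, t)) (at (x, t) within quadrant)" using f' x t by auto
    have "((\<lambda>y. f (y, t)) has_derivative (\<lambda>h. f' (x, t) (h, 0))) (at x within {0..})"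
      by (rule has_derivative_in_compose[where f = "\<lambda>y. (y, t)"])
        (auto intro!: derivative_eq_intros has_derivative_subset[OF d] simp: t)
    moreover have "(\<lambda>h. f' (x, t) (h, 0)) = (*) (f' (x, t) (1, 0))"
    proof
      fix h :: real
      have "f' (x, t) (h *\<^sub>R (1, 0)) = h *\<^sub>R f' (x, t) (1, 0)"
        by (rule linear_cmul[OF has_derivative_linear[OF d]])
      then show "f' (x, t) (h, 0) = f' (x, t) (1, 0) * h" by simp
    qed
    ultimately show ?thesis unfolding has_field_derivative_def by simp
  qed
  moreover have "Ck_on k quadrant (\<lambda>p. f' p (1, 0))" using Ck by (auto simp: Basis_prod_def)
  ultimately show ?thesis using that by blast
qed

lemma Ck_on_partial_snd:
  assumes "Ck_on (Suc k) quadrant f"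
  obtains g where "Ck_on k quadrant g"
    "\<And>x t. x \<ge> 0 \<Longrightarrow> t \<ge> 0 \<Longrightarrow> ((\<lambda>s. f (x, s)) has_real_derivative g (x, t)) (at t within {0..})"
proof -
  obtain f' where f': "\<And>p. p \<in> quadrant \<Longrightarrow> (f has_derivative f' p) (at p within quadrant)"
    and Ck: "\<forall>e\<in>Basis. Ck_on k quadrant (\<lambda>p. f' p e)" using assms by auto
  have "((\<lambda>s. f (x, s)) has_real_derivative f' (x, t) (0, 1)) (at t within {0..})"
    if x: "x \<ge> 0" and t: "t \<ge> 0" for x t
  proof -
    have d: "(f has_derivative f' (x, t)) (at (x, t) within quadrant)" using f' x t by auto
    have "((\<lambda>s. f (x, s)) has_derivative (\<lambda>h. f' (x, t) (0, h))) (at t within {0..})"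
      by (rule has_derivative_in_compose[where f = "\<lambda>s. (x, s)"])
        (auto intro!: derivative_eq_intros has_derivative_subset[OF d] simp: x)
    moreover have "(\<lambda>h. f' (x, t) (0, h)) = (*) (f' (x, t) (0, 1))"
    proof
      fix h :: real
      have "f' (x, t) (h *\<^sub>R (0, 1)) = h *\<^sub>R f' (x, t) (0, 1)"
        by (rule linear_cmul[OF has_derivative_linear[OF d]])
      then show "f' (x, t) (0, h) = f' (x, t) (0, 1) * h" by simp
    qed
    ultimately show ?thesis unfolding has_field_derivative_def by simp
  qed
  moreover have "Ck_on k quadrant (\<lambda>p. f' p (0, 1))" using Ck by (auto simp: Basis_prod_def)
  ultimately show ?thesis using that by blast
qed

lemma Ck_on_real_derivative:
  fixes f :: "real \<Rightarrow> real"
  assumes "Ck_on (Suc k) S f"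
  obtains g where "Ck_on k S g" "\<And>x. x \<in> S \<Longrightarrow> (f has_real_derivative g x) (at x within S)"
proof -
  obtain f' where f': "\<And>p. p \<in> S \<Longrightarrow> (f has_derivative f' p) (at p within S)"
    and Ck: "\<forall>e\<in>Basis. Ck_on k S (\<lambda>p. f' p e)" using assms by auto
  have "(f has_real_derivative f' x 1) (at x within S)" if x: "x \<in> S" for x
  proof -
    have "f' x = (*) (f' x 1)"
    proof
      fix h :: real
      have "f' x (h *\<^sub>R 1) = h *\<^sub>R f' x 1" by (rule linear_cmul[OF has_derivative_linear[OF f'[OF x]]])
      then show "f' x h = f' x 1 * h" by simp
    qed
    then show ?thesis using f'[OF x] unfolding has_field_derivative_def by metis
  qed
  then show ?thesis using that[of "\<lambda>x. f' x 1"] Ck by auto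
qed

text \<open>Every point of the half-line, its endpoint included, is a limit from the right. This
  identifies the derivatives supplied by the differential equation with those supplied by
  smoothness, for which bounds are available.\<close>

lemma real_derivative_unique_within_Ici:
  assumes "(f has_real_derivative D) (at x within {a..})" "(f has_real_derivative E) (at x within {a..})" "x \<ge> a"
  shows "D = E"
proof (rule tendsto_unique)
  show "at x within {a..} \<noteq> bot"
    using at_le[of "{x<..}" "{a..}" x] assms(3) trivial_limit_at_right_real[of x]
    by (auto simp: subset_iff bot.extremum_unique)
qed (use assms in \<open>simp_all add: has_field_derivative_iff\<close>)

lemma increment_bound:
  fixes f :: "real \<Rightarrow> real"
  assumes f: "\<And>z. z \<in> {l..u} \<Longrightarrow> (f has_real_derivative f' z) (at z within {l..u})"
    and M: "\<And>z. z \<in> {l..u} \<Longrightarrow> \<bar>f' z\<bar> \<le> M" and x: "x \<in> {l..u}" and y: "y \<in> {l..u}"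
  shows "\<bar>f y - f x\<bar> \<le> M * \<bar>y - x\<bar>"
proof -
  have less: "\<bar>f b - f a\<bar> \<le> M * \<bar>b - a\<bar>" if ab: "a \<in> {l..u}" "b \<in> {l..u}" "a < b" for a b
  proof (rule mvt[OF ab(3)])
    show "continuous_on {a..b} f"
      by (rule continuous_on_subset[OF DERIV_continuous_on[OF f]]) (use ab in auto)
    fix z assume z: "a < z" "z < b"
    then have "at z within {l..u} = at z" using ab by (intro at_within_Icc_at) auto
    then show "(f has_derivative (*) (f' z)) (at z)"
      using f[of z] ab z unfolding has_field_derivative_def by auto
  next
    fix z assume z: "a < z" "z < b" and e: "f b - f a = f' z * (b - a)"
    show ?thesis unfolding e abs_mult by (rule mult_right_mono[OF M]) (use z ab in auto)
  qed
  show ?thesis using less[of x y] less[of y x] x y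
    by (cases x y rule: linorder_cases) (auto simp: abs_minus_commute)
qed

text \<open>\<open>increment_bound\<close> is used twice: for f', and then for z -> f z - z f' x,
  whose derivative is at most M |y - x| between the points. This costs the factor 1/2 of the sharp
  remainder, but two first-order estimates suffice.\<close>

lemma taylor_remainder_bound:
  fixes f :: "real \<Rightarrow> real"
  assumes f: "\<And>z. z \<in> {l..u} \<Longrightarrow> (f has_real_derivative f' z) (at z within {l..u})"
    and f': "\<And>z. z \<in> {l..u} \<Longrightarrow> (f' has_real_derivative f'' z) (at z within {l..u})"
    and M: "\<And>z. z \<in> {l..u} \<Longrightarrow> \<bar>f'' z\<bar> \<le> M" and x: "x \<in> {l..u}" and y: "y \<in> {l..u}"
  shows "\<bar>f y - f x - (y - x) * f' x\<bar> \<le> M * (y - x)\<^sup>2"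
proof -
  let ?I = "{min x y..max x y}"
  have sub: "?I \<subseteq> {l..u}" using x y by auto
  have M0: "M \<ge> 0" using M[OF x] by linarith
  have "\<bar>(f y - y * f' x) - (f x - x * f' x)\<bar> \<le> (M * \<bar>y - x\<bar>) * \<bar>y - x\<bar>"
  proof (rule increment_bound[where l = "min x y" and u = "max x y" and f' = "\<lambda>z. f' z - f' x"])
    fix z assume z: "z \<in> ?I"
    show "((\<lambda>z. f z - z * f' x) has_real_derivative f' z - f' x) (at z within ?I)"
      using z sub by (auto intro!: derivative_eq_intros has_field_derivative_subset[OF f])
    have "\<bar>f' z - f' x\<bar> \<le> M * \<bar>z - x\<bar>"
      by (rule increment_bound[OF f' M x]) (use z sub in auto)
    also have "\<dots> \<le> M * \<bar>y - x\<bar>" using z M0 by (intro mult_left_mono) auto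
    finally show "\<bar>f' z - f' x\<bar> \<le> M * \<bar>y - x\<bar>" .
  qed auto
  then show ?thesis by (simp add: algebra_simps power2_eq_square abs_mult_self_eq)
qed

section \<open>Componentwise bounds and splitting of the upwind residual\<close>

lemma vec_bounded_by_mono: "vec_bounded_by w c \<Longrightarrow> c \<le> d \<Longrightarrow> vec_bounded_by w d"
  unfolding vec_bounded_by_def by force

lemma vec_bounded_by_add:
  assumes "w \<in> carrier_vec n" "z \<in> carrier_vec n" "vec_bounded_by w c" "vec_bounded_by z d"
  shows "vec_bounded_by (w + z) (c + d)"
  unfolding vec_bounded_by_def
proof (intro allI impI)
  fix i assume "i < dim_vec (w + z)"
  then have "i < n" using assms by auto
  then have "\<bar>w $ i\<bar> \<le> c" "\<bar>z $ i\<bar> \<le> d" using assms unfolding vec_bounded_by_def by auto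
  then show "\<bar>(w + z) $ i\<bar> \<le> c + d" using \<open>i < n\<close> assms(1,2) by auto
qed

lemma vec_bounded_by_smult:
  assumes "vec_bounded_by w c" "k \<ge> 0"
  shows "vec_bounded_by (k \<cdot>\<^sub>v w) (k * c)"
  using assms unfolding vec_bounded_by_def by (auto simp: abs_mult mult_left_mono)

text \<open>An upper bound for the operator norm induced by the maximum norm. Summing all entries
  avoids a maximum over a possibly empty set of rows.\<close>

definition entry_sum :: "real mat \<Rightarrow> real" where
  "entry_sum M = (\<Sum>i<dim_row M. \<Sum>j<dim_col M. \<bar>M $$ (i, j)\<bar>)"

lemma entry_sum_nonneg: "entry_sum M \<ge> 0"
  unfolding entry_sum_def by (intro sum_nonneg) auto

lemma vec_bounded_by_mult:
  assumes M: "M \<in> carrier_mat n k" and w: "w \<in> carrier_vec k" and b: "vec_bounded_by w c" and c: "c \<ge> 0"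
  shows "vec_bounded_by (M *\<^sub>v w) (entry_sum M * c)"
  unfolding vec_bounded_by_def
proof (intro allI impI)
  fix i assume "i < dim_vec (M *\<^sub>v w)"
  then have i: "i < n" using M by auto
  have "\<bar>(M *\<^sub>v w) $ i\<bar> = \<bar>\<Sum>j<k. M $$ (i, j) * w $ j\<bar>"
    using i M w by (auto simp: scalar_prod_def atLeast0LessThan intro!: arg_cong[where f = abs] sum.cong)
  also have "\<dots> \<le> (\<Sum>j<k. \<bar>M $$ (i, j)\<bar> * c)"
    using b w by (intro order_trans[OF sum_abs] sum_mono)
      (auto simp: abs_mult vec_bounded_by_def intro!: mult_left_mono)
  also have "\<dots> = (\<Sum>j<k. \<bar>M $$ (i, j)\<bar>) * c" by (rule sum_distrib_right[symmetric])
  also have "\<dots> \<le> entry_sum M * c"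
  proof (rule mult_right_mono[OF _ c])
    have d: "dim_row M = n" "dim_col M = k" using M by auto
    show "(\<Sum>j<k. \<bar>M $$ (i, j)\<bar>) \<le> entry_sum M"
      unfolding entry_sum_def d using i
      by (intro member_le_sum[where f = "\<lambda>i. \<Sum>j<k. \<bar>M $$ (i, j)\<bar>"]) (auto intro: sum_nonneg)
  qed
  finally show "\<bar>(M *\<^sub>v w) $ i\<bar> \<le> entry_sum M * c" .
qed

text \<open>The subtracted first-order terms amount to tau u_t + lam h (P + N) u_x. As lam h = tau
  and P + N = M, this is tau times the differential equation, hence zero; only Taylor remainders are
  left.\<close>

lemma upwind_residual_split:
  assumes P: "P \<in> carrier_mat m m" and N: "N \<in> carrier_mat m m" and PN: "P + N = M"
    and c: "d0 \<in> carrier_vec m" "d1 \<in> carrier_vec m" "d2 \<in> carrier_vec m" "ut \<in> carrier_vec m" "ux \<in> carrier_vec m"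
    and pde: "ut + M *\<^sub>v ux = 0\<^sub>v m" and t: "\<tau> = lam * h"
  shows "d0 + lam \<cdot>\<^sub>v (P *\<^sub>v d1) + lam \<cdot>\<^sub>v (N *\<^sub>v d2) =
    (d0 - \<tau> \<cdot>\<^sub>v ut) + lam \<cdot>\<^sub>v (P *\<^sub>v (d1 - h \<cdot>\<^sub>v ux)) + lam \<cdot>\<^sub>v (N *\<^sub>v (d2 - h \<cdot>\<^sub>v (ux :: real vec)))"
proof -
  have hx: "h \<cdot>\<^sub>v ux \<in> carrier_vec m" using c by simp
  have e: "L *\<^sub>v (d - h \<cdot>\<^sub>v ux) = L *\<^sub>v d - h \<cdot>\<^sub>v (L *\<^sub>v ux)"
    if "L \<in> carrier_mat m m" "d \<in> carrier_vec m" for L d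
    using mult_minus_distrib_mat_vec[OF that hx] mult_mat_vec[OF that(1) c(5)] by simp
  define p n p1 n2 where "p = P *\<^sub>v ux" and "n = N *\<^sub>v ux" and "p1 = P *\<^sub>v d1" and "n2 = N *\<^sub>v d2"
  have pn: "p \<in> carrier_vec m" "n \<in> carrier_vec m" "p1 \<in> carrier_vec m" "n2 \<in> carrier_vec m"
    unfolding p_def n_def p1_def n2_def using P N c by auto
  have upn: "ut + (p + n) = 0\<^sub>v m"
    using pde unfolding PN[symmetric] add_mult_distrib_mat_vec[OF P N c(5)] p_def n_def .
  have z: "ut $ i + (p $ i + n $ i) = 0" if i: "i < m" for i
  proof -
    have "(ut + (p + n)) $ i = 0" unfolding upn using i by simp
    then show ?thesis using i pn by simp
  qed
  show ?thesis
    unfolding e[OF P c(2)] e[OF N c(3)] p_def[symmetric] n_def[symmetric] p1_def[symmetric] n2_def[symmetric]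
  proof (rule eq_vecI, goal_cases)
    case (1 i)
    then have i: "i < m" using c pn by auto
    have ut: "ut $ i = - (p $ i + n $ i)" using z[OF i] by linarith
    show ?case using i c pn by (simp add: ut t algebra_simps)
  qed (use c pn in auto)
qed

section \<open>Constants uniform on compact rectangles\<close>

text \<open>All increments are parallel to an axis, so bounds on the pure first and second
  derivatives over the compact rectangle suffice. The derivative \<open>D\<close> is arbitrary, so
  the values named by the differential equation can be inserted directly.\<close>

lemma smooth_quadrant_bounds:
  fixes f :: "real \<times> real \<Rightarrow> real"
  assumes f: "smooth_on quadrant f"
  obtains M where "M \<ge> 0"
    "\<And>x y t. x \<in> {0..X} \<Longrightarrow> y \<in> {0..X} \<Longrightarrow> t \<in> {0..T} \<Longrightarrow> \<bar>f (y, t) - f (x, t)\<bar> \<le> M * \<bar>y - x\<bar>"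
    "\<And>x s t. x \<in> {0..X} \<Longrightarrow> s \<in> {0..T} \<Longrightarrow> t \<in> {0..T} \<Longrightarrow> \<bar>f (x, s) - f (x, t)\<bar> \<le> M * \<bar>s - t\<bar>"
    "\<And>x y t D. x \<in> {0..X} \<Longrightarrow> y \<in> {0..X} \<Longrightarrow> t \<in> {0..T} \<Longrightarrow>
      ((\<lambda>y. f (y, t)) has_real_derivative D) (at x within {0..}) \<Longrightarrow>
      \<bar>f (y, t) - f (x, t) - (y - x) * D\<bar> \<le> M * (y - x)\<^sup>2"
    "\<And>x s t D. x \<in> {0..X} \<Longrightarrow> s \<in> {0..T} \<Longrightarrow> t \<in> {0..T} \<Longrightarrow>
      ((\<lambda>s. f (x, s)) has_real_derivative D) (at t within {0..}) \<Longrightarrow>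
      \<bar>f (x, s) - f (x, t) - (s - t) * D\<bar> \<le> M * (s - t)\<^sup>2"
proof -
  have C2: "Ck_on (Suc (Suc 0)) quadrant f" using f unfolding smooth_on_def by blast
  obtain fx where fx: "Ck_on (Suc 0) quadrant fx"
    and dfx: "\<And>x t. x \<ge> 0 \<Longrightarrow> t \<ge> 0 \<Longrightarrow> ((\<lambda>y. f (y, t)) has_real_derivative fx (x, t)) (at x within {0..})"
    by (rule Ck_on_partial_fst[OF C2]) blast
  obtain fxx where fxx: "Ck_on 0 quadrant fxx"
    and dfxx: "\<And>x t. x \<ge> 0 \<Longrightarrow> t \<ge> 0 \<Longrightarrow> ((\<lambda>y. fx (y, t)) has_real_derivative fxx (x, t)) (at x within {0..})"
    by (rule Ck_on_partial_fst[OF fx]) blast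
  obtain ft where ft: "Ck_on (Suc 0) quadrant ft"
    and dft: "\<And>x t. x \<ge> 0 \<Longrightarrow> t \<ge> 0 \<Longrightarrow> ((\<lambda>s. f (x, s)) has_real_derivative ft (x, t)) (at t within {0..})"
    by (rule Ck_on_partial_snd[OF C2]) blast
  obtain ftt where ftt: "Ck_on 0 quadrant ftt"
    and dftt: "\<And>x t. x \<ge> 0 \<Longrightarrow> t \<ge> 0 \<Longrightarrow> ((\<lambda>s. ft (x, s)) has_real_derivative ftt (x, t)) (at t within {0..})"
    by (rule Ck_on_partial_snd[OF ft]) blast
  let ?D = "{0..X} \<times> {0..T}"
  have bd: "\<exists>M. \<forall>p\<in>?D. \<bar>g p\<bar> \<le> M" if "Ck_on k quadrant g" for g k
  proof -
    have "continuous_on ?D g"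
      by (rule continuous_on_subset[OF Ck_on_imp_continuous_on[OF that]]) auto
    then have "bounded (g ` ?D)"
      by (intro compact_imp_bounded compact_continuous_image compact_Times compact_Icc)
    then show ?thesis unfolding bounded_any_center[where a = 0] by auto
  qed
  obtain M1 M2 M3 M4 where M: "\<forall>p\<in>?D. \<bar>fx p\<bar> \<le> M1" "\<forall>p\<in>?D. \<bar>fxx p\<bar> \<le> M2"
    "\<forall>p\<in>?D. \<bar>ft p\<bar> \<le> M3" "\<forall>p\<in>?D. \<bar>ftt p\<bar> \<le> M4"
    using bd[OF fx] bd[OF fxx] bd[OF ft] bd[OF ftt] by blast
  \<comment> \<open>The 0 secures M >= 0 even if the rectangle is empty.\<close>
  define M where "M = max 0 (max (max M1 M2) (max M3 M4))"
  have Mb: "\<bar>fx p\<bar> \<le> M" "\<bar>fxx p\<bar> \<le> M" "\<bar>ft p\<bar> \<le> M" "\<bar>ftt p\<bar> \<le> M" if "p \<in> ?D" for p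
  proof -
    have "M1 \<le> M" "M2 \<le> M" "M3 \<le> M" "M4 \<le> M" unfolding M_def by auto
    then show "\<bar>fx p\<bar> \<le> M" "\<bar>fxx p\<bar> \<le> M" "\<bar>ft p\<bar> \<le> M" "\<bar>ftt p\<bar> \<le> M"
      using M that order_trans by blast+
  qed
  have sub: "{0..X} \<subseteq> {0..}" "{0..T} \<subseteq> {0..}" by auto
  note within = has_field_derivative_subset[OF _ sub(1)] has_field_derivative_subset[OF _ sub(2)]
  show ?thesis
  proof (rule that[of M])
    show "M \<ge> 0" unfolding M_def by simp
  next
    fix x y t assume a: "x \<in> {0..X}" "y \<in> {0..X}" "t \<in> {0..T}"
    show "\<bar>f (y, t) - f (x, t)\<bar> \<le> M * \<bar>y - x\<bar>"
      by (rule increment_bound[where f = "\<lambda>y. f (y, t)", OF within(1)[OF dfx] Mb(1) a(1,2)])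
        (use a in auto)
  next
    fix x s t assume a: "x \<in> {0..X}" "s \<in> {0..T}" "t \<in> {0..T}"
    show "\<bar>f (x, s) - f (x, t)\<bar> \<le> M * \<bar>s - t\<bar>"
      by (rule increment_bound[where f = "\<lambda>s. f (x, s)", OF within(2)[OF dft] Mb(3) a(3,2)])
        (use a in auto)
  next
    fix x y t D assume a: "x \<in> {0..X}" "y \<in> {0..X}" "t \<in> {0..T}"
      and D: "((\<lambda>y. f (y, t)) has_real_derivative D) (at x within {0..})"
    have D: "D = fx (x, t)" by (rule real_derivative_unique_within_Ici[OF D dfx]) (use a in auto)
    show "\<bar>f (y, t) - f (x, t) - (y - x) * D\<bar> \<le> M * (y - x)\<^sup>2" unfolding D
      by (rule taylor_remainder_bound[where f = "\<lambda>y. f (y, t)" and f' = "\<lambda>y. fx (y, t)",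
            OF within(1)[OF dfx] within(1)[OF dfxx] Mb(2) a(1,2)]) (use a in auto)
  next
    fix x s t D assume a: "x \<in> {0..X}" "s \<in> {0..T}" "t \<in> {0..T}"
      and D: "((\<lambda>s. f (x, s)) has_real_derivative D) (at t within {0..})"
    have D: "D = ft (x, t)" by (rule real_derivative_unique_within_Ici[OF D dft]) (use a in auto)
    show "\<bar>f (x, s) - f (x, t) - (s - t) * D\<bar> \<le> M * (s - t)\<^sup>2" unfolding D
      by (rule taylor_remainder_bound[where f = "\<lambda>s. f (x, s)" and f' = "\<lambda>s. ft (x, s)",
            OF within(2)[OF dft] within(2)[OF dftt] Mb(4) a(3,2)]) (use a in auto)
  qed
qed

lemma smooth_half_line_bound:
  fixes f :: "real \<Rightarrow> real"
  assumes f: "smooth_on {0..} f"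
  obtains M where "M \<ge> 0"
    "\<And>s t. s \<in> {0..T} \<Longrightarrow> t \<in> {0..T} \<Longrightarrow> \<bar>f s - f t\<bar> \<le> M * \<bar>s - t\<bar>"
proof -
  have "Ck_on (Suc 0) {0..} f" using f unfolding smooth_on_def by blast
  then obtain g where g: "Ck_on 0 {0..} g"
    and dg: "\<And>x. x \<in> {0..} \<Longrightarrow> (f has_real_derivative g x) (at x within {0..})"
    by (rule Ck_on_real_derivative) blast
  have "continuous_on {0..T} g"
    by (rule continuous_on_subset[OF Ck_on_imp_continuous_on[OF g]]) auto
  then have "bounded (g ` {0..T})"
    by (intro compact_imp_bounded compact_continuous_image compact_Icc)
  then obtain M where M: "\<forall>t\<in>{0..T}. \<bar>g t\<bar> \<le> M" unfolding bounded_any_center[where a = 0] by auto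
  have sub: "{0..T} \<subseteq> {0..}" by auto
  show ?thesis
  proof (rule that[of "max 0 M"])
    fix s t assume a: "s \<in> {0..T}" "t \<in> {0..T}"
    show "\<bar>f s - f t\<bar> \<le> max 0 M * \<bar>s - t\<bar>"
      by (rule increment_bound[where f' = g and l = 0 and u = T])
        (use a M in \<open>auto intro!: has_field_derivative_subset[OF _ sub] dg intro: max.coboundedI2\<close>)
  qed simp
qed

text \<open>The sum of nonnegative constants dominates each of them and also serves for n = 0.
  Enlarging a constant must preserve \<open>Pr\<close>.\<close>

lemma uniform_bound_finite:
  fixes n :: nat
  assumes "\<And>i. i < n \<Longrightarrow> \<exists>M\<ge>0. \<forall>M'\<ge>M. Pr i (M' :: real)"
  shows "\<exists>M\<ge>0. \<forall>i<n. Pr i M"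
proof -
  obtain M where M: "\<And>i. i < n \<Longrightarrow> M i \<ge> 0 \<and> (\<forall>M'\<ge>M i. Pr i M')" using assms by metis
  have "M i \<le> (\<Sum>i<n. M i)" if "i < n" for i
    using M that by (intro member_le_sum) auto
  moreover have "0 \<le> (\<Sum>i<n. M i)" using M by (intro sum_nonneg) auto
  ultimately show ?thesis using M by blast
qed

text \<open>One constant serves all components. The remainder at x is recorded for forward and for
  backward differences, the two forms that occur in the upwind scheme.\<close>

lemma uniform_smooth_quadrant_bounds:
  fixes f :: "real \<Rightarrow> real \<Rightarrow> real vec"
  assumes carr: "\<And>x t. x \<ge> 0 \<Longrightarrow> t \<ge> 0 \<Longrightarrow> f x t \<in> carrier_vec m"
    and smooth: "\<And>i. i < m \<Longrightarrow> smooth_on quadrant (\<lambda>(x, t). f x t $ i)"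
  obtains M where "M \<ge> 0"
    "\<And>x y t. x \<in> {0..X} \<Longrightarrow> y \<in> {0..X} \<Longrightarrow> t \<in> {0..T} \<Longrightarrow> vec_bounded_by (f y t - f x t) (M * \<bar>y - x\<bar>)"
    "\<And>x s t. x \<in> {0..X} \<Longrightarrow> s \<in> {0..T} \<Longrightarrow> t \<in> {0..T} \<Longrightarrow> vec_bounded_by (f x s - f x t) (M * \<bar>s - t\<bar>)"
    "\<And>x y t D. x \<in> {0..X} \<Longrightarrow> y \<in> {0..X} \<Longrightarrow> t \<in> {0..T} \<Longrightarrow> D \<in> carrier_vec m \<Longrightarrow>
      has_vec_derivative (\<lambda>y. f y t) D (at x within {0..}) \<Longrightarrow>
      vec_bounded_by (f y t - f x t - (y - x) \<cdot>\<^sub>v D) (M * (y - x)\<^sup>2)"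
    "\<And>x y t D. x \<in> {0..X} \<Longrightarrow> y \<in> {0..X} \<Longrightarrow> t \<in> {0..T} \<Longrightarrow> D \<in> carrier_vec m \<Longrightarrow>
      has_vec_derivative (\<lambda>y. f y t) D (at x within {0..}) \<Longrightarrow>
      vec_bounded_by (f x t - f y t - (x - y) \<cdot>\<^sub>v D) (M * (x - y)\<^sup>2)"
    "\<And>x s t D. x \<in> {0..X} \<Longrightarrow> s \<in> {0..T} \<Longrightarrow> t \<in> {0..T} \<Longrightarrow> D \<in> carrier_vec m \<Longrightarrow>
      has_vec_derivative (\<lambda>s. f x s) D (at t within {0..}) \<Longrightarrow>
      vec_bounded_by (f x s - f x t - (s - t) \<cdot>\<^sub>v D) (M * (s - t)\<^sup>2)"
proof -
  define Pr where "Pr i M \<longleftrightarrow>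
    (\<forall>x\<in>{0..X}. \<forall>y\<in>{0..X}. \<forall>t\<in>{0..T}. \<bar>f y t $ i - f x t $ i\<bar> \<le> M * \<bar>y - x\<bar>) \<and>
    (\<forall>x\<in>{0..X}. \<forall>s\<in>{0..T}. \<forall>t\<in>{0..T}. \<bar>f x s $ i - f x t $ i\<bar> \<le> M * \<bar>s - t\<bar>) \<and>
    (\<forall>x\<in>{0..X}. \<forall>y\<in>{0..X}. \<forall>t\<in>{0..T}. \<forall>D.
      ((\<lambda>y. f y t $ i) has_real_derivative D) (at x within {0..}) \<longrightarrow>
      \<bar>f y t $ i - f x t $ i - (y - x) * D\<bar> \<le> M * (y - x)\<^sup>2) \<and>
    (\<forall>x\<in>{0..X}. \<forall>s\<in>{0..T}. \<forall>t\<in>{0..T}. \<forall>D.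
      ((\<lambda>s. f x s $ i) has_real_derivative D) (at t within {0..}) \<longrightarrow>
      \<bar>f x s $ i - f x t $ i - (s - t) * D\<bar> \<le> M * (s - t)\<^sup>2)" for i and M :: real
  have "\<exists>M\<ge>0. \<forall>M'\<ge>M. Pr i M'" if i: "i < m" for i
  proof (rule smooth_quadrant_bounds[OF smooth[OF i], of X T])
    fix M :: real
    assume b: "M \<ge> 0"
      "\<And>x y t. x \<in> {0..X} \<Longrightarrow> y \<in> {0..X} \<Longrightarrow> t \<in> {0..T} \<Longrightarrow>
        \<bar>(case (y, t) of (x, t) \<Rightarrow> f x t $ i) - (case (x, t) of (x, t) \<Rightarrow> f x t $ i)\<bar> \<le> M * \<bar>y - x\<bar>"
      "\<And>x s t. x \<in> {0..X} \<Longrightarrow> s \<in> {0..T} \<Longrightarrow> t \<in> {0..T} \<Longrightarrow>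
        \<bar>(case (x, s) of (x, t) \<Rightarrow> f x t $ i) - (case (x, t) of (x, t) \<Rightarrow> f x t $ i)\<bar> \<le> M * \<bar>s - t\<bar>"
      "\<And>x y t D. x \<in> {0..X} \<Longrightarrow> y \<in> {0..X} \<Longrightarrow> t \<in> {0..T} \<Longrightarrow>
        ((\<lambda>y. case (y, t) of (x, t) \<Rightarrow> f x t $ i) has_real_derivative D) (at x within {0..}) \<Longrightarrow>
        \<bar>(case (y, t) of (x, t) \<Rightarrow> f x t $ i) - (case (x, t) of (x, t) \<Rightarrow> f x t $ i) - (y - x) * D\<bar> \<le> M * (y - x)\<^sup>2"
      "\<And>x s t D. x \<in> {0..X} \<Longrightarrow> s \<in> {0..T} \<Longrightarrow> t \<in> {0..T} \<Longrightarrow>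
        ((\<lambda>s. case (x, s) of (x, t) \<Rightarrow> f x t $ i) has_real_derivative D) (at t within {0..}) \<Longrightarrow>
        \<bar>(case (x, s) of (x, t) \<Rightarrow> f x t $ i) - (case (x, t) of (x, t) \<Rightarrow> f x t $ i) - (s - t) * D\<bar> \<le> M * (s - t)\<^sup>2"
    note b = b[unfolded prod.case]
    have "Pr i M'" if "M' \<ge> M" for M'
    proof -
      have m: "M * \<bar>z\<bar> \<le> M' * \<bar>z\<bar>" "M * z\<^sup>2 \<le> M' * z\<^sup>2" for z using that by (auto intro!: mult_right_mono)
      show ?thesis unfolding Pr_def
        by (intro conjI ballI allI impI; rule order_trans[OF b(2) m(1)] order_trans[OF b(3) m(1)]
            order_trans[OF b(4) m(2)] order_trans[OF b(5) m(2)]; assumption)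
    qed
    with b(1) show ?thesis by blast
  qed
  then obtain M where M: "M \<ge> 0" and Pr: "\<And>i. i < m \<Longrightarrow> Pr i M"
    using uniform_bound_finite[of m Pr] by blast
  have nn: "x \<ge> 0" if "x \<in> {0..Z}" for x Z :: real using that by simp
  show ?thesis
  proof (rule that[OF M])
    fix x y t assume a: "x \<in> {0..X}" "y \<in> {0..X}" "t \<in> {0..T}"
    note c = carr[OF nn[OF a(1)] nn[OF a(3)]] carr[OF nn[OF a(2)] nn[OF a(3)]]
    show "vec_bounded_by (f y t - f x t) (M * \<bar>y - x\<bar>)"
      unfolding vec_bounded_by_def using Pr a c unfolding Pr_def by simp
  next
    fix x s t assume a: "x \<in> {0..X}" "s \<in> {0..T}" "t \<in> {0..T}"
    note c = carr[OF nn[OF a(1)] nn[OF a(2)]] carr[OF nn[OF a(1)] nn[OF a(3)]]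
    show "vec_bounded_by (f x s - f x t) (M * \<bar>s - t\<bar>)"
      unfolding vec_bounded_by_def using Pr a c unfolding Pr_def by simp
  next
    fix x y t D assume a: "x \<in> {0..X}" "y \<in> {0..X}" "t \<in> {0..T}" and D: "D \<in> carrier_vec m"
      and d: "has_vec_derivative (\<lambda>y. f y t) D (at x within {0..})"
    note c = carr[OF nn[OF a(1)] nn[OF a(3)]] carr[OF nn[OF a(2)] nn[OF a(3)]]
    have "\<bar>f y t $ i - f x t $ i - (y - x) * D $ i\<bar> \<le> M * (y - x)\<^sup>2" if i: "i < m" for i
    proof -
      have "((\<lambda>y. f y t $ i) has_real_derivative D $ i) (at x within {0..})"
        using d D i unfolding has_vec_derivative_def by auto
      then show ?thesis using Pr[OF i] a unfolding Pr_def by blast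
    qed
    note b = this
    show "vec_bounded_by (f y t - f x t - (y - x) \<cdot>\<^sub>v D) (M * (y - x)\<^sup>2)"
      unfolding vec_bounded_by_def using b c D by simp
    \<comment> \<open>The same remainder with its sign reversed, in the form of a backward
      difference.\<close>
    have "\<bar>f x t $ i - f y t $ i - (x - y) * D $ i\<bar> \<le> M * (x - y)\<^sup>2" if i: "i < m" for i
      using b[OF i] abs_minus_cancel[of "f y t $ i - f x t $ i - (y - x) * D $ i"]
      by (simp add: algebra_simps power2_commute)
    then show "vec_bounded_by (f x t - f y t - (x - y) \<cdot>\<^sub>v D) (M * (x - y)\<^sup>2)"
      unfolding vec_bounded_by_def using c D by simp
  next
    fix x s t D assume a: "x \<in> {0..X}" "s \<in> {0..T}" "t \<in> {0..T}" and D: "D \<in> carrier_vec m"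
      and d: "has_vec_derivative (\<lambda>s. f x s) D (at t within {0..})"
    note c = carr[OF nn[OF a(1)] nn[OF a(2)]] carr[OF nn[OF a(1)] nn[OF a(3)]]
    have "\<bar>f x s $ i - f x t $ i - (s - t) * D $ i\<bar> \<le> M * (s - t)\<^sup>2" if i: "i < m" for i
    proof -
      have "((\<lambda>s. f x s $ i) has_real_derivative D $ i) (at t within {0..})"
        using d D i unfolding has_vec_derivative_def by auto
      then show ?thesis using Pr[OF i] a unfolding Pr_def by blast
    qed
    then show "vec_bounded_by (f x s - f x t - (s - t) \<cdot>\<^sub>v D) (M * (s - t)\<^sup>2)"
      unfolding vec_bounded_by_def using c D by simp
  qed
qed

lemma uniform_smooth_half_line_bound:
  fixes f :: "real \<Rightarrow> real vec"
  assumes carr: "\<And>t. t \<ge> 0 \<Longrightarrow> f t \<in> carrier_vec m"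
    and smooth: "\<And>i. i < m \<Longrightarrow> smooth_on {0..} (\<lambda>t. f t $ i)"
  obtains M where "M \<ge> 0"
    "\<And>s t. s \<in> {0..T} \<Longrightarrow> t \<in> {0..T} \<Longrightarrow> vec_bounded_by (f s - f t) (M * \<bar>s - t\<bar>)"
proof -
  have "\<exists>M\<ge>0. \<forall>M'\<ge>M. \<forall>s\<in>{0..T}. \<forall>t\<in>{0..T}. \<bar>f s $ i - f t $ i\<bar> \<le> M' * \<bar>s - t\<bar>" if i: "i < m" for i
  proof (rule smooth_half_line_bound[OF smooth[OF i], of T])
    fix M :: real
    assume b: "M \<ge> 0" "\<And>s t. s \<in> {0..T} \<Longrightarrow> t \<in> {0..T} \<Longrightarrow> \<bar>f s $ i - f t $ i\<bar> \<le> M * \<bar>s - t\<bar>"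
    have "\<bar>f s $ i - f t $ i\<bar> \<le> M' * \<bar>s - t\<bar>" if "M' \<ge> M" "s \<in> {0..T}" "t \<in> {0..T}" for M' s t
      using b(2)[OF that(2,3)] mult_right_mono[OF that(1), of "\<bar>s - t\<bar>"] by simp
    with b(1) show ?thesis by blast
  qed
  then obtain M where M: "M \<ge> 0"
    "\<And>i s t. i < m \<Longrightarrow> s \<in> {0..T} \<Longrightarrow> t \<in> {0..T} \<Longrightarrow> \<bar>f s $ i - f t $ i\<bar> \<le> M * \<bar>s - t\<bar>"
    using uniform_bound_finite[of m "\<lambda>i M. \<forall>s\<in>{0..T}. \<forall>t\<in>{0..T}. \<bar>f s $ i - f t $ i\<bar> \<le> M * \<bar>s - t\<bar>"] by blast
  show ?thesis
  proof (rule that[OF M(1)])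
    fix s t assume a: "s \<in> {0..T}" "t \<in> {0..T}"
    then have "f s \<in> carrier_vec m" "f t \<in> carrier_vec m" using carr by auto
    then show "vec_bounded_by (f s - f t) (M * \<bar>s - t\<bar>)"
      unfolding vec_bounded_by_def using M(2) a by simp
  qed
qed

text \<open>Rearrangements that arise when the boundary value ubar - K nu is inserted into the
  residuals.\<close>

lemma vec_group_identities:
  fixes w x y z :: "real vec"
  assumes "w \<in> carrier_vec n" "x \<in> carrier_vec n" "y \<in> carrier_vec n" "z \<in> carrier_vec n"
  shows "x - (y - z) - z = x - y" "x - (y - z) = x - y + z" "x + y + - y = x"
    "(w - x) - (y - z) = (w - y) + (z - x)"
  using assms by (auto intro!: eq_vecI)

section \<open>Residuals of the asymptotic limit\<close>

context boundary_scheme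
begin

lemma A11_split: "A11p + A11m = A11"
proof -
  have "A11p + A11m = A11 * (R1p * L1p) + A11 * (R1m * L1m)"
    unfolding assoc_mult_mat[OF A11 s1.Rp s1.Lp] assoc_mult_mat[OF A11 s1.Rm s1.Lm] ..
  also have "\<dots> = A11 * (R1p * L1p + R1m * L1m)"
    by (rule mult_add_distrib_mat[OF A11 mult_carrier_mat[OF s1.Rp s1.Lp] mult_carrier_mat[OF s1.Rm s1.Lm], symmetric])
  also have "\<dots> = A11" unfolding s1.resolution by (rule right_mult_one_mat[OF A11])
  finally show ?thesis .
qed

lemma limit_carrier:
  assumes "asymptotic_limit m r A11 A12 Bu Bv LHp bd ubar nu"
  shows "x \<ge> 0 \<Longrightarrow> t \<ge> 0 \<Longrightarrow> ubar x t \<in> carrier_vec m" "t \<ge> 0 \<Longrightarrow> nu t \<in> carrier_vec r"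
  using assms unfolding asymptotic_limit_def by blast+

text \<open>The correction - K nu in the boundary value is exactly what turns B_u ubar + (B_v - B_u
  K) nu into B_u u_0 + B_v v_0.\<close>

lemma limit_exact:
  assumes lim: "asymptotic_limit m r A11 A12 Bu Bv LHp bd ubar nu"
    and Bu: "Bu \<in> carrier_mat p m" and Bv: "Bv \<in> carrier_mat p r" and t: "0 < \<tau>"
  shows "LHp *\<^sub>v v_lim r nu \<tau> 0 (n + 1) = 0\<^sub>v c"
    and "Bu *\<^sub>v u_lim A11 A12 ubar nu \<tau> h 0 (n + 1) + Bv *\<^sub>v v_lim r nu \<tau> 0 (n + 1) = bd (real (n + 1) * \<tau>)"
proof -
  let ?t = "real (n + 1) * \<tau>"
  have tn: "?t \<ge> 0" using t by simp
  have u: "ubar 0 ?t \<in> carrier_vec m" and v: "nu ?t \<in> carrier_vec r" using limit_carrier[OF lim] tn by auto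
  have "LHp *\<^sub>v nu ?t = 0\<^sub>v (dim_row LHp)" using lim tn unfolding asymptotic_limit_def by blast
  then show "LHp *\<^sub>v v_lim r nu \<tau> 0 (n + 1) = 0\<^sub>v c"
    using carrier_matD[OF sH.Lp] unfolding v_lim_def by simp
  have Kv: "K *\<^sub>v nu ?t \<in> carrier_vec m" by (rule mult_mat_vec_carrier[OF K_carrier v])
  have BuK: "Bu * K \<in> carrier_mat p r" by (rule mult_carrier_mat[OF Bu K_carrier])
  have e: "Bu *\<^sub>v ubar 0 ?t + (Bv - Bu * minv A11 * A12) *\<^sub>v nu ?t = bd ?t"
    using lim tn unfolding asymptotic_limit_def by blast
  define x y z where "x = Bu *\<^sub>v ubar 0 ?t" and "y = Bv *\<^sub>v nu ?t" and "z = (Bu * K) *\<^sub>v nu ?t"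
  have xyz: "x \<in> carrier_vec p" "y \<in> carrier_vec p" "z \<in> carrier_vec p"
    unfolding x_def y_def z_def using Bu Bv BuK u v by auto
  have "Bu *\<^sub>v (ubar 0 ?t - K *\<^sub>v nu ?t) + Bv *\<^sub>v nu ?t = (x - z) + y"
    unfolding x_def y_def z_def mult_minus_distrib_mat_vec[OF Bu u Kv] assoc_mult_mat_vec[OF Bu K_carrier v] ..
  also have "\<dots> = x + (y - z)" using xyz by (intro eq_vecI) auto
  also have "\<dots> = bd ?t"
    using e unfolding assoc_mult_mat[OF Bu minv_A11(1) A12] minus_mult_distrib_mat_vec[OF Bv BuK v]
      x_def y_def z_def .
  finally show "Bu *\<^sub>v u_lim A11 A12 ubar nu \<tau> h 0 (n + 1) + Bv *\<^sub>v v_lim r nu \<tau> 0 (n + 1) = bd ?t"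
    unfolding u_lim_def v_lim_def by simp
qed

text \<open>For j >= 1 the estimate is second order by Taylor expansion. At j = 0 a first-order
  bound is enough, so increments are bounded directly and no derivative has to be compared with
  another.\<close>

lemma limit_consistency:
  assumes lim: "asymptotic_limit m r A11 A12 Bu Bv LHp bd ubar nu" and lam: "lam > 0"
    and C: "compact C" "C \<subseteq> quadrant"
  shows "\<exists>c1. \<forall>\<tau> h. 0 < \<tau> \<longrightarrow> \<tau> < 1 \<longrightarrow> 0 < h \<longrightarrow> \<tau> / h = lam \<longrightarrow>
    (\<forall>n. (h, real n * \<tau>) \<in> C \<longrightarrow> vec_bounded_by (first_cell_residual A11 A12 A11p A11m lam
        (u_lim A11 A12 ubar nu \<tau> h) (v_lim r nu \<tau>) n) (c1 * \<tau>\<^sup>2)) \<and>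
    (\<forall>n. \<forall>j\<ge>2. (real j * h, real n * \<tau>) \<in> C \<longrightarrow> vec_bounded_by (interior_residual A11p A11m lam
        (u_lim A11 A12 ubar nu \<tau> h) j n) (c1 * \<tau>\<^sup>2)) \<and>
    (\<forall>n. (0, real n * \<tau>) \<in> C \<longrightarrow> vec_bounded_by (boundary_residual A11 A12 L1m lam
        (u_lim A11 A12 ubar nu \<tau> h) (v_lim r nu \<tau>) n) (c1 * \<tau>))"
proof -
  have ubar: "ubar x t \<in> carrier_vec m" if "x \<ge> 0" "t \<ge> 0" for x t using limit_carrier(1)[OF lim that] .
  have nu: "nu t \<in> carrier_vec r" if "t \<ge> 0" for t using limit_carrier(2)[OF lim that] .
  have smooth: "smooth_on quadrant (\<lambda>(x, t). ubar x t $ i)" if "i < m" for i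
    using lim that unfolding asymptotic_limit_def by blast
  have smooth_nu: "smooth_on {0..} (\<lambda>t. nu t $ i)" if "i < r" for i
    using lim that unfolding asymptotic_limit_def by blast
  obtain R where R: "\<And>p. p \<in> C \<Longrightarrow> dist 0 p \<le> R"
    using compact_imp_bounded[OF C(1)] unfolding bounded_any_center[where a = 0] by blast
  have CR: "0 \<le> x" "x \<le> R" "0 \<le> t" "t \<le> R" if "(x, t) \<in> C" for x t
    using R[OF that] C(2) that dist_fst_le[of 0 "(x, t)"] dist_snd_le[of 0 "(x, t)"] by auto
  \<comment> \<open>The stencil may leave \<open>C\<close> by one step: with tau < 1 a space step
    satisfies h = tau/lam < 1/lam and a time step is below 1.\<close>
  let ?X = "R + 1 / lam" and ?T = "R + 1"
  obtain M where M: "M \<ge> 0"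
    "\<And>x y t. x \<in> {0..?X} \<Longrightarrow> y \<in> {0..?X} \<Longrightarrow> t \<in> {0..?T} \<Longrightarrow> vec_bounded_by (ubar y t - ubar x t) (M * \<bar>y - x\<bar>)"
    "\<And>x s t. x \<in> {0..?X} \<Longrightarrow> s \<in> {0..?T} \<Longrightarrow> t \<in> {0..?T} \<Longrightarrow> vec_bounded_by (ubar x s - ubar x t) (M * \<bar>s - t\<bar>)"
    "\<And>x y t D. x \<in> {0..?X} \<Longrightarrow> y \<in> {0..?X} \<Longrightarrow> t \<in> {0..?T} \<Longrightarrow> D \<in> carrier_vec m \<Longrightarrow>
      has_vec_derivative (\<lambda>y. ubar y t) D (at x within {0..}) \<Longrightarrow>
      vec_bounded_by (ubar y t - ubar x t - (y - x) \<cdot>\<^sub>v D) (M * (y - x)\<^sup>2)"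
    "\<And>x y t D. x \<in> {0..?X} \<Longrightarrow> y \<in> {0..?X} \<Longrightarrow> t \<in> {0..?T} \<Longrightarrow> D \<in> carrier_vec m \<Longrightarrow>
      has_vec_derivative (\<lambda>y. ubar y t) D (at x within {0..}) \<Longrightarrow>
      vec_bounded_by (ubar x t - ubar y t - (x - y) \<cdot>\<^sub>v D) (M * (x - y)\<^sup>2)"
    "\<And>x s t D. x \<in> {0..?X} \<Longrightarrow> s \<in> {0..?T} \<Longrightarrow> t \<in> {0..?T} \<Longrightarrow> D \<in> carrier_vec m \<Longrightarrow>
      has_vec_derivative (\<lambda>s. ubar x s) D (at t within {0..}) \<Longrightarrow>
      vec_bounded_by (ubar x s - ubar x t - (s - t) \<cdot>\<^sub>v D) (M * (s - t)\<^sup>2)"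
    by (rule uniform_smooth_quadrant_bounds[OF ubar smooth, of ?X ?T]) blast+
  obtain M' where M': "M' \<ge> 0"
    "\<And>s t. s \<in> {0..?T} \<Longrightarrow> t \<in> {0..?T} \<Longrightarrow> vec_bounded_by (nu s - nu t) (M' * \<bar>s - t\<bar>)"
    by (rule uniform_smooth_half_line_bound[OF nu smooth_nu, of ?T]) blast+
  \<comment> \<open>\<open>e1\<close> collects M tau^2 from the time difference and lam M h^2 from
    each space difference, with h = tau/lam. In \<open>e2\<close> the spatial contribution is
    simplified by lam h = tau. Their maximum serves all three estimates.\<close>
  define e1 where "e1 = M * (1 + (entry_sum A11p + entry_sum A11m) / lam)"
  define e2 where "e2 = entry_sum L1m * (M + entry_sum K * M') + entry_sum L1m * (entry_sum A11 * M)"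
  \<comment> \<open>Stated for real points with x - h >= 0, so that x = h covers the first cell and
    x = j h the interior.\<close>
  have cell: "vec_bounded_by (ubar x (t + \<tau>) - ubar x t + lam \<cdot>\<^sub>v (A11p *\<^sub>v (ubar x t - ubar (x - h) t))
      + lam \<cdot>\<^sub>v (A11m *\<^sub>v (ubar (x + h) t - ubar x t))) (max e1 e2 * \<tau>\<^sup>2)"
    if x: "0 \<le> x - h" "x \<le> R" and t: "0 \<le> t" "t \<le> R" and th: "0 < \<tau>" "\<tau> < 1" "0 < h" "\<tau> / h = lam" for x t \<tau> h
  proof -
    have tlh: "\<tau> = lam * h" using th lam by (simp add: field_simps)
    have h: "h = \<tau> / lam" using tlh lam by simp
    have hl: "h < 1 / lam" using th lam unfolding h by (simp add: field_simps)
    obtain ut ux where D: "ut \<in> carrier_vec m" "ux \<in> carrier_vec m"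
      "has_vec_derivative (\<lambda>s. ubar x s) ut (at t within {0..})"
      "has_vec_derivative (\<lambda>y. ubar y t) ux (at x within {0..})" "ut + A11 *\<^sub>v ux = 0\<^sub>v m"
      using lim x t th(3) unfolding asymptotic_limit_def by (metis add_nonneg_nonneg diff_add_cancel less_imp_le)
    have dom: "x \<in> {0..?X}" "x - h \<in> {0..?X}" "x + h \<in> {0..?X}" "t \<in> {0..?T}" "t + \<tau> \<in> {0..?T}"
      using x t th hl lam by auto
    have c: "ubar x (t + \<tau>) \<in> carrier_vec m" "ubar x t \<in> carrier_vec m" "ubar (x - h) t \<in> carrier_vec m"
      "ubar (x + h) t \<in> carrier_vec m" using ubar x t th by auto
    have b0: "vec_bounded_by (ubar x (t + \<tau>) - ubar x t - \<tau> \<cdot>\<^sub>v ut) (M * \<tau>\<^sup>2)"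
      using M(6)[OF dom(1,5,4) D(1,3)] by simp
    have b1: "vec_bounded_by (ubar x t - ubar (x - h) t - h \<cdot>\<^sub>v ux) (M * h\<^sup>2)"
      using M(5)[OF dom(1,2,4) D(2,4)] by simp
    have b2: "vec_bounded_by (ubar (x + h) t - ubar x t - h \<cdot>\<^sub>v ux) (M * h\<^sup>2)"
      using M(4)[OF dom(1,3,4) D(2,4)] by simp
    have d: "ubar x (t + \<tau>) - ubar x t \<in> carrier_vec m" "ubar x t - ubar (x - h) t \<in> carrier_vec m"
      "ubar (x + h) t - ubar x t \<in> carrier_vec m" using c by auto
    have hux: "h \<cdot>\<^sub>v ux \<in> carrier_vec m" and tut: "\<tau> \<cdot>\<^sub>v ut \<in> carrier_vec m" using D by auto
    have Mh: "M * h\<^sup>2 \<ge> 0" using M(1) by simp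
    have l0: "lam \<ge> 0" using lam by simp
    have w1: "ubar x t - ubar (x - h) t - h \<cdot>\<^sub>v ux \<in> carrier_vec m"
      and w2: "ubar (x + h) t - ubar x t - h \<cdot>\<^sub>v ux \<in> carrier_vec m"
      and w0: "ubar x (t + \<tau>) - ubar x t - \<tau> \<cdot>\<^sub>v ut \<in> carrier_vec m" using d hux tut by auto
    have P1: "lam \<cdot>\<^sub>v (A11p *\<^sub>v (ubar x t - ubar (x - h) t - h \<cdot>\<^sub>v ux)) \<in> carrier_vec m"
      and P2: "lam \<cdot>\<^sub>v (A11m *\<^sub>v (ubar (x + h) t - ubar x t - h \<cdot>\<^sub>v ux)) \<in> carrier_vec m"
      using mult_mat_vec_carrier[OF A11p_carrier w1] mult_mat_vec_carrier[OF A11m_carrier w2] by auto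
    have "vec_bounded_by (ubar x (t + \<tau>) - ubar x t + lam \<cdot>\<^sub>v (A11p *\<^sub>v (ubar x t - ubar (x - h) t))
      + lam \<cdot>\<^sub>v (A11m *\<^sub>v (ubar (x + h) t - ubar x t)))
      (M * \<tau>\<^sup>2 + lam * (entry_sum A11p * (M * h\<^sup>2)) + lam * (entry_sum A11m * (M * h\<^sup>2)))"
      unfolding upwind_residual_split[OF A11p_carrier A11m_carrier A11_split d D(1,2,5) tlh]
      by (rule vec_bounded_by_add[OF add_carrier_vec[OF w0 P1] P2 vec_bounded_by_add[OF w0 P1 b0]];
          rule vec_bounded_by_smult[OF vec_bounded_by_mult[OF A11p_carrier w1 b1 Mh] l0]
            vec_bounded_by_smult[OF vec_bounded_by_mult[OF A11m_carrier w2 b2 Mh] l0])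
    then show ?thesis
    proof (rule vec_bounded_by_mono)
      have "M * \<tau>\<^sup>2 + lam * (entry_sum A11p * (M * h\<^sup>2)) + lam * (entry_sum A11m * (M * h\<^sup>2)) = e1 * \<tau>\<^sup>2"
      unfolding e1_def h using lam by (simp add: field_simps power2_eq_square)
      also have "\<dots> \<le> max e1 e2 * \<tau>\<^sup>2" by (intro mult_right_mono) auto
      finally show "M * \<tau>\<^sup>2 + lam * (entry_sum A11p * (M * h\<^sup>2)) + lam * (entry_sum A11m * (M * h\<^sup>2))
        \<le> max e1 e2 * \<tau>\<^sup>2" .
    qed
  qed
  show ?thesis
  proof (intro exI[of _ "max e1 e2"] allI impI conjI)
    fix \<tau> h :: real and n
    assume th: "0 < \<tau>" "\<tau> < 1" "0 < h" "\<tau> / h = lam"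
    let ?u = "u_lim A11 A12 ubar nu \<tau> h" and ?v = "v_lim r nu \<tau>" and ?t = "real n * \<tau>"
    have t0: "?t \<ge> 0" using th by simp
    have tn: "real (n + 1) * \<tau> = ?t + \<tau>" by (simp add: algebra_simps)
    have tlh: "\<tau> = lam * h" using th lam by (simp add: field_simps)
    have h: "h = \<tau> / lam" using tlh lam by simp
    have hl: "h < 1 / lam" using th lam unfolding h by (simp add: field_simps)
    {
      assume "(h, ?t) \<in> C"
      note b = CR[OF this]
      have Kn: "K *\<^sub>v nu ?t \<in> carrier_vec m" by (rule mult_mat_vec_carrier[OF K_carrier nu[OF t0]])
      \<comment> \<open>The two occurrences of K nu cancel, and the residual in the first cell
        becomes the interior one with left neighbor ubar at 0.\<close>
      have "ubar h ?t - (ubar 0 ?t - K *\<^sub>v nu ?t) - K *\<^sub>v nu ?t = ubar h ?t - ubar 0 ?t"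
        by (rule vec_group_identities(1)[OF Kn ubar[OF b(1) t0] ubar[OF order_refl t0] Kn])
      then have "first_cell_residual A11 A12 A11p A11m lam ?u ?v n =
          ubar h (?t + \<tau>) - ubar h ?t + lam \<cdot>\<^sub>v (A11p *\<^sub>v (ubar h ?t - ubar (h - h) ?t))
          + lam \<cdot>\<^sub>v (A11m *\<^sub>v (ubar (h + h) ?t - ubar h ?t))"
        unfolding first_cell_residual_def u_lim_def v_lim_def tn by simp
      then show "vec_bounded_by (first_cell_residual A11 A12 A11p A11m lam ?u ?v n) (max e1 e2 * \<tau>\<^sup>2)"
        using cell[of h h ?t \<tau>] b th by simp
    next
      fix j :: nat assume j: "j \<ge> 2" and "(real j * h, ?t) \<in> C"
      note b = CR[OF this(2)]
      have jj: "real (j - 1) * h = real j * h - h" "real (j + 1) * h = real j * h + h"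
        using j by (auto simp: algebra_simps of_nat_diff)
      have jh: "0 \<le> real j * h - h" using j th unfolding jj(1)[symmetric] by simp
      have "interior_residual A11p A11m lam ?u j n =
          ubar (real j * h) (?t + \<tau>) - ubar (real j * h) ?t
          + lam \<cdot>\<^sub>v (A11p *\<^sub>v (ubar (real j * h) ?t - ubar (real j * h - h) ?t))
          + lam \<cdot>\<^sub>v (A11m *\<^sub>v (ubar (real j * h + h) ?t - ubar (real j * h) ?t))"
        using j unfolding interior_residual_def u_lim_def tn jj by simp
      then show "vec_bounded_by (interior_residual A11p A11m lam ?u j n) (max e1 e2 * \<tau>\<^sup>2)"
        using cell[OF jh b(2) b(3,4) th] by simp
    next
      assume "(0, ?t) \<in> C"
      note b = CR[OF this]
      let ?s = "?t + \<tau>"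
      have s0: "?s \<ge> 0" using t0 th by simp
      have dom: "0 \<in> {0..?X}" "h \<in> {0..?X}" "?t \<in> {0..?T}" "?s \<in> {0..?T}"
        using b th(1-3) hl s0 unfolding atLeastAtMost_iff by linarith+
      have c: "ubar 0 ?s \<in> carrier_vec m" "ubar 0 ?t \<in> carrier_vec m" "ubar h ?t \<in> carrier_vec m"
        "nu ?s \<in> carrier_vec r" "nu ?t \<in> carrier_vec r" using ubar nu t0 s0 th by auto
      have Kn: "K *\<^sub>v nu ?t \<in> carrier_vec m" "K *\<^sub>v nu ?s \<in> carrier_vec m"
        using mult_mat_vec_carrier[OF K_carrier] c by auto
      have du: "ubar 0 ?s - ubar 0 ?t \<in> carrier_vec m" "ubar h ?t - ubar 0 ?t \<in> carrier_vec m"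
        "nu ?t - nu ?s \<in> carrier_vec r" using c by auto
      have Kd: "K *\<^sub>v (nu ?t - nu ?s) \<in> carrier_vec m" by (rule mult_mat_vec_carrier[OF K_carrier du(3)])
      \<comment> \<open>The increment of K nu stays. It is estimated by smoothness of nu and
        contributes \<open>entry_sum K * M'\<close> to \<open>e2\<close>.\<close>
      have first: "(ubar 0 ?s - K *\<^sub>v nu ?s) - (ubar 0 ?t - K *\<^sub>v nu ?t) =
          (ubar 0 ?s - ubar 0 ?t) + K *\<^sub>v (nu ?t - nu ?s)"
        unfolding mult_minus_distrib_mat_vec[OF K_carrier c(5,4)]
        by (rule vec_group_identities(4)[OF c(1) Kn(2) c(2) Kn(1)])
      \<comment> \<open>In the spatial difference nu disappears: A_11 K nu from the boundary value
        cancels the term from A_12 (0 - nu).\<close>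
      have second: "A11 *\<^sub>v (ubar h ?t - (ubar 0 ?t - K *\<^sub>v nu ?t)) + A12 *\<^sub>v (0\<^sub>v r - nu ?t) =
          A11 *\<^sub>v (ubar h ?t - ubar 0 ?t)"
      proof -
        have "ubar h ?t - (ubar 0 ?t - K *\<^sub>v nu ?t) = (ubar h ?t - ubar 0 ?t) + K *\<^sub>v nu ?t"
          by (rule vec_group_identities(2)[OF Kn(1) c(3,2) Kn(1)])
        then have 1: "A11 *\<^sub>v (ubar h ?t - (ubar 0 ?t - K *\<^sub>v nu ?t)) =
            A11 *\<^sub>v (ubar h ?t - ubar 0 ?t) + A12 *\<^sub>v nu ?t"
          using mult_add_distrib_mat_vec[OF A11 du(2) Kn(1)] assoc_mult_mat_vec[OF A11 K_carrier c(5)] A11_K by argo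
        have 2: "A12 *\<^sub>v (0\<^sub>v r - nu ?t) = - (A12 *\<^sub>v nu ?t)"
          unfolding zero_minus_vec[OF c(5)] by (rule mult_mat_vec_uminus[OF A12 c(5)])
        show ?thesis unfolding 1 2
          by (rule vec_group_identities(3)[OF Kn(1) mult_mat_vec_carrier[OF A11 du(2)]
                mult_mat_vec_carrier[OF A12 c(5)] Kn(1)])
      qed
      have res: "boundary_residual A11 A12 L1m lam ?u ?v n =
          L1m *\<^sub>v ((ubar 0 ?s - ubar 0 ?t) + K *\<^sub>v (nu ?t - nu ?s))
          + lam \<cdot>\<^sub>v (L1m *\<^sub>v (A11 *\<^sub>v (ubar h ?t - ubar 0 ?t)))"
        unfolding boundary_residual_def u_lim_def v_lim_def tn using first second by simp
      have b1: "vec_bounded_by (ubar 0 ?s - ubar 0 ?t) (M * \<tau>)" using M(3)[OF dom(1,4,3)] th by simp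
      have b2: "vec_bounded_by (nu ?t - nu ?s) (M' * \<tau>)" using M'(2)[OF dom(3,4)] th by simp
      have b3: "vec_bounded_by (ubar h ?t - ubar 0 ?t) (M * h)" using M(2)[OF dom(1,2,3)] th by simp
      have nn: "M * \<tau> \<ge> 0" "M' * \<tau> \<ge> 0" "M * h \<ge> 0" using M(1) M'(1) th by auto
      have nn2: "M * \<tau> + entry_sum K * (M' * \<tau>) \<ge> 0" "entry_sum A11 * (M * h) \<ge> 0" "lam \<ge> 0"
        using nn entry_sum_nonneg lam by auto
      have Ad: "A11 *\<^sub>v (ubar h ?t - ubar 0 ?t) \<in> carrier_vec m" by (rule mult_mat_vec_carrier[OF A11 du(2)])
      have "vec_bounded_by (boundary_residual A11 A12 L1m lam ?u ?v n)
          (entry_sum L1m * (M * \<tau> + entry_sum K * (M' * \<tau>)) + lam * (entry_sum L1m * (entry_sum A11 * (M * h))))"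
        unfolding res
        by (intro vec_bounded_by_add[where n = b] vec_bounded_by_smult nn2
            vec_bounded_by_mult[OF s1.Lm add_carrier_vec[OF du(1) Kd]
              vec_bounded_by_add[OF du(1) Kd b1 vec_bounded_by_mult[OF K_carrier du(3) b2 nn(2)]]]
            vec_bounded_by_mult[OF s1.Lm Ad vec_bounded_by_mult[OF A11 du(2) b3 nn(3)]]
            smult_carrier_vec[THEN iffD2] mult_mat_vec_carrier[OF s1.Lm] Ad add_carrier_vec[OF du(1) Kd])
      then show "vec_bounded_by (boundary_residual A11 A12 L1m lam ?u ?v n) (max e1 e2 * \<tau>)"
      proof (rule vec_bounded_by_mono)
        have "entry_sum L1m * (M * \<tau> + entry_sum K * (M' * \<tau>)) + lam * (entry_sum L1m * (entry_sum A11 * (M * h))) = e2 * \<tau>"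
        unfolding e2_def tlh by (simp add: algebra_simps)
        also have "\<dots> \<le> max e1 e2 * \<tau>" using th by (intro mult_right_mono) auto
        finally show "entry_sum L1m * (M * \<tau> + entry_sum K * (M' * \<tau>))
          + lam * (entry_sum L1m * (entry_sum A11 * (M * h))) \<le> max e1 e2 * \<tau>" .
      qed
    }
  qed
qed

end

section \<open>Assembly of the limiting scheme and its consistency\<close>

theorem mainTheorem3:
  fixes m r :: nat
    and A11 A12 A21 A22 S A Q Bu Bv B X H :: "real mat"
    and RAp RAm LAp LAm R1p R1m L1p L1m RHp RHm LHp LHm Rip Rim Lip Lim A11p A11m :: "real mat"
    and b :: "real \<Rightarrow> real vec"
    and lam :: real
  assumes A11: "A11 \<in> carrier_mat m m" and A12: "A12 \<in> carrier_mat m r"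
    and A21: "A21 \<in> carrier_mat r m" and A22: "A22 \<in> carrier_mat r r"
    and A: "A = four_block_mat A11 A12 A21 A22"
    and S: "negative_definite r S"
    and Q: "Q = four_block_mat (0\<^sub>m m m) (0\<^sub>m m r) (0\<^sub>m r m) S"
    and Bu: "Bu \<in> carrier_mat (num_pos_eigenvalues A) m"
    and Bv: "Bv \<in> carrier_mat (num_pos_eigenvalues A) r"
    and B: "B = append_cols Bu Bv"
    and hyperbolic: "real_diagonalizable A" "real_diagonalizable A11"
    and noncharacteristic: "invertible_mat A" "invertible_mat A11"
    and X: "X = minv (A22 - A21 * minv A11 * A12)"
    and H: "H = X * S"
    and H_no_imaginary: "\<forall>e. eigenvalue (cmat H) e \<longrightarrow> Re e \<noteq> 0"
    and RA: "right_unstable A RAp" "right_stable A RAm" "left_matrices RAp RAm LAp LAm"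
    and R1: "right_unstable A11 R1p" "right_stable A11 R1m" "left_matrices R1p R1m L1p L1m"
    and R1_eigenvectors: "columns_are_eigenvectors A11 R1p" "columns_are_eigenvectors A11 R1m"
    and RH: "right_unstable H RHp" "right_stable H RHm" "left_matrices RHp RHm LHp LHm"
    and Ri: "Rip = R_infinity A11 A12 R1p RHm" "Rim = R_infinity A11 A12 R1m RHp"
      "left_matrices Rip Rim Lip Lim"
    and A11pm: "A11p = A11 * R1p * L1p" "A11m = A11 * R1m * L1m"
    and b: "\<forall>t\<ge>0. b t \<in> carrier_vec (num_pos_eigenvalues A)"
    and lam: "lam > 0"
  shows
    "(\<forall>\<tau> h (u :: real \<Rightarrow> nat \<Rightarrow> nat \<Rightarrow> real vec) v u0 v0.
        0 < \<tau> \<longrightarrow> 0 < h \<longrightarrow> \<tau> / h = lam \<longrightarrow>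
        (\<forall>\<^sub>F \<epsilon> in at_right 0.
           (\<forall>j n. u \<epsilon> j n \<in> carrier_vec m \<and> v \<epsilon> j n \<in> carrier_vec r) \<and>
           ap_scheme A Q B b (RAp, RAm, LAp, LAm) (Rip, Rim, Lip, Lim) \<tau> h \<epsilon>
             (\<lambda>j n. u \<epsilon> j n @\<^sub>v v \<epsilon> j n) \<and>
           (\<forall>j\<ge>1. v \<epsilon> j 0 = 0\<^sub>v r)) \<longrightarrow>
        (\<forall>j n. u0 j n \<in> carrier_vec m \<and> v0 j n \<in> carrier_vec r \<and>
           vec_tendsto (\<lambda>\<epsilon>. u \<epsilon> j n) (u0 j n) (at_right 0) \<and>
           vec_tendsto (\<lambda>\<epsilon>. v \<epsilon> j n) (v0 j n) (at_right 0)) \<longrightarrow>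
        (\<forall>n.
           first_cell_residual A11 A12 A11p A11m lam u0 v0 n = 0\<^sub>v m \<and>
           (\<forall>j\<ge>2. interior_residual A11p A11m lam u0 j n = 0\<^sub>v m) \<and>
           (\<forall>j\<ge>1. v0 j (n+1) = 0\<^sub>v r) \<and>
           LHp *\<^sub>v v0 0 (n+1) = 0\<^sub>v (dim_row LHp) \<and>
           boundary_residual A11 A12 L1m lam u0 v0 n = 0\<^sub>v (dim_row L1m) \<and>
           Bu *\<^sub>v u0 0 (n+1) + Bv *\<^sub>v v0 0 (n+1) = b (real (n+1) * \<tau>)))
     \<and>
     (\<forall>ubar nu. asymptotic_limit m r A11 A12 Bu Bv LHp b ubar nu \<longrightarrow>
        (\<forall>K. compact K \<longrightarrow> K \<subseteq> quadrant \<longrightarrow>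
           (\<exists>C. \<exists>\<tau>0>0. \<forall>\<tau> h. 0 < \<tau> \<longrightarrow> \<tau> < \<tau>0 \<longrightarrow> 0 < h \<longrightarrow> \<tau> / h = lam \<longrightarrow>
              (let u = u_lim A11 A12 ubar nu \<tau> h; v = v_lim r nu \<tau> in
                 (\<forall>n. (h, real n * \<tau>) \<in> K \<longrightarrow>
                    vec_bounded_by (first_cell_residual A11 A12 A11p A11m lam u v n) (C * \<tau>^2)) \<and>
                 (\<forall>n. \<forall>j\<ge>2. (real j * h, real n * \<tau>) \<in> K \<longrightarrow>
                    vec_bounded_by (interior_residual A11p A11m lam u j n) (C * \<tau>^2)) \<and>
                 (\<forall>n. (0, real n * \<tau>) \<in> K \<longrightarrow>
                    vec_bounded_by (boundary_residual A11 A12 L1m lam u v n) (C * \<tau>))))) \<and>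
        (\<forall>\<tau> h. 0 < \<tau> \<longrightarrow> 0 < h \<longrightarrow> \<tau> / h = lam \<longrightarrow>
           (let u = u_lim A11 A12 ubar nu \<tau> h; v = v_lim r nu \<tau> in
              \<forall>n.
                (\<forall>j\<ge>1. v j (n+1) = 0\<^sub>v r) \<and>
                LHp *\<^sub>v v 0 (n+1) = 0\<^sub>v (dim_row LHp) \<and>
                Bu *\<^sub>v u 0 (n+1) + Bv *\<^sub>v v 0 (n+1) = b (real (n+1) * \<tau>))))"
proof -
  note s1 = spectral_splitting[OF A11 _ R1]
  have s1: "invariant_splitting m (dim_col R1p) (dim_col R1m) A11 R1p R1m L1p L1m"
    \<comment> \<open>For A_11 the absence of imaginary eigenvalues follows from hyperbolicity and
      the non-characteristic boundary, whereas for H it is assumed.\<close>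
    by (rule s1) (use real_diagonalizable_no_imaginary_eigenvalue[OF A11 hyperbolic(2) noncharacteristic(2)] in blast)
  note i = minv_invertible[OF A11 noncharacteristic(2)]
  have schur: "A22 - A21 * minv A11 * A12 \<in> carrier_mat r r"
    by (rule minus_carrier_mat[OF mult_carrier_mat[OF mult_carrier_mat[OF A21 i(1)] A12]])
  have Xc: "X \<in> carrier_mat r r"
    unfolding X using minv_injective(1)[OF schur]
      schur_complement_injective[OF A11 A12 A21 A22 noncharacteristic(2) noncharacteristic(1)[unfolded A]] by blast
  have Sc: "S \<in> carrier_mat r r" using S unfolding negative_definite_def by blast
  have Hc: "H \<in> carrier_mat r r" unfolding H by (rule mult_carrier_mat[OF Xc Sc])
  have sH: "invariant_splitting r (dim_col RHp) (dim_col RHm) (minv (A22 - A21 * minv A11 * A12) * S) RHp RHm LHp LHm"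
    using spectral_splitting[OF Hc H_no_imaginary RH] unfolding H X .
  interpret bs: boundary_scheme m r "dim_col R1p" "dim_col R1m" "dim_col RHp" "dim_col RHm"
    A11 A12 A21 A22 S A Q R1p R1m L1p L1m RHp RHm LHp LHm Rip Rim Lip Lim
    by (rule boundary_scheme.intro[OF A11 A12 A21 A22 A S Q noncharacteristic s1 sH Ri])
  have dims: "dim_row LHp = dim_col RHp" "dim_row L1m = dim_col R1m"
    using carrier_matD(1)[OF bs.sH.Lp] carrier_matD(1)[OF bs.s1.Lm] by auto
  show ?thesis
    unfolding A11pm dims
  proof (intro conjI allI impI)
    fix \<tau> h :: real and u v :: "real \<Rightarrow> nat \<Rightarrow> nat \<Rightarrow> real vec" and u0 v0 n
    assume t: "0 < \<tau>" and h: "0 < h" and th: "\<tau> / h = lam"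
      and ev: "\<forall>\<^sub>F \<epsilon> in at_right 0.
           (\<forall>j n. u \<epsilon> j n \<in> carrier_vec m \<and> v \<epsilon> j n \<in> carrier_vec r) \<and>
           ap_scheme A Q B b (RAp, RAm, LAp, LAm) (Rip, Rim, Lip, Lim) \<tau> h \<epsilon>
             (\<lambda>j n. u \<epsilon> j n @\<^sub>v v \<epsilon> j n) \<and>
           (\<forall>j\<ge>1. v \<epsilon> j 0 = 0\<^sub>v r)"
      and lim: "\<forall>j n. u0 j n \<in> carrier_vec m \<and> v0 j n \<in> carrier_vec r \<and>
           vec_tendsto (\<lambda>\<epsilon>. u \<epsilon> j n) (u0 j n) (at_right 0) \<and>
           vec_tendsto (\<lambda>\<epsilon>. v \<epsilon> j n) (v0 j n) (at_right 0)"
    have bd: "b (real (n + 1) * \<tau>) \<in> carrier_vec (num_pos_eigenvalues A)" for n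
      using b t by simp
    note limiting = bs.limiting_scheme[OF Bu Bv B bd t th ev lim]
    show "first_cell_residual A11 A12 (A11 * R1p * L1p) (A11 * R1m * L1m) lam u0 v0 n = 0\<^sub>v m"
      by (rule limiting(1))
    show "interior_residual (A11 * R1p * L1p) (A11 * R1m * L1m) lam u0 j n = 0\<^sub>v m" if "j \<ge> 2" for j
      by (rule limiting(2)[OF that])
    show "v0 j (n + 1) = 0\<^sub>v r" if "j \<ge> 1" for j by (rule limiting(3)[OF that])
    show "LHp *\<^sub>v v0 0 (n + 1) = 0\<^sub>v (dim_col RHp)" by (rule limiting(4))
    show "boundary_residual A11 A12 L1m lam u0 v0 n = 0\<^sub>v (dim_col R1m)" by (rule limiting(5))
    show "Bu *\<^sub>v u0 0 (n + 1) + Bv *\<^sub>v v0 0 (n + 1) = b (real (n + 1) * \<tau>)" by (rule limiting(6))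
  next
    fix ubar nu and K :: "(real \<times> real) set"
    assume lim: "asymptotic_limit m r A11 A12 Bu Bv LHp b ubar nu" and K: "compact K" "K \<subseteq> quadrant"
    show "\<exists>C. \<exists>\<tau>0>0. \<forall>\<tau> h. 0 < \<tau> \<longrightarrow> \<tau> < \<tau>0 \<longrightarrow> 0 < h \<longrightarrow> \<tau> / h = lam \<longrightarrow>
        (let u = u_lim A11 A12 ubar nu \<tau> h; v = v_lim r nu \<tau> in
           (\<forall>n. (h, real n * \<tau>) \<in> K \<longrightarrow>
              vec_bounded_by (first_cell_residual A11 A12 (A11 * R1p * L1p) (A11 * R1m * L1m) lam u v n) (C * \<tau>^2)) \<and>
           (\<forall>n. \<forall>j\<ge>2. (real j * h, real n * \<tau>) \<in> K \<longrightarrow>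
              vec_bounded_by (interior_residual (A11 * R1p * L1p) (A11 * R1m * L1m) lam u j n) (C * \<tau>^2)) \<and>
           (\<forall>n. (0, real n * \<tau>) \<in> K \<longrightarrow>
              vec_bounded_by (boundary_residual A11 A12 L1m lam u v n) (C * \<tau>)))"
      (is "\<exists>C. \<exists>\<tau>0>0. \<forall>\<tau> h. _ \<longrightarrow> _ \<longrightarrow> _ \<longrightarrow> _ \<longrightarrow> ?bounds C \<tau> h")
    proof -
      obtain C where C: "\<forall>\<tau> h. 0 < \<tau> \<longrightarrow> \<tau> < 1 \<longrightarrow> 0 < h \<longrightarrow> \<tau> / h = lam \<longrightarrow> ?bounds C \<tau> h"
        using bs.limit_consistency[OF lim lam K] unfolding Let_def by (rule exE)
      \<comment> \<open>The witness for \<open>\<tau>0\<close> is 1, the threshold built into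
        \<open>limit_consistency\<close>, where it keeps the stencil inside the enlarged
        rectangle.\<close>
      show ?thesis
      proof (rule exI, rule exI, rule conjI)
        show "(0::real) < 1" by simp
      qed (rule C)
    qed
  next
    fix ubar nu and \<tau> h :: real
    assume lim: "asymptotic_limit m r A11 A12 Bu Bv LHp b ubar nu" and t: "0 < \<tau>"
    show "let u = u_lim A11 A12 ubar nu \<tau> h; v = v_lim r nu \<tau> in
        \<forall>n. (\<forall>j\<ge>1. v j (n+1) = 0\<^sub>v r) \<and>
          LHp *\<^sub>v v 0 (n+1) = 0\<^sub>v (dim_col RHp) \<and>
          Bu *\<^sub>v u 0 (n+1) + Bv *\<^sub>v v 0 (n+1) = b (real (n+1) * \<tau>)"
      using bs.limit_exact[OF lim Bu Bv t] unfolding Let_def by (auto simp: v_lim_def)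
  qed
qed

end
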